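(* There is an algorithm that, given a graph $G=(V,E)$ with $n$ vertices and $m$ edges and a positive integer $k$, finds a set $S\subseteq E$ with $|S|\le k$ such that $(V,E\setminus S)$ is trivially perfect if such a set exists, and answers "No" otherwise, and runs in $O(2.450^k(n+m))$ time.
   Context: Graphs are finite, simple and undirected. A graph is trivially perfect if it has no induced subgraph isomorphic to $P_4$ (the path on four vertices) or $C_4$ (the cycle on four vertices). *)

theory Defs
  imports Complex_Main
begin

section \<open>Finite simple graphs\<close>

text \<open>An edge is the two-element set of its end vertices.\<close>

type_synonym 'a graph = "'a set \<times> 'a set set"

definition simple_graph :: "'a graph \<Rightarrow> bool" where
  "simple_graph G \<longleftrightarrow> finite (fst G) \<and>
     snd G \<subseteq> {{u, v} | u v. u \<in> fst G \<and> v \<in> fst G \<and> u \<noteq> v}"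

definition induced_subgraph :: "'a graph \<Rightarrow> 'a set \<Rightarrow> 'a graph" where
  "induced_subgraph G W = (W, {e \<in> snd G. e \<subseteq> W})"

definition isomorphic :: "'a graph \<Rightarrow> 'b graph \<Rightarrow> bool" where
  "isomorphic G H \<longleftrightarrow>
     (\<exists>f. bij_betw f (fst G) (fst H) \<and> snd H = (\<lambda>e. f ` e) ` snd G)"

definition P4 :: "nat graph" where
  "P4 = ({0, 1, 2, 3}, {{0, 1}, {1, 2}, {2, 3}})"

definition C4 :: "nat graph" where
  "C4 = ({0, 1, 2, 3}, {{0, 1}, {1, 2}, {2, 3}, {3, 0}})"

definition trivially_perfect :: "'a graph \<Rightarrow> bool" where
  "trivially_perfect G \<longleftrightarrow>
     (\<forall>W \<subseteq> fst G. \<not> isomorphic (induced_subgraph G W) P4 \<and>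
                   \<not> isomorphic (induced_subgraph G W) C4)"

definition tp_deletion_set :: "'a graph \<Rightarrow> nat \<Rightarrow> 'a set set \<Rightarrow> bool" where
  "tp_deletion_set G k S \<longleftrightarrow>
     S \<subseteq> snd G \<and> card S \<le> k \<and> trivially_perfect (fst G, snd G - S)"


section \<open>Random access machine programs with unit-cost operations\<close>

text \<open>
  Programs are while-programs over a random access memory of natural numbers, consisting of
  registers and arrays, both named by numbers. A program is a finite syntactic object and hence
  uses finitely many registers and arrays; arrays are unbounded and indexed by computed values.
  The arithmetic operations are addition and truncated subtraction only.

  The semantics has a word bound \<open>W\<close>: an expression can be evaluated only if its value and the
  values of all its subexpressions (array indices in particular) are less than \<open>W\<close>. An execution
  that would exceed the bound is stuck, that is, it has no derivation in \<open>exec\<close>. Every operator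
  evaluated, every memory access and every command costs one time unit.
\<close>

record memory =
  reg :: "nat \<Rightarrow> nat"
  arr :: "nat \<Rightarrow> nat \<Rightarrow> nat"

datatype aexp =
    Const nat
  | Reg nat
  | Arr nat aexp
  | Add aexp aexp
  | Sub aexp aexp

datatype bexp =
    Less aexp aexp
  | Eq aexp aexp
  | Not bexp
  | And bexp bexp

datatype com =
    Skip
  | Set_Reg nat aexp
  | Set_Arr nat aexp aexp
  | Seq com com
  | If bexp com com
  | While bexp com

primrec aval :: "aexp \<Rightarrow> memory \<Rightarrow> nat" where
  "aval (Const c) s = c"
| "aval (Reg x) s = reg s x"
| "aval (Arr a e) s = arr s a (aval e s)"
| "aval (Add e f) s = aval e s + aval f s"
| "aval (Sub e f) s = aval e s - aval f s"

primrec afits :: "nat \<Rightarrow> aexp \<Rightarrow> memory \<Rightarrow> bool" where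
  "afits W (Const c) s \<longleftrightarrow> c < W"
| "afits W (Reg x) s \<longleftrightarrow> reg s x < W"
| "afits W (Arr a e) s \<longleftrightarrow> afits W e s \<and> arr s a (aval e s) < W"
| "afits W (Add e f) s \<longleftrightarrow> afits W e s \<and> afits W f s \<and> aval e s + aval f s < W"
| "afits W (Sub e f) s \<longleftrightarrow> afits W e s \<and> afits W f s"

primrec acost :: "aexp \<Rightarrow> nat" where
  "acost (Const c) = 1"
| "acost (Reg x) = 1"
| "acost (Arr a e) = 1 + acost e"
| "acost (Add e f) = 1 + acost e + acost f"
| "acost (Sub e f) = 1 + acost e + acost f"

primrec bval :: "bexp \<Rightarrow> memory \<Rightarrow> bool" where
  "bval (Less e f) s \<longleftrightarrow> aval e s < aval f s"
| "bval (Eq e f) s \<longleftrightarrow> aval e s = aval f s"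
| "bval (Not b) s \<longleftrightarrow> \<not> bval b s"
| "bval (And b c) s \<longleftrightarrow> bval b s \<and> bval c s"

primrec bfits :: "nat \<Rightarrow> bexp \<Rightarrow> memory \<Rightarrow> bool" where
  "bfits W (Less e f) s \<longleftrightarrow> afits W e s \<and> afits W f s"
| "bfits W (Eq e f) s \<longleftrightarrow> afits W e s \<and> afits W f s"
| "bfits W (Not b) s \<longleftrightarrow> bfits W b s"
| "bfits W (And b c) s \<longleftrightarrow> bfits W b s \<and> bfits W c s"

primrec bcost :: "bexp \<Rightarrow> nat" where
  "bcost (Less e f) = 1 + acost e + acost f"
| "bcost (Eq e f) = 1 + acost e + acost f"
| "bcost (Not b) = 1 + bcost b"
| "bcost (And b c) = 1 + bcost b + bcost c"

text \<open>\<open>exec W p s t s'\<close>: with word bound \<open>W\<close>, program \<open>p\<close> started in memory \<open>s\<close> halts after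
  exactly \<open>t\<close> time units in memory \<open>s'\<close>.\<close>

inductive exec :: "nat \<Rightarrow> com \<Rightarrow> memory \<Rightarrow> nat \<Rightarrow> memory \<Rightarrow> bool" for W where
  Skip: "exec W Skip s 1 s"
| Set_Reg: "afits W e s \<Longrightarrow>
    exec W (Set_Reg x e) s (1 + acost e) (s\<lparr>reg := (reg s)(x := aval e s)\<rparr>)"
| Set_Arr: "afits W i s \<Longrightarrow> afits W e s \<Longrightarrow>
    exec W (Set_Arr a i e) s (1 + acost i + acost e)
      (s\<lparr>arr := (arr s)(a := (arr s a)(aval i s := aval e s))\<rparr>)"
| Seq: "exec W p s t s' \<Longrightarrow> exec W q s' t' s'' \<Longrightarrow> exec W (Seq p q) s (1 + t + t') s''"
| If_True: "bfits W b s \<Longrightarrow> bval b s \<Longrightarrow> exec W p s t s' \<Longrightarrow>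
    exec W (If b p q) s (1 + bcost b + t) s'"
| If_False: "bfits W b s \<Longrightarrow> \<not> bval b s \<Longrightarrow> exec W q s t s' \<Longrightarrow>
    exec W (If b p q) s (1 + bcost b + t) s'"
| While_False: "bfits W b s \<Longrightarrow> \<not> bval b s \<Longrightarrow>
    exec W (While b p) s (1 + bcost b) s"
| While_True: "bfits W b s \<Longrightarrow> bval b s \<Longrightarrow> exec W p s t s' \<Longrightarrow>
    exec W (While b p) s' t' s'' \<Longrightarrow>
    exec W (While b p) s (1 + bcost b + t + t') s''"

inductive_cases exec_SkipE: "exec W Skip s t s'"
inductive_cases exec_Set_RegE: "exec W (Set_Reg x e) s t s'"
inductive_cases exec_Set_ArrE: "exec W (Set_Arr a i e) s t s'"
inductive_cases exec_SeqE: "exec W (Seq p q) s t s'"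
inductive_cases exec_IfE: "exec W (If b p q) s t s'"
inductive_cases exec_WhileE: "exec W (While b p) s t s'"

lemma exec_deterministic:
  "exec W p s t s' \<Longrightarrow> exec W p s u s'' \<Longrightarrow> u = t \<and> s'' = s'"
proof (induction arbitrary: u s'' rule: exec.induct)
  case Skip
  then show ?case by (auto elim: exec_SkipE)
next
  case Set_Reg
  then show ?case by (auto elim: exec_Set_RegE)
next
  case Set_Arr
  then show ?case by (auto elim: exec_Set_ArrE)
next
  case (Seq p s t s1 q t' s2)
  from Seq.prems obtain v r v' where "exec W p s v r" "exec W q r v' s''" "u = 1 + v + v'"
    by (rule exec_SeqE) simp
  with Seq.IH(1)[of v r] Seq.IH(2)[of v' s''] show ?case by simp
next
  case (If_True b s p t s1 q)
  from If_True.prems If_True.hyps obtain v where "exec W p s v s''" "u = 1 + bcost b + v"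
    by (auto elim: exec_IfE)
  with If_True.IH[of v s''] show ?case by simp
next
  case (If_False b s q t s1 p)
  from If_False.prems If_False.hyps obtain v where "exec W q s v s''" "u = 1 + bcost b + v"
    by (auto elim: exec_IfE)
  with If_False.IH[of v s''] show ?case by simp
next
  case While_False
  from While_False.prems show ?case by (rule exec_WhileE) (use While_False.hyps in simp_all)
next
  case (While_True b s p t s1 t' s2)
  from While_True.prems obtain v r v' where
    "exec W p s v r" "exec W (While b p) r v' s''" "u = 1 + bcost b + v + v'"
    by (rule exec_WhileE) (use While_True.hyps in simp_all)
  with While_True.IH(1)[of v r] While_True.IH(2)[of v' s''] show ?case by simp
qed


section \<open>Input and output\<close>

text \<open>A list of pairs represents the edge set \<open>E\<close> if it lists every edge exactly once, in any
  order and with the end vertices of each edge in any order.\<close>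

definition edge_list :: "nat set set \<Rightarrow> (nat \<times> nat) list \<Rightarrow> bool" where
  "edge_list E es \<longleftrightarrow> distinct (map (\<lambda>(u, v). {u, v}) es) \<and> (\<lambda>(u, v). {u, v}) ` set es = E"

text \<open>Registers 0, 1, 2 hold the number of vertices, the number of edges and the parameter;
  the end vertices of the \<open>i\<close>-th edge are in cell \<open>i\<close> of arrays 0 and 1. All other memory
  is zero.\<close>

definition input :: "nat \<Rightarrow> (nat \<times> nat) list \<Rightarrow> nat \<Rightarrow> memory" where
  "input n es k =
     \<lparr>reg = (\<lambda>_. 0)(0 := n, 1 := length es, 2 := k),
      arr = (\<lambda>_ _. 0)(0 := (\<lambda>i. if i < length es then fst (es ! i) else 0),
                      1 := (\<lambda>i. if i < length es then snd (es ! i) else 0))\<rparr>"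

text \<open>On halting, the answer is ``No'' (represented by \<open>None\<close>) if register 3 holds zero; otherwise
  it is the set of edges whose end vertices are listed in arrays 2 and 3, register 4 holding the
  length of the list.\<close>

definition answer :: "memory \<Rightarrow> nat set set option" where
  "answer s = (if reg s 3 = 0 then None
               else Some {{arr s 2 i, arr s 3 i} | i. i < reg s 4})"

definition correct_answer :: "nat graph \<Rightarrow> nat \<Rightarrow> nat set set option \<Rightarrow> bool" where
  "correct_answer G k ans \<longleftrightarrow>
     (case ans of Some S \<Rightarrow> tp_deletion_set G k S
                | None \<Rightarrow> \<not> (\<exists>S. tp_deletion_set G k S))"

end

theory Submission
  imports Defs
begin

text \<open>
  A graph is trivially perfect iff it has no path \<open>a, b, c, d\<close> with non-edges \<open>ac\<close> and \<open>bd\<close>. The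
  algorithm is a search tree. An induced \<open>C4\<close> must lose two of its edges, which gives six branches of
  cost 2 and the rate \<open>sqrt 6 < 2.450\<close>. For an induced \<open>P4\<close>, consider the reversal of the path. If it
  preserves the adjacencies to all other vertices, it extends to an automorphism of the graph, so
  deleting \<open>ab\<close> and deleting \<open>cd\<close> are equivalent and two branches of cost 1 remain. Otherwise a
  fifth vertex breaks the symmetry; it yields either a \<open>C4\<close> or a five-vertex graph in which several
  \<open>P4\<close>s interact, with cost vector \<open>(1, 1, 2)\<close> or \<open>(1, 2, 2, 3, 3)\<close>. All these vectors satisfy
  \<open>sum of 2.450^(-c) \<le> 0.9997\<close>, so the tree has \<open>O(2.450^k)\<close> nodes.

  A node takes linear time. Order the vertices by decreasing degree and let the parent of \<open>v\<close> be its
  latest neighbour before \<open>v\<close>. If \<open>N[v] \<subseteq> N[p]\<close> for each \<open>v\<close> with parent \<open>p\<close>, the graph is trivially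
  perfect. If \<open>y \<in> N[v] - N[p]\<close>, then comparing degrees gives \<open>x \<in> N[p] - N[v]\<close>, and \<open>x, p, v, y\<close> is an
  obstruction. Adjacency is tested in constant time with a matrix that is never initialised: it
  relies on memory being zero at the start, and row offsets are computed by repeated addition.
\<close>


section \<open>Obstructions and branching rules\<close>

text \<open>Leaving \<open>ad\<close> free in an obstruction merges \<open>P4\<close> and
  \<open>C4\<close>, so one notion serves the characterisation, the search and the branching. A node
  is a set \<open>D\<close> of edges removed from the original graph, and the question asked there
  is whether \<open>D\<close> extends to a solution of size at most \<open>k\<close>. Most rules
  show that every solution above \<open>D\<close> contains one of the branches; the symmetric rule
  cannot, since a solution may meet the path in \<open>cd\<close> alone, and it exchanges the
  solution for a mirror image. There is little room in the count: \<open>6 / 2.450^2\<close> is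
  about 0.99958, and the gap to 1 is what makes a weighted sum over the stack fall by at least one
  per popped entry. Since \<open>exec\<close> is stuck as soon as a value reaches the word bound,
  correctness cannot be separated from range invariants: stored parents must denote vertices,
  identifiers stay within \<open>m\<close>, and the stack height has to be bounded linearly in
  \<open>k\<close>.\<close>

definition obstruction :: "'a set set \<Rightarrow> 'a \<Rightarrow> 'a \<Rightarrow> 'a \<Rightarrow> 'a \<Rightarrow> bool" where
  "obstruction F a b c d \<longleftrightarrow> distinct [a, b, c, d] \<and>
     {a, b} \<in> F \<and> {b, c} \<in> F \<and> {c, d} \<in> F \<and> {a, c} \<notin> F \<and> {b, d} \<notin> F"

lemma simple_graph_edgeE:
  assumes "simple_graph (V, F)" "e \<in> F"
  obtains u v where "e = {u, v}" "u \<in> V" "v \<in> V" "u \<noteq> v"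
  using assms unfolding simple_graph_def by fastforce

lemma simple_graph_edgeD:
  assumes "simple_graph (V, F)" "{u, v} \<in> F"
  shows "u \<in> V" "v \<in> V" "u \<noteq> v"
  using assms by (auto elim!: simple_graph_edgeE simp: doubleton_eq_iff)

lemma simple_graph_finite_edges:
  assumes "simple_graph (V, F)" shows "finite F"
proof -
  have "F \<subseteq> Pow V" using assms by (auto elim: simple_graph_edgeE)
  then show ?thesis using assms by (auto simp: simple_graph_def intro: finite_subset)
qed

lemma simple_graph_Diff: "simple_graph (V, F) \<Longrightarrow> simple_graph (V, F - D)"
  by (auto simp: simple_graph_def)

text \<open>A graph on four vertices is determined by its six pairs, so comparing these suffices.
  Keeping \<open>H\<close> abstract lets one proof serve both \<open>P4\<close> and
  \<open>C4\<close>.\<close>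

lemma four_vertex_isomorphism:
  fixes H :: "nat graph"
  assumes F: "simple_graph (V, F)" and d: "distinct [a, b, c, d]"
    and V: "fst H = {0, 1, 2, 3}"
    and H: "snd H \<subseteq> {{0, 1}, {0, 2}, {0, 3}, {1, 2}, {1, 3}, {2, 3}}"
    and e: "{a, b} \<in> F \<longleftrightarrow> {0, 1} \<in> snd H" "{a, c} \<in> F \<longleftrightarrow> {0, 2} \<in> snd H"
      "{a, d} \<in> F \<longleftrightarrow> {0, 3} \<in> snd H" "{b, c} \<in> F \<longleftrightarrow> {1, 2} \<in> snd H"
      "{b, d} \<in> F \<longleftrightarrow> {1, 3} \<in> snd H" "{c, d} \<in> F \<longleftrightarrow> {2, 3} \<in> snd H"
  shows "isomorphic (induced_subgraph (V, F) {a, b, c, d}) H"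
proof -
  define f where "f x = (if x = a then 0 else if x = b then 1 else if x = c then 2 else 3 :: nat)" for x
  have f: "f a = 0" "f b = 1" "f c = 2" "f d = 3"
    using d by (auto simp: f_def)
  have "bij_betw f {a, b, c, d} {0, 1, 2, 3}"
    unfolding bij_betw_def inj_on_def using f d by simp
  moreover
  let ?P = "{{a, b}, {a, c}, {a, d}, {b, c}, {b, d}, {c, d}}"
  have "{e \<in> F. e \<subseteq> {a, b, c, d}} = {e \<in> ?P. e \<in> F}"
  proof (intro set_eqI iffI)
    fix e assume "e \<in> {e \<in> F. e \<subseteq> {a, b, c, d}}"
    then obtain u v where "e = {u, v}" "u \<in> {a, b, c, d}" "v \<in> {a, b, c, d}" "u \<noteq> v" "e \<in> F"
      using F by (auto elim: simple_graph_edgeE)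
    then show "e \<in> {e \<in> ?P. e \<in> F}" by (auto simp: insert_commute)
  qed auto
  have img: "f ` {a, b} = {0, 1}" "f ` {a, c} = {0, 2}" "f ` {a, d} = {0, 3}"
      "f ` {b, c} = {1, 2}" "f ` {b, d} = {1, 3}" "f ` {c, d} = {2, 3}"
    by (simp_all add: f)
  have "snd H = (\<lambda>e. f ` e) ` {e \<in> ?P. e \<in> F}"
  proof (intro set_eqI iffI)
    fix h assume h: "h \<in> snd H"
    with H consider "h = {0, 1}" | "h = {0, 2}" | "h = {0, 3}" | "h = {1, 2}" | "h = {1, 3}" | "h = {2, 3}"
      by blast
    then show "h \<in> (\<lambda>e. f ` e) ` {e \<in> ?P. e \<in> F}"
    proof cases
      case 1 with h e(1) have "{a, b} \<in> {e \<in> ?P. e \<in> F}" "h = f ` {a, b}" using img(1) by simp_all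
      then show ?thesis by (rule rev_image_eqI)
 next
      case 2 with h e(2) have "{a, c} \<in> {e \<in> ?P. e \<in> F}" "h = f ` {a, c}" using img(2) by simp_all
      then show ?thesis by (rule rev_image_eqI)
 next
      case 3 with h e(3) have "{a, d} \<in> {e \<in> ?P. e \<in> F}" "h = f ` {a, d}" using img(3) by simp_all
      then show ?thesis by (rule rev_image_eqI)
 next
      case 4 with h e(4) have "{b, c} \<in> {e \<in> ?P. e \<in> F}" "h = f ` {b, c}" using img(4) by simp_all
      then show ?thesis by (rule rev_image_eqI)
 next
      case 5 with h e(5) have "{b, d} \<in> {e \<in> ?P. e \<in> F}" "h = f ` {b, d}" using img(5) by simp_all
      then show ?thesis by (rule rev_image_eqI)
 next
      case 6 with h e(6) have "{c, d} \<in> {e \<in> ?P. e \<in> F}" "h = f ` {c, d}" using img(6) by simp_all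
      then show ?thesis by (rule rev_image_eqI)
    qed
  next
    fix h assume "h \<in> (\<lambda>e. f ` e) ` {e \<in> ?P. e \<in> F}"
    then obtain g where g: "g \<in> ?P" "g \<in> F" "h = f ` g" by blast
    from g(1) have "g = {a, b} \<or> g = {a, c} \<or> g = {a, d} \<or> g = {b, c} \<or> g = {b, d} \<or> g = {c, d}"
      by simp
    then show "h \<in> snd H" by (elim disjE) (use g(2,3) e img in simp_all)
  qed
  ultimately show ?thesis
    unfolding isomorphic_def induced_subgraph_def
    using V \<open>{e \<in> F. e \<subseteq> {a, b, c, d}} = {e \<in> ?P. e \<in> F}\<close> by auto
qed

text \<open>Pulling the labelled vertices back along the bijection gives the obstruction. The pair
  \<open>{0, 3}\<close>, where \<open>P4\<close> and \<open>C4\<close> differ, is left open.\<close>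

lemma isomorphic_obstruction:
  fixes H :: "nat graph"
  assumes i: "isomorphic (W, F) H" and F: "\<And>e. e \<in> F \<Longrightarrow> e \<subseteq> W"
    and V: "fst H = {0, 1, 2, 3}"
    and H: "{0, 1} \<in> snd H" "{1, 2} \<in> snd H" "{2, 3} \<in> snd H" "{0, 2} \<notin> snd H" "{1, 3} \<notin> snd H"
  shows "\<exists>a b c d. {a, b, c, d} \<subseteq> W \<and> obstruction F a b c d"
proof -
  from i V obtain f where f: "bij_betw f W {0, 1, 2, 3}" and H': "snd H = (\<lambda>e. f ` e) ` F"
    by (auto simp: isomorphic_def)
  have inj: "inj_on f W" and im: "f ` W = {0, 1, 2, 3}"
    using f by (auto simp: bij_betw_def)
  have "\<exists>a \<in> W. f a = i" if "i \<in> {0, 1, 2, 3}" for i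
    using that unfolding im[symmetric] by auto
  then obtain a b c d where w: "a \<in> W" "b \<in> W" "c \<in> W" "d \<in> W"
    and v: "f a = 0" "f b = 1" "f c = 2" "f d = 3"
    by (metis insertI1 insertI2)
  have mem: "{u, v} \<in> F" if "{f u, f v} \<in> snd H" "u \<in> W" "v \<in> W" for u v
  proof -
    from that(1) H' obtain e where "e \<in> F" "f ` e = f ` {u, v}" by auto
    then have "e = {u, v}" using inj F that by (subst (asm) inj_on_image_eq_iff[OF inj]) auto
    with \<open>e \<in> F\<close> show ?thesis by simp
  qed
  have non: "{f u, f v} \<in> snd H" if "{u, v} \<in> F" for u v
    using imageI[OF that, of "\<lambda>e. f ` e"] H' by auto
  have "distinct [a, b, c, d]" using v by auto
  then have "obstruction F a b c d"
    using mem[of a b] mem[of b c] mem[of c d] non[of a c] non[of b d] H v w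
    by (auto simp: obstruction_def)
  then show ?thesis using w by (intro exI[of _ a] exI[of _ b] exI[of _ c] exI[of _ d]) auto
qed

lemma trivially_perfect_iff:
  assumes F: "simple_graph (V, F)"
  shows "trivially_perfect (V, F) \<longleftrightarrow> \<not> (\<exists>a b c d. obstruction F a b c d)"
proof (intro iffI notI)
  assume tp: "trivially_perfect (V, F)" and "\<exists>a b c d. obstruction F a b c d"
  then obtain a b c d where o: "obstruction F a b c d" by auto
  then have V: "{a, b, c, d} \<subseteq> V" using simple_graph_edgeD[OF F] by (auto simp: obstruction_def)
  \<comment> \<open>The one pair that an obstruction leaves open decides which of the two forbidden
    graphs is induced.\<close>
  have "isomorphic (induced_subgraph (V, F) {a, b, c, d}) (if {a, d} \<in> F then C4 else P4)"
    using o by (intro four_vertex_isomorphism[OF F])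
      (auto simp: obstruction_def P4_def C4_def doubleton_eq_iff insert_commute)
  then show False using tp V by (auto simp: trivially_perfect_def split: if_splits)
next
  assume no: "\<not> (\<exists>a b c d. obstruction F a b c d)"
  show "trivially_perfect (V, F)"
    unfolding trivially_perfect_def
  proof (intro allI impI)
    fix W assume "W \<subseteq> fst (V, F)"
    let ?F = "{e \<in> F. e \<subseteq> W}"
    \<comment> \<open>Inside \<open>W\<close> the induced edge set agrees with \<open>F\<close>, so
      the two non-edges of the obstruction are non-edges of \<open>F\<close> as well.\<close>
    have up: False if "{a, b, c, d} \<subseteq> W \<and> obstruction ?F a b c d" for a b c d
      using no that unfolding obstruction_def by fastforce
    have P: "\<not> isomorphic (W, ?F) P4"
    proof
      assume "isomorphic (W, ?F) P4"
      from isomorphic_obstruction[OF this] up show False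
        by (force simp: P4_def doubleton_eq_iff)
    qed
    have C: "\<not> isomorphic (W, ?F) C4"
    proof
      assume "isomorphic (W, ?F) C4"
      from isomorphic_obstruction[OF this] up show False
        by (force simp: C4_def doubleton_eq_iff)
    qed
    from P C show "\<not> isomorphic (induced_subgraph (V, F) W) P4 \<and> \<not> isomorphic (induced_subgraph (V, F) W) C4"
      by (simp add: induced_subgraph_def)
  qed
qed

section \<open>Completeness of the branching rules\<close>

definition extendable :: "'a graph \<Rightarrow> nat \<Rightarrow> 'a set set \<Rightarrow> bool" where
  "extendable G k D \<longleftrightarrow> (\<exists>S. tp_deletion_set G k S \<and> D \<subseteq> S)"

lemma tp_deletion_set_no_obstruction:
  assumes "simple_graph (V, E)" "tp_deletion_set (V, E) k S"
  shows "\<not> obstruction (E - S) a b c d"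
  using assms trivially_perfect_iff[OF simple_graph_Diff[OF assms(1), of S]] by (auto simp: tp_deletion_set_def)

text \<open>A chord may still be present at the current node as long as the solution deletes it.
  This admits paths that become obstructions only through other deletions of the solution, which
  \<open>branch_kite\<close> relies on.\<close>

lemma obstruction_hit:
  assumes G: "simple_graph (V, E)" and S: "tp_deletion_set (V, E) k S" "D \<subseteq> S"
    and "distinct [a, b, c, d]" "{a, b} \<in> E - D" "{b, c} \<in> E - D" "{c, d} \<in> E - D"
    and "{a, c} \<notin> E - D \<or> {a, c} \<in> S" "{b, d} \<notin> E - D \<or> {b, d} \<in> S"
  shows "{a, b} \<in> S \<or> {b, c} \<in> S \<or> {c, d} \<in> S"
  using tp_deletion_set_no_obstruction[OF G S(1), of a b c d] assms
  by (auto simp: obstruction_def)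

text \<open>Each rotation of the cycle is an obstruction, so a solution meets any three of the four
  edges and therefore contains at least two of them.\<close>

lemma branch_C4:
  assumes G: "simple_graph (V, E)" and x: "extendable (V, E) k D"
    and o: "obstruction (E - D) a b c d" and ad: "{a, d} \<in> E - D"
  shows "\<exists>X \<in> set [{{a, b}, {b, c}}, {{a, b}, {c, d}}, {{a, b}, {a, d}},
      {{b, c}, {c, d}}, {{b, c}, {a, d}}, {{c, d}, {a, d}}]. extendable (V, E) k (D \<union> X)"
proof -
  from x obtain S where S: "tp_deletion_set (V, E) k S" "D \<subseteq> S" by (auto simp: extendable_def)
  note hit = obstruction_hit[OF G S]
  have "{a, b} \<in> S \<and> {b, c} \<in> S \<or> {a, b} \<in> S \<and> {c, d} \<in> S \<or> {a, b} \<in> S \<and> {a, d} \<in> S \<or>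
      {b, c} \<in> S \<and> {c, d} \<in> S \<or> {b, c} \<in> S \<and> {a, d} \<in> S \<or> {c, d} \<in> S \<and> {a, d} \<in> S"
    using hit[of a b c d] hit[of b c d a] hit[of c d a b] hit[of d a b c] o ad
    unfolding obstruction_def by (simp add: insert_commute) blast
  then show ?thesis using S by (auto simp: extendable_def)
qed

text \<open>Both \<open>a, b, c, d\<close> and \<open>z, a, b, c\<close> are obstructions, whatever
  holds for \<open>zc\<close> and \<open>zd\<close>. They share \<open>ab\<close> and
  \<open>bc\<close>, and a solution avoiding these two contains both remaining edges.\<close>

lemma branch_pendant:
  assumes G: "simple_graph (V, E)" and x: "extendable (V, E) k D"
    and o: "obstruction (E - D) a b c d"
    and z: "z \<notin> {a, b, c, d}" "{z, a} \<in> E - D" "{z, b} \<notin> E - D"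
  shows "\<exists>X \<in> set [{{a, b}}, {{b, c}}, {{c, d}, {z, a}}]. extendable (V, E) k (D \<union> X)"
proof -
  from x obtain S where S: "tp_deletion_set (V, E) k S" "D \<subseteq> S" by (auto simp: extendable_def)
  note hit = obstruction_hit[OF G S]
  have "{a, b} \<in> S \<or> {b, c} \<in> S \<or> {c, d} \<in> S \<and> {z, a} \<in> S"
    using hit[of a b c d] hit[of z a b c] o z
    unfolding obstruction_def by (simp add: insert_commute) blast
  then show ?thesis using S by (auto simp: extendable_def)
qed

text \<open>The obstructions \<open>a, b, c, d\<close> and \<open>z, b, c, d\<close> share
  \<open>bc\<close> and \<open>cd\<close>; a solution avoiding these two contains \<open>ab\<close>
  and \<open>zb\<close>. The pairs \<open>za\<close> and \<open>zd\<close> may be edges or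
  not.\<close>

lemma branch_fork:
  assumes G: "simple_graph (V, E)" and x: "extendable (V, E) k D"
    and o: "obstruction (E - D) a b c d"
    and z: "z \<notin> {a, b, c, d}" "{z, b} \<in> E - D" "{z, c} \<notin> E - D"
  shows "\<exists>X \<in> set [{{b, c}}, {{c, d}}, {{a, b}, {z, b}}]. extendable (V, E) k (D \<union> X)"
proof -
  from x obtain S where S: "tp_deletion_set (V, E) k S" "D \<subseteq> S" by (auto simp: extendable_def)
  note hit = obstruction_hit[OF G S]
  have "{b, c} \<in> S \<or> {c, d} \<in> S \<or> {a, b} \<in> S \<and> {z, b} \<in> S"
    using hit[of a b c d] hit[of z b c d] o z
    unfolding obstruction_def by (simp add: insert_commute) blast
  then show ?thesis using S by (auto simp: extendable_def)
qed

text \<open>If the solution keeps \<open>cd\<close>, the paths \<open>a, b, c, d\<close> and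
  \<open>a, z, c, d\<close> force one of \<open>ab\<close>, \<open>bc\<close> and one of
  \<open>za\<close>, \<open>zc\<close>. The mixed choices do not stop there: without
  \<open>ab\<close> and \<open>zc\<close> the path \<open>a, z, b, c\<close> has no chords, and
  without \<open>bc\<close> and \<open>za\<close> the same holds for \<open>a, b, z, c\<close>.
  Hitting that path either leads back to an unmixed choice or costs \<open>zb\<close>, whence the
  two branches of size 3.\<close>

lemma branch_kite:
  assumes G: "simple_graph (V, E)" and x: "extendable (V, E) k D"
    and o: "obstruction (E - D) a b c d"
    and z: "z \<notin> {a, b, c, d}" "{z, a} \<in> E - D" "{z, b} \<in> E - D" "{z, c} \<in> E - D" "{z, d} \<notin> E - D"
  shows "\<exists>X \<in> set [{{c, d}}, {{a, b}, {z, a}}, {{b, c}, {z, c}},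
      {{a, b}, {z, c}, {z, b}}, {{b, c}, {z, a}, {z, b}}]. extendable (V, E) k (D \<union> X)"
proof -
  from x obtain S where S: "tp_deletion_set (V, E) k S" "D \<subseteq> S" by (auto simp: extendable_def)
  note hit = obstruction_hit[OF G S]
  have "{c, d} \<in> S \<or> {a, b} \<in> S \<and> {z, a} \<in> S \<or> {b, c} \<in> S \<and> {z, c} \<in> S \<or>
      {a, b} \<in> S \<and> {z, c} \<in> S \<and> {z, b} \<in> S \<or> {b, c} \<in> S \<and> {z, a} \<in> S \<and> {z, b} \<in> S"
    using hit[of a b c d] hit[of a z c d] hit[of a z b c] hit[of a b z c] o z
    unfolding obstruction_def by (simp add: insert_commute) blast
  then show ?thesis using S by (auto simp: extendable_def)
qed

lemma obstruction_image:
  assumes "inj f" "obstruction F a b c d"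
  shows "obstruction ((`) f ` F) (f a) (f b) (f c) (f d)"
proof -
  have "inj ((`) f)"
    by (rule injI) (simp only: inj_image_eq_iff[OF assms(1)])
  from inj_image_mem_iff[OF this, of "{_, _}" F]
  have "{f u, f v} \<in> (`) f ` F \<longleftrightarrow> {u, v} \<in> F" for u v
    by simp
  then show ?thesis using assms by (simp add: obstruction_def inj_eq)
qed

text \<open>Swapping \<open>a\<close> with \<open>d\<close> and \<open>b\<close> with
  \<open>c\<close> is an automorphism of the graph remaining at the node, so a solution that meets
  the path only in \<open>cd\<close> can be exchanged for one that contains
  \<open>ab\<close>.\<close>

lemma branch_symmetric:
  assumes G: "simple_graph (V, E)" and x: "extendable (V, E) k D" and D: "D \<subseteq> E"
    and o: "obstruction (E - D) a b c d"
    and z: "\<And>z. z \<in> V \<Longrightarrow> z \<notin> {a, b, c, d} \<Longrightarrow>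
      ({z, a} \<in> E - D \<longleftrightarrow> {z, d} \<in> E - D) \<and> ({z, b} \<in> E - D \<longleftrightarrow> {z, c} \<in> E - D)"
  shows "\<exists>X \<in> set [{{a, b}}, {{b, c}}]. extendable (V, E) k (D \<union> X)"
proof -
  from x obtain S where S: "tp_deletion_set (V, E) k S" "D \<subseteq> S" by (auto simp: extendable_def)
  note no = tp_deletion_set_no_obstruction[OF G S(1)]
  show ?thesis
  proof (cases "{a, b} \<in> S \<or> {b, c} \<in> S")
    case True
    then show ?thesis using S by (auto simp: extendable_def)
  next
    case False
    then have cd: "{c, d} \<in> S"
      using no[of a b c d] o S(2) by (auto simp: obstruction_def)
    define f where "f x = (if x = a then d else if x = d then a else if x = b then c
      else if x = c then b else x)" for x
    have dist: "distinct [a, b, c, d]" using o by (simp add: obstruction_def)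
    have f: "f a = d" "f b = c" "f c = b" "f d = a" using dist by (auto simp: f_def)
    have fz: "f x = x" if "x \<notin> {a, b, c, d}" for x using that by (auto simp: f_def)
    have ff: "f (f x) = x" for x using dist by (auto simp: f_def)
    then have inj: "inj f" by (metis injI)
    have img: "f ` f ` e = e" for e using ff by (simp add: image_image)
    have F: "{u, v} \<in> E - D \<Longrightarrow> {f u, f v} \<in> E - D" for u v
    proof -
      assume uv: "{u, v} \<in> E - D"
      then have V: "u \<in> V" "v \<in> V" "u \<noteq> v" using simple_graph_edgeD[OF G] by auto
      have nb: "{b, c} \<in> E - D" "{a, b} \<in> E - D" "{c, d} \<in> E - D" "{a, c} \<notin> E - D" "{b, d} \<notin> E - D"
        using o by (auto simp: obstruction_def)
      have out: "{f u, f v} \<in> E - D" if "u \<notin> {a, b, c, d}" "{u, v} \<in> E - D" "u \<in> V" for u v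
      proof (cases "v \<in> {a, b, c, d}")
        case True
        then show ?thesis using z[OF that(3,1)] fz[OF that(1)] f that(2) by auto
      next
        case False
        then show ?thesis using fz that by auto
      qed
      consider "u \<notin> {a, b, c, d}" | "v \<notin> {a, b, c, d}" | "u \<in> {a, b, c, d}" "v \<in> {a, b, c, d}" by blast
      then show ?thesis
      proof cases
        case 1 then show ?thesis using out uv V by blast
      next
        case 2 then show ?thesis using out[of v u] uv V by (metis insert_commute)
      next
        case 3
        then have "u = a \<or> u = b \<or> u = c \<or> u = d" "v = a \<or> v = b \<or> v = c \<or> v = d" by simp_all
        then show ?thesis by (elim disjE) (use nb uv V(3) f in \<open>simp_all add: insert_commute\<close>)
      qed
    qed
    have FE: "f ` e \<in> E - D" if "e \<in> E - D" for e
    proof -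
      from that have "e \<in> E" by simp
      then obtain u v where "e = {u, v}" by (rule simple_graph_edgeE[OF G])
      then show ?thesis using F[of u v] that by simp
    qed
    \<comment> \<open>Only the part of the solution beyond \<open>D\<close> is reflected:
      \<open>f\<close> preserves \<open>E - D\<close>, but need not preserve \<open>E\<close> or
      \<open>D\<close>. Since \<open>D\<close> is kept, the new solution is no larger than
      \<open>S\<close>.\<close>
    define T where "T = (`) f ` (S - D)"
    have SE: "S \<subseteq> E" using S by (auto simp: tp_deletion_set_def)
    have TE: "T \<subseteq> E - D" using FE SE by (auto simp: T_def)
    have fin: "finite S" using SE simple_graph_finite_edges[OF G] finite_subset by auto
    have "card T = card (S - D)"
      unfolding T_def by (intro card_image inj_onI) (metis img)
    moreover have "card (D \<union> T) \<le> card D + card T" by (rule card_Un_le)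
    moreover have "card (S - D) = card S - card D" "card D \<le> card S"
      using S fin finite_subset by (auto intro: card_Diff_subset card_mono)
    ultimately have card: "card (D \<union> T) \<le> k" using S by (auto simp: tp_deletion_set_def)
    \<comment> \<open>This inclusion and the next identify \<open>E - S\<close> with the mirror
      image of \<open>E - (D \<union> T)\<close>, so an obstruction left by
      \<open>D \<union> T\<close> would reflect to one left by \<open>S\<close>.\<close>
    have sub: "E - S \<supseteq> (`) f ` (E - (D \<union> T))"
    proof
      fix e assume "e \<in> (`) f ` (E - (D \<union> T))"
      then obtain e' where e': "e = f ` e'" "e' \<in> E - D" "e' \<notin> T" by auto
      have "e \<notin> S - D"
      proof
        assume "e \<in> S - D"
        then have "f ` e \<in> T" by (auto simp: T_def)
        with e' img show False by simp
      qed
      with FE[OF e'(2)] e'(1) show "e \<in> E - S" by auto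
    qed
    have sup: "E - S \<subseteq> (`) f ` (E - (D \<union> T))"
    proof
      fix e assume e: "e \<in> E - S"
      then have "e \<in> E - D" using S by auto
      then have 1: "f ` e \<in> E - D" by (rule FE)
      have "f ` e \<notin> T"
      proof
        assume "f ` e \<in> T"
        then obtain g where "g \<in> S" "f ` e = f ` g" by (auto simp: T_def)
        then have "e = g" by (metis img)
        with \<open>g \<in> S\<close> e show False by simp
      qed
      with 1 have "f ` f ` e \<in> (`) f ` (E - (D \<union> T))" by blast
      then show "e \<in> (`) f ` (E - (D \<union> T))" by (simp add: img)
    qed
    have "\<not> obstruction (E - (D \<union> T)) p q r s" for p q r s
      using obstruction_image[OF inj, of "E - (D \<union> T)" p q r s] no sub sup by auto
    then have "trivially_perfect (V, E - (D \<union> T))"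
      using trivially_perfect_iff[OF simple_graph_Diff[OF G]] by auto
    then have "tp_deletion_set (V, E) k (D \<union> T)"
      using card D TE by (auto simp: tp_deletion_set_def)
    moreover have "{a, b} \<in> D \<union> T"
    proof -
      have "{c, d} \<in> S - D" using cd o by (auto simp: obstruction_def)
      then have "f ` {c, d} \<in> T" unfolding T_def by (rule imageI)
      then show ?thesis using f by (simp add: insert_commute)
    qed
    ultimately show ?thesis by (auto simp: extendable_def)
  qed
qed

section \<open>Domination in the degree order\<close>

definition degree :: "nat set set \<Rightarrow> nat \<Rightarrow> nat" where
  "degree F v = card {w. {v, w} \<in> F}"

text \<open>The tie-break by vertex number turns the comparison of degrees into a strict linear
  order, so that a latest earlier neighbour is unique.\<close>

definition before :: "nat set set \<Rightarrow> nat \<Rightarrow> nat \<Rightarrow> bool" where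
  "before F w v \<longleftrightarrow> degree F v < degree F w \<or> degree F v = degree F w \<and> w < v"

lemma before_linear: "w = v \<or> before F w v \<or> before F v w"
  by (auto simp: before_def)

lemma before_trans: "before F u v \<Longrightarrow> before F v w \<Longrightarrow> before F u w"
  by (auto simp: before_def)

lemma before_irrefl: "\<not> before F v v"
  by (simp add: before_def)

definition is_parent :: "nat set set \<Rightarrow> nat \<Rightarrow> nat \<Rightarrow> bool" where
  "is_parent F v p \<longleftrightarrow> {v, p} \<in> F \<and> before F p v \<and>
     (\<forall>w. {v, w} \<in> F \<and> before F w v \<longrightarrow> w = p \<or> before F w p)"

lemma finite_neighbours:
  fixes v :: nat
  assumes "simple_graph ({..<n}, F)" shows "finite {w. {v, w} \<in> F}"
  by (rule finite_subset[of _ "{..<n}"]) (auto dest: simple_graph_edgeD[OF assms])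

text \<open>Degrees are at most \<open>n\<close>; measuring a vertex by \<open>n - degree\<close>
  and its number embeds the order into a lexicographic order on naturals.\<close>

lemma wf_before:
  assumes F: "simple_graph ({..<n}, F)" shows "wf {(w, v). before F w v}"
proof -
  have "degree F v \<le> n" for v
  proof -
    have "{w. {v, w} \<in> F} \<subseteq> {..<n}" by (auto dest: simple_graph_edgeD[OF F])
    then show ?thesis unfolding degree_def using card_mono[of "{..<n}"] by fastforce
  qed
  then have "n - degree F w < n - degree F v" if "degree F v < degree F w" for v w
    using that by (meson diff_less_mono2 less_le_trans)
  then have "{(w, v). before F w v} \<subseteq> inv_image (less_than <*lex*> less_than) (\<lambda>v. (n - degree F v, v))"
    by (auto simp: before_def)
  then show ?thesis by (rule wf_subset[rotated]) (intro wf_inv_image wf_lex_prod wf_less_than)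
qed

text \<open>Domination passes along parents: an earlier neighbour \<open>w\<close> of
  \<open>v\<close> other than the parent \<open>p\<close> is before \<open>p\<close> and, as
  \<open>p\<close> dominates \<open>v\<close>, adjacent to \<open>p\<close>; the induction
  hypothesis for \<open>p\<close> then carries neighbours of \<open>v\<close> from \<open>p\<close>
  to \<open>w\<close>. So every earlier neighbour dominates, which fails on an obstruction for the
  later of its two middle vertices.\<close>

lemma no_obstruction_if_parents_dominate:
  assumes F: "simple_graph ({..<n}, F)"
    and par: "\<And>v. v < n \<Longrightarrow> (\<exists>w. {v, w} \<in> F \<and> before F w v) \<Longrightarrow> \<exists>p. is_parent F v p \<and>
        (\<forall>y. {v, y} \<in> F \<longrightarrow> y = p \<or> {y, p} \<in> F)"
  shows "\<not> obstruction F a b c d"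
proof -
  have dom: "\<forall>w y. {v, w} \<in> F \<and> before F w v \<and> {v, y} \<in> F \<longrightarrow> y = w \<or> {y, w} \<in> F" for v
  proof (induction v rule: wf_induct_rule[OF wf_before[OF F]])
    case (1 v)
    show ?case
    proof (intro allI impI)
      fix w y assume a: "{v, w} \<in> F \<and> before F w v \<and> {v, y} \<in> F"
      then have "v < n" using simple_graph_edgeD[OF F] by auto
      with par[of v] a obtain p where p: "is_parent F v p"
        and d: "\<And>y. {v, y} \<in> F \<Longrightarrow> y = p \<or> {y, p} \<in> F" by blast
      have pv: "before F p v" using p by (auto simp: is_parent_def)
      from p a consider "w = p" | "before F w p" by (auto simp: is_parent_def)
      then show "y = w \<or> {y, w} \<in> F"
      proof cases
        case 1 then show ?thesis using d a by auto
      next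
        case 2
        then have "{p, w} \<in> F" using d[of w] a before_irrefl[of F p] by (auto simp: insert_commute)
        show ?thesis
        proof (cases "y = p")
          case True
          with \<open>{p, w} \<in> F\<close> show ?thesis by simp
        next
          case False
          with d[of y] a have "{p, y} \<in> F" by (simp add: insert_commute)
          with \<open>{p, w} \<in> F\<close> 1[of p] pv 2 show ?thesis by blast
        qed
      qed
    qed
  qed
  show ?thesis
  proof
    assume o: "obstruction F a b c d"
    then consider "before F b c" | "before F c b"
      using before_linear[of b c F] by (auto simp: obstruction_def)
    then show False
    proof cases
      case 1
      then show False using dom[of c, rule_format, of b d] o
        by (simp add: obstruction_def insert_commute)
    next
      case 2
      then show False using dom[of b, rule_format, of c a] o
        by (simp add: obstruction_def insert_commute)
    qed
  qed
qed

text \<open>The degree of \<open>p\<close> is at least that of \<open>v\<close>. Removing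
  \<open>v\<close> from the neighbours of \<open>p\<close> costs one, removing \<open>p\<close> and
  \<open>y\<close> from those of \<open>v\<close> costs two, so some neighbour of \<open>p\<close>
  is left over. It is not \<open>y\<close>, because \<open>y\<close> and \<open>p\<close> are not
  adjacent.\<close>

lemma undominated_obstruction:
  assumes F: "simple_graph ({..<n}, F)"
    and vp: "{v, p} \<in> F" "before F p v" and y: "{v, y} \<in> F" "y \<noteq> p" "{y, p} \<notin> F"
  shows "\<exists>x < n. {p, x} \<in> F \<and> x \<noteq> v \<and> {v, x} \<notin> F"
    and "{p, x} \<in> F \<Longrightarrow> x \<noteq> v \<Longrightarrow> {v, x} \<notin> F \<Longrightarrow> obstruction F x p v y"
proof -
  note edge = simple_graph_edgeD[OF F]
  have "\<not> {w. {p, w} \<in> F} - {v} \<subseteq> {w. {v, w} \<in> F} - {p, y}"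
  proof
    assume s: "{w. {p, w} \<in> F} - {v} \<subseteq> {w. {v, w} \<in> F} - {p, y}"
    have "card ({w. {p, w} \<in> F} - {v}) \<le> card ({w. {v, w} \<in> F} - {p, y})"
      using finite_neighbours[OF F] by (intro card_mono[OF _ s]) auto
    moreover have "card ({w. {p, w} \<in> F} - {v}) = degree F p - 1"
      using vp by (simp add: degree_def insert_commute)
    moreover have "card ({w. {v, w} \<in> F} - {p, y}) = degree F v - 2"
      unfolding degree_def using y vp by (subst card_Diff_subset) auto
    \<comment> \<open>Makes the truncated \<open>degree F v - 2\<close> a true difference.\<close>
    moreover have "card {p, y} \<le> degree F v"
      unfolding degree_def using y vp finite_neighbours[OF F] by (intro card_mono) auto
    ultimately show False using vp y by (auto simp: before_def)
  qed
  then show "\<exists>x < n. {p, x} \<in> F \<and> x \<noteq> v \<and> {v, x} \<notin> F"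
    using y edge by (auto simp: insert_commute)
  show "obstruction F x p v y" if "{p, x} \<in> F" "x \<noteq> v" "{v, x} \<notin> F"
    using that vp y edge unfolding obstruction_def by (auto simp: insert_commute)
qed

section \<open>Reasoning about programs\<close>

primrec linear_cost :: "com \<Rightarrow> nat" where
  "linear_cost Skip = 1"
| "linear_cost (Set_Reg x e) = 1 + acost e"
| "linear_cost (Set_Arr a i e) = 1 + acost i + acost e"
| "linear_cost (Seq p q) = 1 + linear_cost p + linear_cost q"
| "linear_cost (If b p q) = 1 + bcost b + linear_cost p + linear_cost q"
| "linear_cost (While b p) = 1 + bcost b + linear_cost p"

primrec written_regs :: "com \<Rightarrow> nat set" where
  "written_regs Skip = {}"
| "written_regs (Set_Reg x e) = {x}"
| "written_regs (Set_Arr a i e) = {}"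
| "written_regs (Seq p q) = written_regs p \<union> written_regs q"
| "written_regs (If b p q) = written_regs p \<union> written_regs q"
| "written_regs (While b p) = written_regs p"

primrec written_arrs :: "com \<Rightarrow> nat set" where
  "written_arrs Skip = {}"
| "written_arrs (Set_Reg x e) = {}"
| "written_arrs (Set_Arr a i e) = {a}"
| "written_arrs (Seq p q) = written_arrs p \<union> written_arrs q"
| "written_arrs (If b p q) = written_arrs p \<union> written_arrs q"
| "written_arrs (While b p) = written_arrs p"

text \<open>Read off the syntax once and for all, frames spare the loop invariants from listing what
  a loop leaves unchanged.\<close>

definition frame :: "com \<Rightarrow> memory \<Rightarrow> memory \<Rightarrow> bool" where
  "frame c s s' \<longleftrightarrow> (\<forall>r. r \<notin> written_regs c \<longrightarrow> reg s' r = reg s r) \<and>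
     (\<forall>a. a \<notin> written_arrs c \<longrightarrow> arr s' a = arr s a)"

lemma frame_reg: "frame c s s' \<Longrightarrow> r \<notin> written_regs c \<Longrightarrow> reg s' r = reg s r"
  and frame_arr: "frame c s s' \<Longrightarrow> a \<notin> written_arrs c \<Longrightarrow> arr s' a = arr s a"
  by (simp_all add: frame_def)

lemma exec_frame: "exec W c s t s' \<Longrightarrow> frame c s s'"
  by (induction rule: exec.induct) (auto simp: frame_def)

text \<open>\<open>run W X c s Q\<close>: from \<open>s\<close>, program \<open>c\<close> halts in a memory satisfying \<open>Q\<close>, within its syntactic
  cost times \<open>X\<close>. This is the right form for programs whose loops are not nested and are
  executed fewer than \<open>X\<close> times each.\<close>

definition run :: "nat \<Rightarrow> nat \<Rightarrow> com \<Rightarrow> memory \<Rightarrow> (memory \<Rightarrow> bool) \<Rightarrow> bool" where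
  "run W X c s Q \<longleftrightarrow> (\<exists>t s'. exec W c s t s' \<and> t \<le> linear_cost c * X \<and> Q s')"

lemma run_frame:
  assumes "run W X c s Q" "\<And>s'. Q s' \<Longrightarrow> frame c s s' \<Longrightarrow> R s'"
  shows "run W X c s R"
  using assms exec_frame unfolding run_def by blast

lemma run_mono:
  assumes "run W X c s Q" "\<And>s'. Q s' \<Longrightarrow> R s'" "X \<le> Y"
  shows "run W Y c s R"
proof -
  from assms obtain t s' where "exec W c s t s'" "t \<le> linear_cost c * X" "R s'"
    unfolding run_def by blast
  moreover have "linear_cost c * X \<le> linear_cost c * Y" using assms(3) by simp
  ultimately show ?thesis unfolding run_def using le_trans by blast
qed

lemma run_Seq:
  assumes "run W X p s P" "\<And>s'. P s' \<Longrightarrow> frame p s s' \<Longrightarrow> run W X q s' Q" "1 \<le> X"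
  shows "run W X (Seq p q) s Q"
proof -
  from assms(1) obtain t s' where p: "exec W p s t s'" "t \<le> linear_cost p * X" "P s'"
    unfolding run_def by blast
  with assms(2) exec_frame obtain u s'' where q: "exec W q s' u s''" "u \<le> linear_cost q * X" "Q s''"
    unfolding run_def by blast
  have "1 + t + u \<le> linear_cost (Seq p q) * X"
    using p(2) q(2) assms(3) by (simp add: algebra_simps)
  then show ?thesis using exec.Seq[OF p(1) q(1)] q(3) unfolding run_def by blast
qed

lemma run_If:
  assumes "bfits W b s" "bval b s \<Longrightarrow> run W X p s Q" "\<not> bval b s \<Longrightarrow> run W X q s Q" "1 \<le> X"
  shows "run W X (If b p q) s Q"
proof (cases "bval b s")
  case True
  with assms(2) obtain t s' where p: "exec W p s t s'" "t \<le> linear_cost p * X" "Q s'"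
    unfolding run_def by blast
  have "bcost b \<le> bcost b * X" using assms(4) by simp
  with p(2) have "1 + bcost b + t \<le> linear_cost (If b p q) * X"
    using assms(4) unfolding linear_cost.simps distrib_right mult_1 by linarith
  then show ?thesis using exec.If_True[OF assms(1) True p(1)] p(3) unfolding run_def by blast
next
  case False
  with assms(3) obtain t s' where p: "exec W q s t s'" "t \<le> linear_cost q * X" "Q s'"
    unfolding run_def by blast
  have "bcost b \<le> bcost b * X" using assms(4) by simp
  with p(2) have "1 + bcost b + t \<le> linear_cost (If b p q) * X"
    using assms(4) unfolding linear_cost.simps distrib_right mult_1 by linarith
  then show ?thesis using exec.If_False[OF assms(1) False p(1)] p(3) unfolding run_def by blast
qed

text \<open>The body runs with factor 1, that is, at its syntactic cost. The test is evaluated once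
  more than the body, hence the strict bound \<open>N < X\<close>.\<close>

lemma run_While_count:
  assumes I: "I 0 s"
    and body: "\<And>j s. j < N \<Longrightarrow> I j s \<Longrightarrow> bfits W b s \<and> bval b s \<and> run W 1 p s (I (Suc j))"
    and stop: "\<And>s. I N s \<Longrightarrow> bfits W b s \<and> \<not> bval b s"
    and X: "N < X"
  shows "run W X (While b p) s (I N)"
proof -
  have "\<exists>t s'. exec W (While b p) s t s' \<and> t \<le> linear_cost (While b p) * (N - j + 1) \<and> I N s'"
    if "j \<le> N" "I j s" for j s
    using that
  proof (induction "N - j" arbitrary: j s)
    case 0
    then have "I N s" by simp
    with stop[of s] have "exec W (While b p) s (1 + bcost b) s" "I N s"
      by (blast intro: exec.While_False)+
    then show ?case by (intro exI conjI) (auto simp: 0)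
  next
    case (Suc x)
    then have "j < N" by simp
    with body[OF this Suc.prems(2)] obtain t s' where
      p: "bfits W b s" "bval b s" "exec W p s t s'" "t \<le> linear_cost p" "I (Suc j) s'"
      unfolding run_def by auto
    from Suc.hyps(1)[OF _ _ p(5)] Suc.hyps(2) \<open>j < N\<close> obtain u s'' where
      q: "exec W (While b p) s' u s''" "u \<le> linear_cost (While b p) * (N - Suc j + 1)" "I N s''"
      by fastforce
    have "N - j + 1 = (N - Suc j + 1) + 1" using \<open>j < N\<close> by simp
    then have "1 + bcost b + t + u \<le> linear_cost (While b p) * (N - j + 1)"
      using p(4) q(2) by (simp only: distrib_left linear_cost.simps mult_1_right)
    then show ?case using exec.While_True[OF p(1,2,3) q(1)] q(3) by blast
  qed
  from this[OF _ I] obtain t s' where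
    e: "exec W (While b p) s t s'" "t \<le> linear_cost (While b p) * (N + 1)" "I N s'" by auto
  have "linear_cost (While b p) * (N + 1) \<le> linear_cost (While b p) * X"
    using X by (intro mult_le_mono2) simp
  with e show ?thesis unfolding run_def using le_trans by blast
qed

section \<open>Loop-free code, counting loops and amortised loops\<close>

primrec loop_free :: "com \<Rightarrow> bool" where
  "loop_free Skip \<longleftrightarrow> True"
| "loop_free (Set_Reg x e) \<longleftrightarrow> True"
| "loop_free (Set_Arr a i e) \<longleftrightarrow> True"
| "loop_free (Seq p q) \<longleftrightarrow> loop_free p \<and> loop_free q"
| "loop_free (If b p q) \<longleftrightarrow> loop_free p \<and> loop_free q"
| "loop_free (While b p) \<longleftrightarrow> False"

text \<open>Evaluating loop-free code as a function reduces its verification to rewriting;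
  \<open>fits\<close> collects the word bound conditions met on the way.\<close>

primrec result :: "com \<Rightarrow> memory \<Rightarrow> memory" where
  "result Skip s = s"
| "result (Set_Reg x e) s = s\<lparr>reg := (reg s)(x := aval e s)\<rparr>"
| "result (Set_Arr a i e) s = s\<lparr>arr := (arr s)(a := (arr s a)(aval i s := aval e s))\<rparr>"
| "result (Seq p q) s = result q (result p s)"
| "result (If b p q) s = (if bval b s then result p s else result q s)"
| "result (While b p) s = s"

primrec fits :: "nat \<Rightarrow> com \<Rightarrow> memory \<Rightarrow> bool" where
  "fits W Skip s \<longleftrightarrow> True"
| "fits W (Set_Reg x e) s \<longleftrightarrow> afits W e s"
| "fits W (Set_Arr a i e) s \<longleftrightarrow> afits W i s \<and> afits W e s"
| "fits W (Seq p q) s \<longleftrightarrow> fits W p s \<and> fits W q (result p s)"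
| "fits W (If b p q) s \<longleftrightarrow> bfits W b s \<and> (if bval b s then fits W p s else fits W q s)"
| "fits W (While b p) s \<longleftrightarrow> True"

lemma exec_loop_free:
  "loop_free c \<Longrightarrow> fits W c s \<Longrightarrow> \<exists>t \<le> linear_cost c. exec W c s t (result c s)"
proof (induction c arbitrary: s)
  case Skip
  then show ?case using exec.Skip by fastforce
next
  case (Set_Reg x e)
  then show ?case using exec.Set_Reg[of W e s x] by auto
next
  case (Set_Arr a i e)
  then show ?case using exec.Set_Arr[of W i s e a] by auto
next
  case (Seq p q)
  then obtain t u where "t \<le> linear_cost p" "exec W p s t (result p s)"
    "u \<le> linear_cost q" "exec W q (result p s) u (result q (result p s))" by fastforce
  then show ?case using exec.Seq[of W p s t "result p s" q u]
    by (intro exI[of _ "1 + t + u"]) auto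
next
  case (If b p q)
  show ?case
  proof (cases "bval b s")
    case True
    with If obtain t where "t \<le> linear_cost p" "exec W p s t (result p s)" by fastforce
    then show ?thesis using exec.If_True[of W b s p t "result p s" q] True If.prems
      by (intro exI[of _ "1 + bcost b + t"]) auto
  next
    case False
    with If obtain t where "t \<le> linear_cost q" "exec W q s t (result q s)" by fastforce
    then show ?thesis using exec.If_False[of W b s q t "result q s" p] False If.prems
      by (intro exI[of _ "1 + bcost b + t"]) auto
  qed
next
  case (While b p)
  then show ?case by simp
qed

lemma run_loop_free:
  assumes "loop_free c" "fits W c s" "1 \<le> X" "Q (result c s)"
  shows "run W X c s Q"
proof -
  have "linear_cost c * 1 \<le> linear_cost c * X" using assms(3) by (intro mult_le_mono2)
  then show ?thesis
    using exec_loop_free[OF assms(1,2)] assms(4) unfolding run_def by (metis le_trans mult_1_right)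
qed

lemma run_Seq_loop_free:
  assumes "loop_free c" "fits W c s" "1 \<le> X" "run W X q (result c s) Q"
  shows "run W X (Seq c q) s Q"
  by (rule run_Seq[OF run_loop_free[where Q = "\<lambda>s'. s' = result c s"]]) (use assms in auto)

definition for_loop :: "nat \<Rightarrow> nat \<Rightarrow> com \<Rightarrow> com" where
  "for_loop i n p = Seq (Set_Reg i (Const 0))
     (While (Less (Reg i) (Reg n)) (Seq p (Set_Reg i (Add (Reg i) (Const 1)))))"

lemma written_regs_for_loop [simp]: "written_regs (for_loop i n p) = insert i (written_regs p)"
  and written_arrs_for_loop [simp]: "written_arrs (for_loop i n p) = written_arrs p"
  by (auto simp: for_loop_def)

text \<open>The counter is incremented after the body has established the next instance of
  \<open>P\<close>, so \<open>P\<close> must be insensitive to that register; this is the last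
  assumption. The counter value and the frame since the start of the loop are supplied to the body
  and need not be carried in \<open>P\<close>.\<close>

lemma run_for_loop:
  assumes "loop_free p" "i \<notin> written_regs p" "n \<notin> written_regs p" "n \<noteq> i"
    and N: "reg s n = N" "Suc N < W" "N < X"
    and P0: "P 0 s"
    and body: "\<And>j s'. j < N \<Longrightarrow> P j s' \<Longrightarrow> reg s' i = j \<Longrightarrow> frame (for_loop i n p) s s' \<Longrightarrow>
      fits W p s' \<and> P (Suc j) (result p s')"
    and P: "\<And>j s' v. P j s' \<Longrightarrow> P j (s'\<lparr>reg := (reg s')(i := v)\<rparr>)"
  shows "run W X (for_loop i n p) s (P N)"
proof -
  define I where "I j s' \<longleftrightarrow> P j s' \<and> reg s' i = j \<and> frame (for_loop i n p) s s'" for j s'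
  let ?b = "Less (Reg i) (Reg n)" and ?p = "Seq p (Set_Reg i (Add (Reg i) (Const 1)))"
  have n: "reg s' n = N" if "I j s'" for j s'
    using that assms(3,4) N frame_reg[of "for_loop i n p" s s' n] by (simp add: I_def)
  have loop: "run W X (While ?b ?p) s' (I N)" if "I 0 s'" for s'
    using that
  proof (rule run_While_count)
    fix j s' assume j: "j < N" and I: "I j s'"
    have f: "fits W p s'" "P (Suc j) (result p s')"
      using body[OF j, of s'] I by (auto simp: I_def)
    from exec_loop_free[OF assms(1) f(1)] obtain t where "exec W p s' t (result p s')" by blast
    then have fr: "frame p s' (result p s')" by (rule exec_frame)
    then have i: "reg (result p s') i = j" using assms(2) I by (simp add: frame_def I_def)
    have "run W 1 ?p s' (I (Suc j))"
    proof (rule run_loop_free)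
      show "fits W ?p s'" using f i j N by simp
      have "frame (for_loop i n p) s (result ?p s')"
        using fr I by (auto simp: frame_def I_def)
      then show "I (Suc j) (result ?p s')"
        using P[OF f(2)] i by (simp add: I_def)
    qed (use assms in simp_all)
    then show "bfits W ?b s' \<and> bval ?b s' \<and> run W 1 ?p s' (I (Suc j))"
      using n[OF I] I j N by (simp add: I_def)
  next
    fix s' assume "I N s'"
    then show "bfits W ?b s' \<and> \<not> bval ?b s'" using n N by (simp add: I_def)
  qed (rule N)
  have "run W X (Set_Reg i (Const 0)) s (I 0)"
    using N P[OF P0] by (intro run_loop_free) (auto simp: I_def frame_def)
  then have "run W X (for_loop i n p) s (I N)"
    unfolding for_loop_def by (rule run_Seq) (use loop N in auto)
  then show ?thesis by (rule run_mono) (auto simp: I_def)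
qed

text \<open>The number of rounds is not known in advance, but each takes at least 1 from a
  nonnegative potential, and the integer part of the potential serves as the induction measure. The
  additional 1 in the bound pays for the final test.\<close>

lemma While_potential:
  fixes \<Phi> :: "memory \<Rightarrow> real"
  assumes J: "J s" and pos: "\<And>s. J s \<Longrightarrow> 0 \<le> \<Phi> s" and b: "\<And>s. J s \<Longrightarrow> bfits W b s"
    and body: "\<And>s. J s \<Longrightarrow> bval b s \<Longrightarrow> run W X p s (\<lambda>s'. J s' \<and> \<Phi> s' + 1 \<le> \<Phi> s)"
    and X: "1 \<le> X"
  shows "\<exists>t s'. exec W (While b p) s t s' \<and>
    real t \<le> real (linear_cost (While b p) * X) * (\<Phi> s + 1) \<and> J s' \<and> \<not> bval b s'"
  using J
proof (induction "nat \<lfloor>\<Phi> s\<rfloor>" arbitrary: s rule: less_induct)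
  case less
  let ?K = "real (linear_cost (While b p) * X)"
  have K: "real (1 + bcost b + t) \<le> ?K" if "t \<le> linear_cost p * X" for t
  proof -
    have "bcost b \<le> bcost b * X" using X by simp
    with that X have "1 + bcost b + t \<le> linear_cost (While b p) * X"
      unfolding linear_cost.simps distrib_right mult_1 by linarith
    then show ?thesis by (rule of_nat_mono)
  qed
  show ?case
  proof (cases "bval b s")
    case False
    then have "exec W (While b p) s (1 + bcost b) s"
      using b[OF less.prems] by (intro exec.While_False)
    moreover have "real (1 + bcost b) \<le> ?K * 1" using K[of 0] by simp
    moreover have "?K * 1 \<le> ?K * (\<Phi> s + 1)"
      using pos[OF less.prems] by (intro mult_left_mono) auto
    ultimately show ?thesis using less.prems False by (meson order_trans)
  next
    case True
    with body[OF less.prems] obtain t s' where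
      p: "exec W p s t s'" "t \<le> linear_cost p * X" "J s'" "\<Phi> s' + 1 \<le> \<Phi> s"
      unfolding run_def by blast
    have "nat \<lfloor>\<Phi> s'\<rfloor> < nat \<lfloor>\<Phi> s\<rfloor>" using p(4) pos[OF p(3)] by linarith
    from less.hyps[OF this p(3)] obtain u s'' where
      q: "exec W (While b p) s' u s''" "real u \<le> ?K * (\<Phi> s' + 1)" "J s''" "\<not> bval b s''" by blast
    have "real (1 + bcost b + t + u) \<le> ?K * (1 + (\<Phi> s' + 1))"
      using K[OF p(2)] q(2) by (simp add: distrib_left)
    also have "\<dots> \<le> ?K * (\<Phi> s + 1)" using p(4) by (intro mult_left_mono) auto
    finally show ?thesis
      using exec.While_True[OF b[OF less.prems] True p(1) q(1)] q(3,4) by blast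
  qed
qed

section \<open>Memory layout and initialisation\<close>

abbreviation (input) "rN \<equiv> 0 :: nat"
abbreviation (input) "rM \<equiv> 1 :: nat"
abbreviation (input) "rK \<equiv> 2 :: nat"
abbreviation (input) "rFound \<equiv> 3 :: nat"
abbreviation (input) "rLen \<equiv> 4 :: nat"
abbreviation (input) "rTop \<equiv> 5 :: nat"
abbreviation (input) "rI \<equiv> 6 :: nat"
abbreviation (input) "rHalf \<equiv> 7 :: nat"
abbreviation (input) "rFlag \<equiv> 8 :: nat"
abbreviation (input) "rA \<equiv> 9 :: nat"
abbreviation (input) "rB \<equiv> 10 :: nat"
abbreviation (input) "rC \<equiv> 11 :: nat"
abbreviation (input) "rD \<equiv> 12 :: nat"
abbreviation (input) "rZ \<equiv> 13 :: nat"
abbreviation (input) "rT \<equiv> 14 :: nat"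
abbreviation (input) "rAB \<equiv> 15 :: nat"
abbreviation (input) "rBC \<equiv> 16 :: nat"
abbreviation (input) "rCD \<equiv> 17 :: nat"
abbreviation (input) "rAD \<equiv> 18 :: nat"
abbreviation (input) "rZA \<equiv> 19 :: nat"
abbreviation (input) "rZB \<equiv> 20 :: nat"
abbreviation (input) "rZC \<equiv> 21 :: nat"
abbreviation (input) "rU \<equiv> 22 :: nat"
abbreviation (input) "rV \<equiv> 23 :: nat"

text \<open>\<open>aHU\<close> and \<open>aHV\<close> list every edge in both directions. A vertex \<open>p\<close> is stored in \<open>aPar\<close> as
  \<open>p + 1\<close>, with \<open>0\<close> for no parent. The edges deleted at the current node form the trail; a stack entry
  keeps only the length \<open>aLev\<close> of the trail prefix it inherits, and \<open>aCnt\<close> further edges in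
  \<open>aStack\<close>, \<open>aStack + 1\<close>, \<open>aStack + 2\<close>.\<close>

abbreviation (input) "aU \<equiv> 0 :: nat"
abbreviation (input) "aV \<equiv> 1 :: nat"
abbreviation (input) "aOutU \<equiv> 2 :: nat"
abbreviation (input) "aOutV \<equiv> 3 :: nat"
abbreviation (input) "aMul \<equiv> 4 :: nat"
abbreviation (input) "aId \<equiv> 5 :: nat"
abbreviation (input) "aHU \<equiv> 6 :: nat"
abbreviation (input) "aHV \<equiv> 7 :: nat"
abbreviation (input) "aLive \<equiv> 8 :: nat"
abbreviation (input) "aDeg \<equiv> 9 :: nat"
abbreviation (input) "aPar \<equiv> 10 :: nat"
abbreviation (input) "aTrail \<equiv> 11 :: nat"
abbreviation (input) "aLev \<equiv> 12 :: nat"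
abbreviation (input) "aCnt \<equiv> 13 :: nat"
abbreviation (input) "aStack \<equiv> 14 :: nat"

primrec block :: "com list \<Rightarrow> com" where
  "block [] = Skip"
| "block (c # cs) = Seq c (block cs)"

definition id_exp :: "aexp \<Rightarrow> aexp \<Rightarrow> aexp" where
  "id_exp e f = Arr aId (Add (Arr aMul e) f)"

definition adj_exp :: "aexp \<Rightarrow> aexp \<Rightarrow> aexp" where
  "adj_exp e f = Arr aLive (id_exp e f)"

definition init_mul :: com where
  "init_mul = for_loop rI rN
     (Set_Arr aMul (Add (Reg rI) (Const 1)) (Add (Arr aMul (Reg rI)) (Reg rN)))"

definition init_edge :: com where
  "init_edge = block
    [Set_Reg rU (Arr aU (Reg rI)), Set_Reg rV (Arr aV (Reg rI)),
     Set_Arr aId (Add (Arr aMul (Reg rU)) (Reg rV)) (Add (Reg rI) (Const 1)),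
     Set_Arr aId (Add (Arr aMul (Reg rV)) (Reg rU)) (Add (Reg rI) (Const 1)),
     Set_Arr aHU (Reg rI) (Reg rU), Set_Arr aHV (Reg rI) (Reg rV),
     Set_Arr aHU (Add (Reg rM) (Reg rI)) (Reg rV), Set_Arr aHV (Add (Reg rM) (Reg rI)) (Reg rU)]"

definition init :: com where
  "init = Seq init_mul (Seq (for_loop rI rM init_edge)
     (block [Set_Reg rHalf (Add (Reg rM) (Reg rM)), Set_Reg rTop (Const 1)]))"

section \<open>An instance and its representation in memory\<close>

locale tp_instance =
  fixes n :: nat and E :: "nat set set" and es :: "(nat \<times> nat) list" and k W :: nat
  assumes G: "simple_graph ({..<n}, E)" and es: "edge_list E es"
    and W: "100 * ((n + length es + k + 2) * (n + length es + k + 2)) \<le> W"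
begin

abbreviation "m \<equiv> length es"

definition edge :: "nat \<Rightarrow> nat set" where
  "edge i = {fst (es ! i), snd (es ! i)}"

text \<open>The half-edges are the arcs of the graph with every edge taken in both directions. They
  replace adjacency lists: one scan of the indices below \<open>2 * m\<close> meets each pair of a
  vertex and a neighbour exactly once.\<close>

definition half_u :: "nat \<Rightarrow> nat" where
  "half_u h = (if h < m then fst (es ! h) else snd (es ! (h - m)))"

definition half_v :: "nat \<Rightarrow> nat" where
  "half_v h = (if h < m then snd (es ! h) else fst (es ! (h - m)))"

lemma edge_eq: "edge i = (\<lambda>(u, v). {u, v}) (es ! i)"
  by (simp add: edge_def split_beta)

lemma edges: "E = edge ` {..<m}"
proof -
  have "E = (\<lambda>(u, v). {u, v}) ` nth es ` {..<m}"
    using es by (simp add: edge_list_def lessThan_atLeast0 nth_image)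
  then show ?thesis by (simp add: image_image edge_eq)
qed

lemma edge_mem: "i < m \<Longrightarrow> edge i \<in> E"
  by (simp add: edges)

lemma edge_inj: "inj_on edge {..<m}"
proof (rule inj_onI)
  fix i j assume "i \<in> {..<m}" "j \<in> {..<m}" "edge i = edge j"
  then show "i = j"
    using es nth_eq_iff_index_eq[of "map (\<lambda>(u, v). {u, v}) es" i j]
    by (simp add: edge_list_def edge_eq)
qed

lemma edge_eq_iff: "i < m \<Longrightarrow> j < m \<Longrightarrow> edge i = edge j \<longleftrightarrow> i = j"
  using edge_inj by (auto simp: inj_on_def)

lemma finite_E: "finite E"
  by (simp add: edges)

lemma edge_ends:
  assumes "i < m"
  shows "fst (es ! i) < n" "snd (es ! i) < n" "fst (es ! i) \<noteq> snd (es ! i)"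
  using simple_graph_edgeD[OF G, of "fst (es ! i)" "snd (es ! i)"] edge_mem[OF assms]
  by (auto simp: edge_def)

lemma half_ends:
  assumes "h < 2 * m" shows "half_u h < n" "half_v h < n"
  using assms edge_ends[of h] edge_ends[of "h - m"] by (auto simp: half_u_def half_v_def)

lemma half_exists:
  assumes "{u, v} \<in> E" shows "\<exists>h < 2 * m. half_u h = u \<and> half_v h = v"
proof -
  from assms obtain i where i: "i < m" "edge i = {u, v}" by (auto simp: edges)
  then consider "fst (es ! i) = u" "snd (es ! i) = v" | "fst (es ! i) = v" "snd (es ! i) = u"
    by (auto simp: edge_def doubleton_eq_iff)
  then show ?thesis
  proof cases
    case 1 then show ?thesis using i by (intro exI[of _ i]) (simp add: half_u_def half_v_def)
  next
    case 2 then show ?thesis using i by (intro exI[of _ "m + i"]) (simp add: half_u_def half_v_def)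
  qed
qed

lemma half_inj:
  assumes "h < 2 * m" "h' < 2 * m" "half_u h = half_u h'" "half_v h = half_v h'"
  shows "h = h'"
proof -
  define i where "i h = (if h < m then h else h - m)" for h
  have e: "{half_u h, half_v h} = edge (i h)" for h
    by (auto simp: half_u_def half_v_def edge_def i_def)
  have i: "i h < m" "i h' < m" using assms by (auto simp: i_def)
  then have "i h = i h'" using e[of h] e[of h'] assms edge_eq_iff by auto
  then show ?thesis
    using assms edge_ends(3)[OF i(1)] by (auto simp: i_def half_u_def half_v_def split: if_splits)
qed

text \<open>Covers counters, identifiers and the stack pointer, for which the factor 20 is generous.
  The comparison with the square uses that the sum is at least 2; the square itself is there for the
  matrix cells.\<close>

lemma fits_linear: "x \<le> 20 * (n + m + k + 2) \<Longrightarrow> x < W"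
proof -
  assume "x \<le> 20 * (n + m + k + 2)"
  also have "\<dots> < 100 * ((n + m + k + 2) * 2)" by simp
  also have "\<dots> \<le> 100 * ((n + m + k + 2) * (n + m + k + 2))" by (intro mult_le_mono) auto
  finally show ?thesis using W by simp
qed

lemma fits_square: "u \<le> n \<Longrightarrow> v \<le> n \<Longrightarrow> u * n + v < W"
proof -
  assume "u \<le> n" "v \<le> n"
  then have "u * n + v \<le> n * n + n" by (intro add_mono mult_le_mono) auto
  also have "\<dots> < 100 * ((n + m + k + 2) * (n + m + k + 2))" by (simp add: algebra_simps)
  finally show ?thesis using W by simp
qed

lemma cell_inj: "u < n \<Longrightarrow> v < n \<Longrightarrow> u' < n \<Longrightarrow> v' < n \<Longrightarrow> u * n + v = u' * n + v' \<longleftrightarrow> u = u' \<and> v = v'"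
proof (intro iffI)
  assume "u < n" "v < n" "u' < n" "v' < n" "u * n + v = u' * n + v'"
  then have "(u * n + v) div n = (u' * n + v') div n" "(u * n + v) mod n = (u' * n + v') mod n" by simp_all
  then show "u = u' \<and> v = v'" using \<open>v < n\<close> \<open>v' < n\<close> by simp
qed simp

text \<open>Identifiers of edges are positive, and \<open>0\<close> stands for a non-edge.\<close>

definition static :: "(nat \<Rightarrow> nat) \<Rightarrow> (nat \<Rightarrow> nat \<Rightarrow> nat) \<Rightarrow> bool" where
  "static R A \<longleftrightarrow> R rN = n \<and> R rM = m \<and> R rK = k \<and> R rHalf = 2 * m \<and>
     (\<forall>i < m. A aU i = fst (es ! i) \<and> A aV i = snd (es ! i)) \<and>
     (\<forall>u < n. A aMul u = u * n) \<and>
     (\<forall>u < n. \<forall>v < n. (\<forall>i < m. edge i = {u, v} \<longrightarrow> A aId (u * n + v) = Suc i) \<and>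
        ({u, v} \<notin> E \<longrightarrow> A aId (u * n + v) = 0)) \<and>
     (\<forall>h < 2 * m. A aHU h = half_u h \<and> A aHV h = half_v h)"

text \<open>\<open>static\<close> speaks of the two memory components separately so that updates of
  unrelated registers and arrays can be rewritten away.\<close>

lemma static_reg [simp]:
  "r \<notin> {rN, rM, rK, rHalf} \<Longrightarrow> static (R(r := x)) A \<longleftrightarrow> static R A"
  by (simp add: static_def)

lemma static_arr [simp]:
  "a \<notin> {aU, aV, aMul, aId, aHU, aHV} \<Longrightarrow> static R (A(a := f)) \<longleftrightarrow> static R A"
  by (simp add: static_def)

lemma static_frame:
  assumes "static (reg s) (arr s)" "frame c s s'"
    "written_regs c \<inter> {rN, rM, rK, rHalf} = {}" "written_arrs c \<inter> {aU, aV, aMul, aId, aHU, aHV} = {}"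
  shows "static (reg s') (arr s')"
proof -
  have "reg s' r = reg s r" if "r \<in> {rN, rM, rK, rHalf}" for r
    using frame_reg[OF assms(2), of r] assms(3) that by blast
  moreover have "arr s' a = arr s a" if "a \<in> {aU, aV, aMul, aId, aHU, aHV}" for a
    using frame_arr[OF assms(2), of a] assms(4) that by blast
  ultimately show ?thesis using assms(1) by (simp add: static_def)
qed

lemma fits_const [simp]: "0 < W" "Suc 0 < W" "2 < W" "3 < W" "n < W" "m < W" "k < W"
  "u < n \<Longrightarrow> u < W" "i < m \<Longrightarrow> i < W" "h < 2 * m \<Longrightarrow> h < W"
  by (rule fits_linear; simp)+

lemma init_mul:
  assumes "reg s rN = n" "\<And>i. arr s aMul i = 0" "n + 2 \<le> X"
  shows "run W X init_mul s (\<lambda>s'. \<forall>u \<le> n. arr s' aMul u = u * n)"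
  unfolding init_mul_def
proof (rule run_mono[OF run_for_loop[where N = n and X = X and
      P = "\<lambda>j s'. \<forall>u \<le> j. arr s' aMul u = u * n"]])
  fix j s' assume j: "j < n" and P: "\<forall>u \<le> j. arr s' aMul u = u * n" and i: "reg s' rI = j"
    and f: "frame (for_loop rI rN (Set_Arr aMul (Add (Reg rI) (Const 1)) (Add (Arr aMul (Reg rI)) (Reg rN)))) s s'"
  have "reg s' rN = n" using frame_reg[OF f, of rN] assms by simp
  moreover have "j * n + n < W" using fits_square[of j n] j by simp
  moreover have "j * n < W" using fits_square[of j 0] j by simp
  moreover have "Suc j < W" using j by (intro fits_linear) simp
  ultimately show "fits W (Set_Arr aMul (Add (Reg rI) (Const 1)) (Add (Arr aMul (Reg rI)) (Reg rN))) s' \<and>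
    (\<forall>u \<le> Suc j. arr (result (Set_Arr aMul (Add (Reg rI) (Const 1)) (Add (Arr aMul (Reg rI)) (Reg rN))) s') aMul u = u * n)"
    using j P i by (auto simp: le_Suc_eq)
qed (use assms fits_linear[of "Suc n"] in auto)

lemma init_edges:
  assumes r: "reg s rN = n" "reg s rM = m" and mul: "\<forall>u \<le> n. arr s aMul u = u * n"
    and e: "\<forall>i < m. arr s aU i = fst (es ! i) \<and> arr s aV i = snd (es ! i)"
    and z: "\<And>i. arr s aId i = 0" and X: "m + 2 \<le> X"
  shows "run W X (for_loop rI rM init_edge) s (\<lambda>s'.
    (\<forall>u < n. \<forall>v < n. (\<forall>i < m. edge i = {u, v} \<longrightarrow> arr s' aId (u * n + v) = Suc i) \<and>
        ({u, v} \<notin> E \<longrightarrow> arr s' aId (u * n + v) = 0)) \<and>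
     (\<forall>h < 2 * m. arr s' aHU h = half_u h \<and> arr s' aHV h = half_v h))"
proof (rule run_mono[OF run_for_loop[where N = m and X = X and
      P = "\<lambda>j s'. (\<forall>u < n. \<forall>v < n. (\<forall>i < j. edge i = {u, v} \<longrightarrow> arr s' aId (u * n + v) = Suc i) \<and>
          ((\<forall>i < j. edge i \<noteq> {u, v}) \<longrightarrow> arr s' aId (u * n + v) = 0)) \<and>
        (\<forall>h < 2 * m. (if h < m then h < j else h - m < j) \<longrightarrow> arr s' aHU h = half_u h \<and> arr s' aHV h = half_v h)"]])
  fix j s' assume j: "j < m" and P: "(\<forall>u < n. \<forall>v < n.
      (\<forall>i < j. edge i = {u, v} \<longrightarrow> arr s' aId (u * n + v) = Suc i) \<and>
      ((\<forall>i < j. edge i \<noteq> {u, v}) \<longrightarrow> arr s' aId (u * n + v) = 0)) \<and>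
      (\<forall>h < 2 * m. (if h < m then h < j else h - m < j) \<longrightarrow> arr s' aHU h = half_u h \<and> arr s' aHV h = half_v h)"
    and i: "reg s' rI = j" and f: "frame (for_loop rI rM init_edge) s s'"
  define u v where uv: "u = fst (es ! j)" "v = snd (es ! j)"
  have uvn: "u < n" "v < n" "u \<noteq> v" using edge_ends[OF j] uv by simp_all
  have rs: "reg s' rN = n" "reg s' rM = m"
    using frame_reg[OF f, of rN] frame_reg[OF f, of rM] r by (simp_all add: init_edge_def)
  have as: "arr s' aMul u = u * n" "arr s' aMul v = v * n" "arr s' aU j = u" "arr s' aV j = v"
    using frame_arr[OF f, of aMul] frame_arr[OF f, of aU] frame_arr[OF f, of aV] mul e uvn j
    by (simp_all add: init_edge_def uv)
  have sq: "u * n < W" "v * n < W" "u * n + v < W" "v * n + u < W"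
    using fits_square[of u 0] fits_square[of v 0] fits_square[of u v] fits_square[of v u] uvn by simp_all
  have li: "Suc j < W" "m + j < W" using j by (auto intro: fits_linear)
  let ?s = "result init_edge s'"
  have fit: "fits W init_edge s'"
    using i rs as uvn sq li j by (simp add: init_edge_def)
  have id: "arr ?s aId = (arr s' aId)(u * n + v := Suc j, v * n + u := Suc j)"
    using i rs as by (simp add: init_edge_def)
  have hu: "arr ?s aHU = (arr s' aHU)(j := u, m + j := v)" "arr ?s aHV = (arr s' aHV)(j := v, m + j := u)"
    using i rs as by (simp_all add: init_edge_def)
  have ej: "edge j = {u, v}" by (simp add: edge_def uv)
  \<comment> \<open>Cell indices are injective on pairs of vertices, so the two cells written in
    this round belong to the edge just read, and no other edge of the list has the same
    ends.\<close>
  have c1: "(\<forall>i < Suc j. edge i = {x, y} \<longrightarrow> arr ?s aId (x * n + y) = Suc i) \<and>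
      ((\<forall>i < Suc j. edge i \<noteq> {x, y}) \<longrightarrow> arr ?s aId (x * n + y) = 0)" if xy: "x < n" "y < n" for x y
  proof (cases "edge j = {x, y}")
    case True
    then have "x = u \<and> y = v \<or> x = v \<and> y = u" using ej by (auto simp: doubleton_eq_iff)
    then have "arr ?s aId (x * n + y) = Suc j" by (auto simp: id)
    moreover have "i = j" if "edge i = {x, y}" "i < Suc j" for i
      using that True edge_eq_iff[of i j] j by simp
    ultimately show ?thesis using True by blast
  next
    case False
    then have "arr ?s aId (x * n + y) = arr s' aId (x * n + y)"
      using xy uvn ej cell_inj by (auto simp: id insert_commute)
    then show ?thesis using P xy False by (simp add: less_Suc_eq)
  qed
  have c2: "arr ?s aHU h = half_u h \<and> arr ?s aHV h = half_v h"
    if "h < 2 * m" "if h < m then h < Suc j else h - m < Suc j" for h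
  proof -
    consider "h = j" | "h = m + j" | "h \<noteq> j" "h \<noteq> m + j" by blast
    then show ?thesis
    proof cases
      case 1 then show ?thesis using j by (auto simp: hu half_u_def half_v_def uv)
    next
      case 2 then show ?thesis using j by (simp add: hu half_u_def half_v_def uv)
    next
      case 3
      have "if h < m then h < j else h - m < j" using that 3 by (auto split: if_splits)
      then show ?thesis using P that(1) 3 by (simp add: hu)
    qed
  qed
  show "fits W init_edge s' \<and> (\<forall>u < n. \<forall>v < n.
      (\<forall>i < Suc j. edge i = {u, v} \<longrightarrow> arr ?s aId (u * n + v) = Suc i) \<and>
      ((\<forall>i < Suc j. edge i \<noteq> {u, v}) \<longrightarrow> arr ?s aId (u * n + v) = 0)) \<and>
      (\<forall>h < 2 * m. (if h < m then h < Suc j else h - m < Suc j) \<longrightarrow> arr ?s aHU h = half_u h \<and> arr ?s aHV h = half_v h)"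
    using fit c1 c2 by blast
next
  fix s' assume "(\<forall>u < n. \<forall>v < n. (\<forall>i < m. edge i = {u, v} \<longrightarrow> arr s' aId (u * n + v) = Suc i) \<and>
          ((\<forall>i < m. edge i \<noteq> {u, v}) \<longrightarrow> arr s' aId (u * n + v) = 0)) \<and>
        (\<forall>h < 2 * m. (if h < m then h < m else h - m < m) \<longrightarrow> arr s' aHU h = half_u h \<and> arr s' aHV h = half_v h)"
  moreover have "if h < m then h < m else h - m < m" if "h < 2 * m" for h using that by auto
  moreover have "\<forall>i < m. edge i \<noteq> {u, v}" if "{u, v} \<notin> E" for u v using that edge_mem by metis
  ultimately show "(\<forall>u < n. \<forall>v < n. (\<forall>i < m. edge i = {u, v} \<longrightarrow> arr s' aId (u * n + v) = Suc i) \<and>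
        ({u, v} \<notin> E \<longrightarrow> arr s' aId (u * n + v) = 0)) \<and>
     (\<forall>h < 2 * m. arr s' aHU h = half_u h \<and> arr s' aHV h = half_v h)" by auto
qed (use r z X fits_linear[of "Suc m"] in \<open>auto simp: init_edge_def\<close>)

text \<open>The root of the search tree is stack entry 0 with level and count 0. Zeroed memory
  already contains it; setting \<open>rTop\<close> to 1 activates it.\<close>

lemma init:
  assumes X: "n + 2 * m + 2 \<le> X"
  shows "run W X init (input n es k) (\<lambda>s. static (reg s) (arr s) \<and> reg s rTop = 1 \<and> reg s rFound = 0 \<and>
    arr s aLev 0 = 0 \<and> arr s aCnt 0 = 0)"
  unfolding init_def
proof (rule run_Seq[OF init_mul])
  fix s assume mul: "\<forall>u \<le> n. arr s aMul u = u * n" and f: "frame init_mul (input n es k) s"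
  have w: "written_regs init_mul = {rI}" "written_arrs init_mul = {aMul}" by (simp_all add: init_mul_def)
  have r: "reg s r = reg (input n es k) r" if "r \<noteq> rI" for r using frame_reg[OF f] that w by simp
  have a: "arr s a = arr (input n es k) a" if "a \<noteq> aMul" for a using frame_arr[OF f] that w by simp
  show "run W X (Seq (for_loop rI rM init_edge)
     (block [Set_Reg rHalf (Add (Reg rM) (Reg rM)), Set_Reg rTop (Const 1)])) s
    (\<lambda>s. static (reg s) (arr s) \<and> reg s rTop = 1 \<and> reg s rFound = 0 \<and> arr s aLev 0 = 0 \<and> arr s aCnt 0 = 0)"
  proof (rule run_Seq[OF init_edges])
    fix s' assume 1: "(\<forall>u < n. \<forall>v < n. (\<forall>i < m. edge i = {u, v} \<longrightarrow> arr s' aId (u * n + v) = Suc i) \<and>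
        ({u, v} \<notin> E \<longrightarrow> arr s' aId (u * n + v) = 0)) \<and>
     (\<forall>h < 2 * m. arr s' aHU h = half_u h \<and> arr s' aHV h = half_v h)"
      and f': "frame (for_loop rI rM init_edge) s s'"
    have r': "reg s' r = reg (input n es k) r" if "r \<notin> {rI, rU, rV}" for r
      using frame_reg[OF f', of r] r[of r] that by (simp add: init_edge_def)
    have a': "arr s' a = arr s a" if "a \<notin> {aId, aHU, aHV}" for a
      using frame_arr[OF f', of a] that by (simp add: init_edge_def)
    have "static ((reg s')(rHalf := 2 * m, rTop := 1)) (arr s')"
      using 1 r' a' a mul unfolding static_def by (simp add: input_def)
    then show "run W X (block [Set_Reg rHalf (Add (Reg rM) (Reg rM)), Set_Reg rTop (Const 1)]) s'
      (\<lambda>s. static (reg s) (arr s) \<and> reg s rTop = 1 \<and> reg s rFound = 0 \<and> arr s aLev 0 = 0 \<and> arr s aCnt 0 = 0)"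
      using r' a' a X fits_linear[of "m + m"] by (intro run_loop_free) (auto simp: input_def mult_2)
  qed (use r a X mul in \<open>auto simp: input_def\<close>)
qed (use X in \<open>auto simp: input_def\<close>)

end

section \<open>Finding an obstruction\<close>

text \<open>The trail is copied to the output arrays at every node, so a node without obstruction
  already holds its answer: \<open>rLen\<close> is also the register from which the length of the
  answer is read.\<close>

definition kill_edge :: com where
  "kill_edge = block
    [Set_Reg rT (Arr aTrail (Reg rI)), Set_Arr aLive (Reg rT) (Const 0),
     Set_Arr aOutU (Reg rI) (Arr aU (Sub (Reg rT) (Const 1))),
     Set_Arr aOutV (Reg rI) (Arr aV (Sub (Reg rT) (Const 1)))]"

text \<open>Rebuilding all flags from the trail takes linear time, which a node can afford, and
  replaces any undoing when the search backtracks. Cell 0 is set to 0 because non-edges have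
  identifier 0.\<close>

definition reset :: com where
  "reset = Seq (Set_Arr aLive (Const 0) (Const 0))
     (Seq (for_loop rI rM (Set_Arr aLive (Add (Reg rI) (Const 1)) (Const 1)))
       (for_loop rI rLen kill_edge))"

text \<open>The nested negations express a disjunction, for which \<open>bexp\<close> has no
  constructor; the same pattern occurs in \<open>parent_half\<close> and
  \<open>mirror\<close>.\<close>

definition before_exp :: "aexp \<Rightarrow> aexp \<Rightarrow> bexp" where
  "before_exp e f = Not (And (Not (Less (Arr aDeg f) (Arr aDeg e)))
     (Not (And (Eq (Arr aDeg f) (Arr aDeg e)) (Less e f))))"

definition clear_vertex :: com where
  "clear_vertex = block [Set_Arr aDeg (Reg rI) (Const 0), Set_Arr aPar (Reg rI) (Const 0)]"

definition count_half :: com where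
  "count_half = block
    [Set_Reg rU (Arr aHU (Reg rI)), Set_Reg rV (Arr aHV (Reg rI)),
     If (Eq (adj_exp (Reg rU) (Reg rV)) (Const 1))
       (Set_Arr aDeg (Reg rU) (Add (Arr aDeg (Reg rU)) (Const 1))) Skip]"

definition parent_half :: com where
  "parent_half = block
    [Set_Reg rU (Arr aHU (Reg rI)), Set_Reg rV (Arr aHV (Reg rI)),
     If (And (Eq (adj_exp (Reg rU) (Reg rV)) (Const 1)) (And (before_exp (Reg rV) (Reg rU))
          (Not (And (Not (Eq (Arr aPar (Reg rU)) (Const 0)))
            (Not (before_exp (Sub (Arr aPar (Reg rU)) (Const 1)) (Reg rV)))))))
       (Set_Arr aPar (Reg rU) (Add (Reg rV) (Const 1))) Skip]"

definition search_half :: com where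
  "search_half = block
    [Set_Reg rU (Arr aHU (Reg rI)), Set_Reg rV (Arr aHV (Reg rI)), Set_Reg rT (Arr aPar (Reg rU)),
     If (And (And (Eq (adj_exp (Reg rU) (Reg rV)) (Const 1)) (Not (Eq (Reg rT) (Const 0))))
          (And (Not (Eq (Add (Reg rV) (Const 1)) (Reg rT)))
            (Eq (adj_exp (Reg rV) (Sub (Reg rT) (Const 1))) (Const 0))))
       (block [Set_Reg rFlag (Const 1), Set_Reg rB (Sub (Reg rT) (Const 1)), Set_Reg rC (Reg rU),
          Set_Reg rD (Reg rV)])
       Skip]"

definition search_end :: com where
  "search_end =
     If (And (Eq (adj_exp (Reg rB) (Reg rI)) (Const 1))
          (And (Not (Eq (Reg rI) (Reg rC))) (Eq (adj_exp (Reg rC) (Reg rI)) (Const 0))))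
       (Set_Reg rA (Reg rI)) Skip"

definition symmetric_exp :: "nat \<Rightarrow> bexp" where
  "symmetric_exp z = And (Eq (adj_exp (Reg z) (Reg rA)) (adj_exp (Reg z) (Reg rD)))
     (Eq (adj_exp (Reg z) (Reg rB)) (adj_exp (Reg z) (Reg rC)))"

definition search_asymmetric :: com where
  "search_asymmetric =
     If (And (And (And (Not (Eq (Reg rI) (Reg rA))) (Not (Eq (Reg rI) (Reg rB))))
            (And (Not (Eq (Reg rI) (Reg rC))) (Not (Eq (Reg rI) (Reg rD)))))
          (Not (symmetric_exp rI)))
       (block [Set_Reg rFlag (Const 1), Set_Reg rZ (Reg rI)]) Skip"

text \<open>The invariant of a running maximum with respect to \<open>before\<close>; the shift by
  one frees 0 for the empty set, as in \<open>aPar\<close>.\<close>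

definition latest :: "nat set set \<Rightarrow> nat set \<Rightarrow> nat \<Rightarrow> bool" where
  "latest F S q \<longleftrightarrow> q = 0 \<and> S = {} \<or>
     0 < q \<and> q - 1 \<in> S \<and> (\<forall>w \<in> S. w = q - 1 \<or> before F w (q - 1))"

lemma latest_insert:
  assumes "latest F S q"
  shows "latest F (insert w S) (if q \<noteq> 0 \<and> \<not> before F (q - 1) w then q else Suc w)"
  using assms before_linear[of w "q - 1" F] before_trans[of F _ "q - 1" w] by (auto simp: latest_def)

section \<open>Linear scans of the remaining graph\<close>

context tp_instance
begin

definition live :: "(nat \<Rightarrow> nat \<Rightarrow> nat) \<Rightarrow> nat set set \<Rightarrow> bool" where
  "live A F \<longleftrightarrow> A aLive 0 = 0 \<and> (\<forall>i < m. A aLive (Suc i) = of_bool (edge i \<in> F))"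

lemma live_arr [simp]: "a \<noteq> aLive \<Longrightarrow> live (A(a := f)) F \<longleftrightarrow> live A F"
  by (simp add: live_def)

lemma live_frame:
  assumes "live (arr s) F" "frame c s s'" "aLive \<notin> written_arrs c"
  shows "live (arr s') F"
  using assms frame_arr[OF assms(2,3)] by (simp add: live_def)

lemma static_cell:
  assumes "static R A" "u < n" "v < n"
  shows "A aMul u = u * n" "i < m \<Longrightarrow> edge i = {u, v} \<Longrightarrow> A aId (u * n + v) = Suc i"
    "{u, v} \<notin> E \<Longrightarrow> A aId (u * n + v) = 0"
  using assms by (auto simp: static_def)

lemma static_cell_le:
  assumes "static R A" "u < n" "v < n" shows "A aId (u * n + v) \<le> m"
proof (cases "{u, v} \<in> E")
  case True
  then obtain i where "i < m" "edge i = {u, v}" by (auto simp: edges)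
  then show ?thesis using static_cell(2)[OF assms] by simp
next
  case False
  then show ?thesis using static_cell(3)[OF assms] by simp
qed

lemma afits_id:
  assumes "static (reg s) (arr s)" "afits W e s" "afits W f s" "aval e s < n" "aval f s < n"
  shows "afits W (id_exp e f) s"
  using assms static_cell(1)[OF assms(1,4,5)] static_cell_le[OF assms(1,4,5)]
    fits_square[of "aval e s" "aval f s"] fits_linear[of "arr s aId (aval e s * n + aval f s)"]
  by (simp add: id_exp_def)

lemma aval_id:
  assumes "static (reg s) (arr s)" "aval e s < n" "aval f s < n"
    "{aval e s, aval f s} = edge i" "i < m"
  shows "aval (id_exp e f) s = Suc i"
  using assms static_cell[OF assms(1,2,3)] by (simp add: id_exp_def)

text \<open>The double lookup needs no case distinction: a deleted edge reads 0 through its flag,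
  and a non-edge reads 0 because its identifier points to cell 0 of \<open>aLive\<close>.\<close>

lemma aval_adj:
  assumes "live (arr s) F" "F \<subseteq> E" "static (reg s) (arr s)" "aval e s < n" "aval f s < n"
  shows "aval (adj_exp e f) s = of_bool ({aval e s, aval f s} \<in> F)"
proof (cases "{aval e s, aval f s} \<in> E")
  case True
  then obtain i where "i < m" "edge i = {aval e s, aval f s}" by (auto simp: edges)
  moreover from this have "aval (id_exp e f) s = Suc i" using aval_id[OF assms(3,4,5)] by simp
  ultimately show ?thesis using assms by (simp add: live_def adj_exp_def)
next
  case False
  then show ?thesis
    using assms static_cell[OF assms(3,4,5)] by (auto simp: live_def adj_exp_def id_exp_def)
qed

lemma afits_adj:
  assumes "live (arr s) F" "F \<subseteq> E" "static (reg s) (arr s)" "aval e s < n" "aval f s < n"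
    "afits W e s" "afits W f s"
  shows "afits W (adj_exp e f) s"
  using aval_adj[OF assms(1-5)] afits_id[OF assms(3,6,7,4,5)] by (simp add: adj_exp_def)

definition ids_edges :: "nat list \<Rightarrow> nat set set" where
  "ids_edges ids = (\<lambda>i. edge (i - 1)) ` set ids"

lemma reset:
  assumes st: "static (reg s) (arr s)" and L: "reg s rLen = L" "L \<le> m"
    and T: "\<forall>i < L. arr s aTrail i \<in> {1..m}" and X: "n + 2 * m + 2 \<le> X"
  shows "run W X reset s (\<lambda>s'. live (arr s') (E - ids_edges (map (arr s aTrail) [0..<L])) \<and>
    (\<forall>i < L. {arr s' aOutU i, arr s' aOutV i} = edge (arr s aTrail i - 1)))"
  unfolding reset_def
proof (rule run_Seq)
  let ?c = "Set_Arr aLive (Const 0) (Const 0)"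
  show "run W X ?c s (\<lambda>s'. arr s' aLive 0 = 0)"
    using X by (intro run_loop_free) auto
  fix s1 assume 1: "arr s1 aLive 0 = 0" and f1: "frame ?c s s1"
  let ?l = "for_loop rI rM (Set_Arr aLive (Add (Reg rI) (Const 1)) (Const 1))"
  have st1: "static (reg s1) (arr s1)" using static_frame[OF st f1] by simp
  have T1: "arr s1 aTrail = arr s aTrail" "reg s1 rLen = L" "reg s1 rM = m"
    using frame_arr[OF f1, of aTrail] frame_reg[OF f1] L st by (simp_all add: static_def)
  show "run W X (Seq ?l (for_loop rI rLen kill_edge)) s1 (\<lambda>s'.
    live (arr s') (E - ids_edges (map (arr s aTrail) [0..<L])) \<and>
    (\<forall>i < L. {arr s' aOutU i, arr s' aOutV i} = edge (arr s aTrail i - 1)))"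
  proof (rule run_Seq)
    let ?P = "\<lambda>j (s' :: memory). arr s' aLive 0 = 0 \<and> (\<forall>i < j. arr s' aLive (Suc i) = 1)"
    show "run W X ?l s1 (?P m)"
    proof (rule run_for_loop[where P = ?P])
      fix j and s' :: memory assume "j < m" "?P j s'" "reg s' rI = j"
      then show "fits W (Set_Arr aLive (Add (Reg rI) (Const 1)) (Const 1)) s' \<and>
        ?P (Suc j) (result (Set_Arr aLive (Add (Reg rI) (Const 1)) (Const 1)) s')"
        using fits_linear[of "Suc j"] by (auto simp: less_Suc_eq)
    qed (use T1 1 X fits_linear[of "Suc m"] in auto)
    fix s2 assume 2: "?P m s2" and f2: "frame ?l s1 s2"
    have st2: "static (reg s2) (arr s2)" using static_frame[OF st1 f2] by simp
    have T2: "arr s2 aTrail = arr s aTrail" "reg s2 rLen = L"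
      using frame_arr[OF f2, of aTrail] frame_reg[OF f2] T1 by (simp_all)
    let ?Q = "\<lambda>j (s' :: memory). arr s' aLive 0 = 0 \<and>
      (\<forall>i < m. arr s' aLive (Suc i) = of_bool (Suc i \<notin> arr s aTrail ` {..<j})) \<and>
      (\<forall>i < j. {arr s' aOutU i, arr s' aOutV i} = edge (arr s aTrail i - 1))"
    have "run W X (for_loop rI rLen kill_edge) s2 (?Q L)"
    proof (rule run_for_loop[where P = ?Q])
      fix j and s' :: memory assume j: "j < L" and Q: "?Q j s'" and i: "reg s' rI = j"
        and f: "frame (for_loop rI rLen kill_edge) s2 s'"
      obtain t where t: "arr s aTrail j = Suc t" "t < m"
        using T j by (metis Suc_le_D One_nat_def Suc_le_eq atLeastAtMost_iff)
      have "static (reg s') (arr s')" using static_frame[OF st2 f] by (simp add: kill_edge_def)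
      then have uv: "arr s' aU t = fst (es ! t)" "arr s' aV t = snd (es ! t)" using t by (simp_all add: static_def)
      have tr: "arr s' aTrail = arr s aTrail" using frame_arr[OF f, of aTrail] T2 by (simp add: kill_edge_def)
      have "j < m" using j L by simp
      have fit: "fits W kill_edge s'"
        using i tr t uv edge_ends[OF t(2)] \<open>j < m\<close> fits_linear[of "Suc t"] by (simp add: kill_edge_def)
      have r: "arr (result kill_edge s') aLive = (arr s' aLive)(Suc t := 0)"
        "arr (result kill_edge s') aOutU = (arr s' aOutU)(j := fst (es ! t))"
        "arr (result kill_edge s') aOutV = (arr s' aOutV)(j := snd (es ! t))"
        using i tr t uv by (simp_all add: kill_edge_def)
      show "fits W kill_edge s' \<and> ?Q (Suc j) (result kill_edge s')"
        using fit Q t unfolding r by (auto simp: lessThan_Suc less_Suc_eq edge_def)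
    qed (use T2 2 X L fits_linear[of "Suc L"] in \<open>auto simp: kill_edge_def\<close>)
    then show "run W X (for_loop rI rLen kill_edge) s2 (\<lambda>s'.
      live (arr s') (E - ids_edges (map (arr s aTrail) [0..<L])) \<and>
      (\<forall>i < L. {arr s' aOutU i, arr s' aOutV i} = edge (arr s aTrail i - 1)))"
    proof (rule run_mono)
      fix s' assume Q: "?Q L s'"
      have "edge i \<in> ids_edges (map (arr s aTrail) [0..<L]) \<longleftrightarrow> Suc i \<in> arr s aTrail ` {..<L}" if "i < m" for i
      proof
        assume "edge i \<in> ids_edges (map (arr s aTrail) [0..<L])"
        then obtain j where j: "j < L" "edge i = edge (arr s aTrail j - 1)"
          by (auto simp: ids_edges_def)
        with T have "arr s aTrail j \<in> {1..m}" by simp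
        then have "Suc i = arr s aTrail j" using j that edge_eq_iff[of i "arr s aTrail j - 1"] by auto
        then show "Suc i \<in> arr s aTrail ` {..<L}" using j by auto
      next
        assume "Suc i \<in> arr s aTrail ` {..<L}"
        then obtain j where "j < L" "arr s aTrail j = Suc i" by auto
        then show "edge i \<in> ids_edges (map (arr s aTrail) [0..<L])"
          unfolding ids_edges_def by (intro image_eqI[where x = "Suc i"]) force+
      qed
      then show "live (arr s') (E - ids_edges (map (arr s aTrail) [0..<L])) \<and>
        (\<forall>i < L. {arr s' aOutU i, arr s' aOutV i} = edge (arr s aTrail i - 1))"
        using Q edge_mem by (simp add: live_def)
    qed simp
  qed (use X in simp)
qed (use X in simp)

definition degs :: "(nat \<Rightarrow> nat \<Rightarrow> nat) \<Rightarrow> nat set set \<Rightarrow> bool" where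
  "degs A F \<longleftrightarrow> (\<forall>v < n. A aDeg v = degree F v)"

lemma degs_arr [simp]: "a \<noteq> aDeg \<Longrightarrow> degs (A(a := f)) F \<longleftrightarrow> degs A F"
  by (simp add: degs_def)

lemma degs_frame:
  assumes "degs (arr s) F" "frame c s s'" "aDeg \<notin> written_arrs c"
  shows "degs (arr s') F"
  using assms frame_arr[OF assms(2,3)] by (simp add: degs_def)

lemma before_exp:
  assumes "degs (arr s) F" "F \<subseteq> E" "aval e s < n" "aval f s < n"
  shows "bval (before_exp e f) s \<longleftrightarrow> before F (aval e s) (aval f s)"
    "bfits W (before_exp e f) s \<longleftrightarrow> afits W e s \<and> afits W f s"
proof -
  have "degree F v \<le> n" for v
  proof -
    have "{w. {v, w} \<in> F} \<subseteq> {..<n}" using simple_graph_edgeD[OF G] assms(2) by auto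
    then show ?thesis unfolding degree_def using card_mono[of "{..<n}"] by fastforce
  qed
  then have "degree F v < W" for v using fits_const(5) by (rule le_less_trans)
  then show "bval (before_exp e f) s \<longleftrightarrow> before F (aval e s) (aval f s)"
    "bfits W (before_exp e f) s \<longleftrightarrow> afits W e s \<and> afits W f s"
    using assms by (auto simp: before_exp_def before_def degs_def)
qed

lemma clear_vertices:
  assumes "static (reg s) (arr s)" "n + 2 * m + 2 \<le> X"
  shows "run W X (for_loop rI rN clear_vertex) s (\<lambda>s'. \<forall>v < n. arr s' aDeg v = 0 \<and> arr s' aPar v = 0)"
proof (rule run_for_loop[where P = "\<lambda>j s'. \<forall>v < j. arr s' aDeg v = 0 \<and> arr s' aPar v = 0"])
  fix j and s' :: memory assume "j < n" "\<forall>v < j. arr s' aDeg v = 0 \<and> arr s' aPar v = 0" "reg s' rI = j"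
  then show "fits W clear_vertex s' \<and> (\<forall>v < Suc j. arr (result clear_vertex s') aDeg v = 0 \<and>
      arr (result clear_vertex s') aPar v = 0)"
    by (auto simp: clear_vertex_def less_Suc_eq)
qed (use assms fits_linear[of "Suc n"] in \<open>auto simp: clear_vertex_def static_def\<close>)

text \<open>Mapping a half-edge that leaves \<open>v\<close> to its other end is a bijection onto
  the neighbours of \<open>v\<close>, so counting half-edges computes degrees.\<close>

lemma degree_half:
  assumes "F \<subseteq> E"
  shows "degree F v = card {h. h < 2 * m \<and> half_u h = v \<and> {half_u h, half_v h} \<in> F}"
proof -
  have "bij_betw half_v {h. h < 2 * m \<and> half_u h = v \<and> {half_u h, half_v h} \<in> F} {w. {v, w} \<in> F}"
    unfolding bij_betw_def
  proof
    show "inj_on half_v {h. h < 2 * m \<and> half_u h = v \<and> {half_u h, half_v h} \<in> F}"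
      using half_inj by (auto intro!: inj_onI)
    show "half_v ` {h. h < 2 * m \<and> half_u h = v \<and> {half_u h, half_v h} \<in> F} = {w. {v, w} \<in> F}"
      using half_exists assms by (force simp: image_iff)
  qed
  then show ?thesis by (simp add: degree_def bij_betw_same_card)
qed

lemma count_degrees:
  assumes st: "static (reg s) (arr s)" and lv: "live (arr s) F" "F \<subseteq> E"
    and z: "\<forall>v < n. arr s aDeg v = 0" and X: "n + 2 * m + 2 \<le> X"
  shows "run W X (for_loop rI rHalf count_half) s (\<lambda>s'. degs (arr s') F)"
proof (rule run_mono[OF run_for_loop[where N = "2 * m" and X = X and P = "\<lambda>j s'. \<forall>v < n.
    arr s' aDeg v = card {h. h < j \<and> half_u h = v \<and> {half_u h, half_v h} \<in> F}"]])
  let ?S = "\<lambda>j v. {h. h < j \<and> half_u h = v \<and> {half_u h, half_v h} \<in> F}"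
  fix j and s' :: memory assume j: "j < 2 * m" and P: "\<forall>v < n. arr s' aDeg v = card (?S j v)"
    and i: "reg s' rI = j" and f: "frame (for_loop rI rHalf count_half) s s'"
  have st': "static (reg s') (arr s')" "live (arr s') F"
    using static_frame[OF st f] live_frame[OF lv(1) f] by (simp_all add: count_half_def)
  have uv: "arr s' aHU j = half_u j" "arr s' aHV j = half_v j" using st' j by (simp_all add: static_def)
  note h = half_ends[OF j]
  have c: "card (?S j v) \<le> j" for v
    using card_mono[of "{..<j}" "?S j v"] by fastforce
  have S: "?S (Suc j) v = (if v = half_u j \<and> {half_u j, half_v j} \<in> F then insert j (?S j v) else ?S j v)" for v
    by (auto simp: less_Suc_eq)
  have "Suc (card (?S j v)) < W" for v using c[of v] j by (intro fits_linear) simp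
  moreover from this have "card (?S j v) < W" for v using Suc_lessD by blast
  ultimately show "fits W count_half s' \<and> (\<forall>v < n. arr (result count_half s') aDeg v = card (?S (Suc j) v))"
    using i uv h st' P j lv unfolding S
    by (simp add: count_half_def aval_adj[where F = F] afits_adj[where F = F])
next
  fix s' assume "\<forall>v < n. arr s' aDeg v = card {h. h < 2 * m \<and> half_u h = v \<and> {half_u h, half_v h} \<in> F}"
  then show "degs (arr s') F" by (simp add: degs_def degree_half[OF lv(2)])
qed (use st z X fits_linear[of "Suc (2 * m)"] in \<open>auto simp: count_half_def static_def\<close>)

lemma find_parents:
  assumes st: "static (reg s) (arr s)" and lv: "live (arr s) F" "F \<subseteq> E" and dg: "degs (arr s) F"
    and z: "\<forall>v < n. arr s aPar v = 0" and X: "n + 2 * m + 2 \<le> X"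
  shows "run W X (for_loop rI rHalf parent_half) s (\<lambda>s'. \<forall>v < n.
    latest F {w. {v, w} \<in> F \<and> before F w v} (arr s' aPar v))"
proof (rule run_mono[OF run_for_loop[where N = "2 * m" and X = X and P = "\<lambda>j s'. \<forall>v < n.
    latest F {half_v h | h. h < j \<and> half_u h = v \<and> {v, half_v h} \<in> F \<and> before F (half_v h) v} (arr s' aPar v)"]])
  let ?S = "\<lambda>j v. {half_v h | h. h < j \<and> half_u h = v \<and> {v, half_v h} \<in> F \<and> before F (half_v h) v}"
  fix j and s' :: memory assume j: "j < 2 * m" and P: "\<forall>v < n. latest F (?S j v) (arr s' aPar v)"
    and i: "reg s' rI = j" and f: "frame (for_loop rI rHalf parent_half) s s'"
  have st': "static (reg s') (arr s')" "live (arr s') F" "degs (arr s') F"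
    using static_frame[OF st f] live_frame[OF lv(1) f] degs_frame[OF dg f] by (simp_all add: parent_half_def)
  have uv: "arr s' aHU j = half_u j" "arr s' aHV j = half_v j" using st' j by (simp_all add: static_def)
  note h = half_ends[OF j]
  define u v where u: "u = half_u j" and v: "v = half_v j"
  have uvn: "u < n" "v < n" using h u v by simp_all
  \<comment> \<open>The word bound is demanded of both conjuncts of a condition, so
    \<open>aPar u - 1\<close> is used as a vertex even if \<open>u\<close> has no parent yet.
    Truncated subtraction then yields 0, which is a vertex because \<open>u < n\<close>.\<close>
  have p: "arr s' aPar u - 1 < n" "arr s' aPar u < W"
  proof -
    from P uvn have "latest F (?S j u) (arr s' aPar u)" by simp
    then have "arr s' aPar u = 0 \<or> arr s' aPar u - 1 < n \<and> 0 < arr s' aPar u"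
      using half_ends(2) j by (fastforce simp: latest_def)
    then show "arr s' aPar u - 1 < n" "arr s' aPar u < W"
      using uvn fits_linear[of "arr s' aPar u"] by auto
  qed
  have S: "?S (Suc j) x = (if x = u \<and> {u, v} \<in> F \<and> before F v u then insert v (?S j x) else ?S j x)" for x
    by (auto simp: less_Suc_eq u v)
  have "Suc v < W" using uvn by (intro fits_linear) simp
  moreover have "arr s' aPar u - 1 < W" using p(2) by simp
  ultimately have fit: "fits W parent_half s'"
    using i uv[folded u v] uvn st' j lv p
    by (simp add: parent_half_def aval_adj[where F = F] afits_adj[where F = F] before_exp[where F = F])
  have r: "arr (result parent_half s') aPar = (if {u, v} \<in> F \<and> before F v u then
      (arr s' aPar)(u := (if arr s' aPar u \<noteq> 0 \<and> \<not> before F (arr s' aPar u - 1) v then arr s' aPar u else Suc v))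
      else arr s' aPar)"
    using i uv[folded u v] uvn st' j lv p
    by (simp add: parent_half_def aval_adj[where F = F] before_exp[where F = F])
  have "latest F (?S (Suc j) x) (arr (result parent_half s') aPar x)" if "x < n" for x
    unfolding r S using P[rule_format, OF that] latest_insert[of F "?S j u" "arr s' aPar u" v] by auto
  with fit show "fits W parent_half s' \<and> (\<forall>x < n. latest F (?S (Suc j) x) (arr (result parent_half s') aPar x))"
    by blast
next
  fix s' assume a: "\<forall>v < n.
    latest F {half_v h | h. h < 2 * m \<and> half_u h = v \<and> {v, half_v h} \<in> F \<and> before F (half_v h) v} (arr s' aPar v)"
  have "{half_v h | h. h < 2 * m \<and> half_u h = v \<and> {v, half_v h} \<in> F \<and> before F (half_v h) v} =
      {w. {v, w} \<in> F \<and> before F w v}" for v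
    using half_exists lv(2) by blast
  with a show "\<forall>v < n. latest F {w. {v, w} \<in> F \<and> before F w v} (arr s' aPar v)" by simp
qed (use st z X fits_linear[of "Suc (2 * m)"] in \<open>auto simp: parent_half_def static_def latest_def\<close>)

end

context tp_instance
begin

text \<open>Each half-edge tests one neighbour of a vertex against the parent of that vertex. A
  later violation may overwrite an earlier one, since any will do; the second alternative provides
  exactly the hypotheses of \<open>undominated_obstruction\<close>.\<close>

lemma search_violation:
  assumes st: "static (reg s) (arr s)" and lv: "live (arr s) F" "F \<subseteq> E"
    and par: "\<forall>v < n. latest F {w. {v, w} \<in> F \<and> before F w v} (arr s aPar v)"
    and z: "reg s rFlag = 0" and X: "n + 2 * m + 2 \<le> X"
  shows "run W X (for_loop rI rHalf search_half) s (\<lambda>s'.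
    reg s' rFlag = 0 \<and> (\<forall>a b c d. \<not> obstruction F a b c d) \<or>
    reg s' rFlag = 1 \<and> {reg s' rC, reg s' rB} \<in> F \<and> before F (reg s' rB) (reg s' rC) \<and>
      {reg s' rC, reg s' rD} \<in> F \<and> reg s' rD \<noteq> reg s' rB \<and> {reg s' rD, reg s' rB} \<notin> F)"
proof -
  define bad where "bad v y \<longleftrightarrow> {v, y} \<in> F \<and> arr s aPar v \<noteq> 0 \<and> Suc y \<noteq> arr s aPar v \<and>
    {y, arr s aPar v - 1} \<notin> F" for v y
  have bad: "{v, p} \<in> F \<and> before F p v \<and> {v, y} \<in> F \<and> y \<noteq> p \<and> {y, p} \<notin> F"
    if "v < n" "bad v y" "p = arr s aPar v - 1" for v y p
    using par[rule_format, OF that(1)] that by (auto simp: bad_def latest_def)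
  let ?P = "\<lambda>j (s' :: memory). reg s' rFlag = 0 \<and> (\<forall>h < j. \<not> bad (half_u h) (half_v h)) \<or>
    reg s' rFlag = 1 \<and> reg s' rC < n \<and> bad (reg s' rC) (reg s' rD) \<and> reg s' rB = arr s aPar (reg s' rC) - 1"
  show ?thesis
  proof (rule run_mono[OF run_for_loop[where N = "2 * m" and X = X and P = ?P]])
    fix j and s' :: memory assume j: "j < 2 * m" and P: "?P j s'"
      and i: "reg s' rI = j" and f: "frame (for_loop rI rHalf search_half) s s'"
    have st': "static (reg s') (arr s')" "live (arr s') F"
      using static_frame[OF st f] live_frame[OF lv(1) f] by (simp_all add: search_half_def)
    have uv: "arr s' aHU j = half_u j" "arr s' aHV j = half_v j" using st' j by (simp_all add: static_def)
    note h = half_ends[OF j]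
    have pa: "arr s' aPar = arr s aPar" using frame_arr[OF f, of aPar] by (simp add: search_half_def)
    have p: "arr s aPar (half_u j) - 1 < n" "arr s aPar (half_u j) < W"
    proof -
      from par h have "latest F {w. {half_u j, w} \<in> F \<and> before F w (half_u j)} (arr s aPar (half_u j))" by simp
      then have "arr s aPar (half_u j) = 0 \<or> arr s aPar (half_u j) - 1 < n \<and> 0 < arr s aPar (half_u j)"
        using simple_graph_edgeD[OF G] lv(2) by (fastforce simp: latest_def)
      then show "arr s aPar (half_u j) - 1 < n" "arr s aPar (half_u j) < W"
        using h fits_linear[of "arr s aPar (half_u j)"] by auto
    qed
    have "Suc (half_v j) < W" using h by (intro fits_linear) simp
    moreover have "arr s aPar (half_u j) - 1 < W" using p(2) by simp
    ultimately have fit: "fits W search_half s'"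
      using i uv h st' j lv p pa
      by (simp add: search_half_def aval_adj[where F = F] afits_adj[where F = F])
    have P': "?P (Suc j) (result search_half s')"
    proof (cases "bad (half_u j) (half_v j)")
      case True
      then show ?thesis using i uv h st' j lv p pa
        by (simp add: search_half_def aval_adj[where F = F] afits_adj[where F = F] bad_def)
    next
      case False
      then have "result search_half s' = s'\<lparr>reg := (reg s')(rU := half_u j, rV := half_v j, rT := arr s aPar (half_u j))\<rparr>"
        using i uv h st' j lv p pa
        by (auto simp: search_half_def aval_adj[where F = F] afits_adj[where F = F] bad_def)
      then show ?thesis using P False by (simp add: less_Suc_eq)
    qed
    show "fits W search_half s' \<and> ?P (Suc j) (result search_half s')"
      using fit P' by blast
  next
    fix s' assume P: "?P (2 * m) s'"
    have "\<not> obstruction F a b c d" if "\<forall>h < 2 * m. \<not> bad (half_u h) (half_v h)" for a b c d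
    proof (rule no_obstruction_if_parents_dominate[of n])
      show F: "simple_graph ({..<n}, F)"
        using G lv(2) by (auto simp: simple_graph_def)
      fix v assume v: "v < n" and "\<exists>w. {v, w} \<in> F \<and> before F w v"
      with par[rule_format, OF v] have q: "0 < arr s aPar v"
        "is_parent F v (arr s aPar v - 1)"
        by (auto simp: latest_def is_parent_def)
      moreover have "y = arr s aPar v - 1 \<or> {y, arr s aPar v - 1} \<in> F" if y: "{v, y} \<in> F" for y
      proof -
        obtain h where "h < 2 * m" "half_u h = v" "half_v h = y"
          using half_exists[of v y] y lv(2) by blast
        with \<open>\<forall>h < 2 * m. \<not> bad (half_u h) (half_v h)\<close> have "\<not> bad v y" by blast
        then show ?thesis using y q(1) by (auto simp: bad_def)
      qed
      ultimately show "\<exists>p. is_parent F v p \<and> (\<forall>y. {v, y} \<in> F \<longrightarrow> y = p \<or> {y, p} \<in> F)" by blast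
    qed
    with P bad show "reg s' rFlag = 0 \<and> (\<forall>a b c d. \<not> obstruction F a b c d) \<or>
      reg s' rFlag = 1 \<and> {reg s' rC, reg s' rB} \<in> F \<and> before F (reg s' rB) (reg s' rC) \<and>
      {reg s' rC, reg s' rD} \<in> F \<and> reg s' rD \<noteq> reg s' rB \<and> {reg s' rD, reg s' rB} \<notin> F"
      by blast
  qed (use st z X fits_linear[of "Suc (2 * m)"] in \<open>auto simp: search_half_def static_def\<close>)
qed

text \<open>No success flag is kept: the degree count guarantees a hit, so whatever
  \<open>rA\<close> held before the scan is overwritten.\<close>

lemma search_end:
  assumes st: "static (reg s) (arr s)" and lv: "live (arr s) F" "F \<subseteq> E"
    and v: "{reg s rC, reg s rB} \<in> F" "before F (reg s rB) (reg s rC)"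
      "{reg s rC, reg s rD} \<in> F" "reg s rD \<noteq> reg s rB" "{reg s rD, reg s rB} \<notin> F"
    and X: "n + 2 * m + 2 \<le> X"
  shows "run W X (for_loop rI rN search_end) s (\<lambda>s'.
    obstruction F (reg s' rA) (reg s' rB) (reg s' rC) (reg s' rD))"
proof -
  define good where "good x \<longleftrightarrow> {reg s rB, x} \<in> F \<and> x \<noteq> reg s rC \<and> {reg s rC, x} \<notin> F" for x
  have F: "simple_graph ({..<n}, F)" using G lv(2) by (auto simp: simple_graph_def)
  have bc: "reg s rB < n" "reg s rC < n" using simple_graph_edgeD[OF F v(1)] by auto
  let ?P = "\<lambda>j (s' :: memory). (\<exists>x < j. good x) \<longrightarrow> good (reg s' rA)"
  have "run W X (for_loop rI rN search_end) s (?P n)"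
  proof (rule run_for_loop[where P = ?P])
    fix j and s' :: memory assume j: "j < n" and P: "?P j s'"
      and i: "reg s' rI = j" and f: "frame (for_loop rI rN search_end) s s'"
    have st': "static (reg s') (arr s')" "live (arr s') F"
      using static_frame[OF st f] live_frame[OF lv(1) f] by (simp_all add: search_end_def)
    have r: "reg s' rB = reg s rB" "reg s' rC = reg s rC"
      using frame_reg[OF f] by (simp_all add: search_end_def)
    have fit: "fits W search_end s'"
      using i st' j lv bc r by (simp add: search_end_def aval_adj[where F = F] afits_adj[where F = F])
    have res: "result search_end s' = (if good j then s'\<lparr>reg := (reg s')(rA := j)\<rparr> else s')"
      using i st' j lv bc r by (auto simp: search_end_def aval_adj[where F = F] good_def)
    show "fits W search_end s' \<and> ?P (Suc j) (result search_end s')"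
      using fit P unfolding res by (auto simp: less_Suc_eq)
  qed (use st X fits_linear[of "Suc n"] in \<open>auto simp: search_end_def static_def\<close>)
  then show ?thesis
  proof (rule run_frame)
    fix s' assume P: "?P n s'" and f: "frame (for_loop rI rN search_end) s s'"
    have r: "reg s' rB = reg s rB" "reg s' rC = reg s rC" "reg s' rD = reg s rD"
      using frame_reg[OF f] by (simp_all add: search_end_def)
    have "\<exists>x < n. good x" unfolding good_def by (rule undominated_obstruction(1)[OF F v])
    with P have "good (reg s' rA)" by blast
    then show "obstruction F (reg s' rA) (reg s' rB) (reg s' rC) (reg s' rD)"
      unfolding good_def r using undominated_obstruction(2)[OF F v] by blast
  qed
qed

definition asymmetric :: "nat set set \<Rightarrow> nat \<Rightarrow> nat \<Rightarrow> nat \<Rightarrow> nat \<Rightarrow> nat \<Rightarrow> bool" where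
  "asymmetric F a b c d z \<longleftrightarrow> z < n \<and> z \<notin> {a, b, c, d} \<and>
     \<not> (({z, a} \<in> F \<longleftrightarrow> {z, d} \<in> F) \<and> ({z, b} \<in> F \<longleftrightarrow> {z, c} \<in> F))"

lemma search_asymmetric:
  assumes st: "static (reg s) (arr s)" and lv: "live (arr s) F" "F \<subseteq> E"
    and o: "reg s rA < n" "reg s rB < n" "reg s rC < n" "reg s rD < n"
    and z: "reg s rFlag = 0" and X: "n + 2 * m + 2 \<le> X"
  shows "run W X (for_loop rI rN search_asymmetric) s (\<lambda>s'.
    reg s' rFlag = 0 \<and> (\<forall>z. \<not> asymmetric F (reg s rA) (reg s rB) (reg s rC) (reg s rD) z) \<or>
    reg s' rFlag = 1 \<and> asymmetric F (reg s rA) (reg s rB) (reg s rC) (reg s rD) (reg s' rZ))"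
proof -
  define good where "good = asymmetric F (reg s rA) (reg s rB) (reg s rC) (reg s rD)"
  let ?P = "\<lambda>j (s' :: memory). reg s' rFlag = 0 \<and> (\<forall>x < j. \<not> good x) \<or> reg s' rFlag = 1 \<and> good (reg s' rZ)"
  have "run W X (for_loop rI rN search_asymmetric) s (?P n)"
  proof (rule run_for_loop[where P = ?P])
    fix j and s' :: memory assume j: "j < n" and P: "?P j s'"
      and i: "reg s' rI = j" and f: "frame (for_loop rI rN search_asymmetric) s s'"
    have st': "static (reg s') (arr s')" "live (arr s') F"
      using static_frame[OF st f] live_frame[OF lv(1) f] by (simp_all add: search_asymmetric_def)
    have r: "reg s' rA = reg s rA" "reg s' rB = reg s rB" "reg s' rC = reg s rC" "reg s' rD = reg s rD"
      using frame_reg[OF f] by (simp_all add: search_asymmetric_def)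
    have fit: "fits W search_asymmetric s'"
      using i st' j lv o r
      by (simp add: search_asymmetric_def symmetric_exp_def afits_adj[where F = F])
    have res: "result search_asymmetric s' =
        (if good j then s'\<lparr>reg := (reg s')(rFlag := 1, rZ := j)\<rparr> else s')"
      using i st' j lv o r
      by (auto simp: search_asymmetric_def symmetric_exp_def aval_adj[where F = F] good_def asymmetric_def
          simp del: of_bool_eq_iff split: split_of_bool)
    show "fits W search_asymmetric s' \<and> ?P (Suc j) (result search_asymmetric s')"
      using fit P unfolding res by (auto simp: less_Suc_eq)
  qed (use st z X fits_linear[of "Suc n"] in \<open>auto simp: search_asymmetric_def static_def\<close>)
  then show ?thesis by (rule run_mono) (auto simp: good_def asymmetric_def)
qed

end

section \<open>Emitting branches\<close>

definition push :: "nat list \<Rightarrow> com" where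
  "push rs = block
    [Set_Arr aLev (Reg rTop) (Reg rLen), Set_Arr aCnt (Reg rTop) (Const (length rs)),
     block (map (\<lambda>i. Set_Arr (aStack + i) (Reg rTop) (Reg (rs ! i))) [0..<length rs]),
     Set_Reg rTop (Add (Reg rTop) (Const 1))]"

primrec pushes :: "nat list list \<Rightarrow> com" where
  "pushes [] = Skip"
| "pushes (rs # xs) = Seq (push rs) (pushes xs)"

definition path_ids :: com where
  "path_ids = block
    [Set_Reg rAB (id_exp (Reg rA) (Reg rB)), Set_Reg rBC (id_exp (Reg rB) (Reg rC)),
     Set_Reg rCD (id_exp (Reg rC) (Reg rD)), Set_Reg rAD (id_exp (Reg rA) (Reg rD))]"

definition third_ids :: com where
  "third_ids = block
    [Set_Reg rZA (id_exp (Reg rZ) (Reg rA)), Set_Reg rZB (id_exp (Reg rZ) (Reg rB)),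
     Set_Reg rZC (id_exp (Reg rZ) (Reg rC))]"

definition emit_C4 :: com where
  "emit_C4 = Seq path_ids (pushes
    [[rAB, rBC], [rAB, rCD], [rAB, rAD], [rBC, rCD], [rBC, rAD], [rCD, rAD]])"

definition emit_symmetric :: com where
  "emit_symmetric = Seq path_ids (pushes [[rAB], [rBC]])"

definition emit_third :: "nat list list \<Rightarrow> com" where
  "emit_third xs = Seq path_ids (Seq third_ids (pushes xs))"

definition mirror :: com where
  "mirror = If (Not (And (Not (Less (adj_exp (Reg rZ) (Reg rA)) (adj_exp (Reg rZ) (Reg rD))))
      (Not (And (Eq (adj_exp (Reg rZ) (Reg rA)) (adj_exp (Reg rZ) (Reg rD)))
        (Less (adj_exp (Reg rZ) (Reg rB)) (adj_exp (Reg rZ) (Reg rC)))))))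
    (block [Set_Reg rT (Reg rA), Set_Reg rA (Reg rD), Set_Reg rD (Reg rT),
      Set_Reg rT (Reg rB), Set_Reg rB (Reg rC), Set_Reg rC (Reg rT)]) Skip"

definition emit_asymmetric :: com where
  "emit_asymmetric =
    If (And (Eq (adj_exp (Reg rZ) (Reg rB)) (Const 0)) (Eq (adj_exp (Reg rZ) (Reg rC)) (Const 1)))
      (Seq (Set_Reg rD (Reg rZ)) emit_C4)
    (If (Eq (adj_exp (Reg rZ) (Reg rD)) (Const 1)) (Seq (Set_Reg rA (Reg rZ)) emit_C4)
    (If (Eq (adj_exp (Reg rZ) (Reg rB)) (Const 0)) (emit_third [[rAB], [rBC], [rCD, rZA]])
    (If (Eq (adj_exp (Reg rZ) (Reg rC)) (Const 0)) (emit_third [[rBC], [rCD], [rAB, rZB]])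
      (emit_third [[rCD], [rAB, rZA], [rBC, rZC], [rAB, rZC, rZB], [rBC, rZA, rZB]]))))"

definition branch :: com where
  "branch = Seq (for_loop rI rN search_end)
    (If (Eq (adj_exp (Reg rA) (Reg rD)) (Const 1)) emit_C4
      (Seq (Set_Reg rFlag (Const 0)) (Seq (for_loop rI rN search_asymmetric)
        (If (Eq (Reg rFlag) (Const 0)) emit_symmetric (Seq mirror emit_asymmetric)))))"

text \<open>Abstracts the memory to a list with the oldest entry first. The arrays of the stack are
  those numbered from \<open>aLev\<close> on, so writes to lower-numbered arrays, the trail among
  them, leave it unchanged.\<close>

definition stack :: "(nat \<Rightarrow> nat \<Rightarrow> nat) \<Rightarrow> nat \<Rightarrow> (nat \<times> nat list) list" where
  "stack A t = map (\<lambda>j. (A aLev j, map (\<lambda>i. A (aStack + i) j) [0..<A aCnt j])) [0..<t]"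

lemma length_stack [simp]: "length (stack A t) = t"
  by (simp add: stack_def)

lemma stack_arr [simp]: "a < aLev \<Longrightarrow> stack (A(a := f)) t = stack A t"
  by (simp add: stack_def)

text \<open>For each of the three possible lengths \<open>push rs\<close> unfolds to a concrete
  block, which rewriting can evaluate.\<close>

lemma result_push:
  assumes "rs \<noteq> []" "length rs \<le> 3"
  shows "stack (arr (result (push rs) s)) (Suc (reg s rTop)) =
      stack (arr s) (reg s rTop) @ [(reg s rLen, map (reg s) rs)]" (is ?A)
    and "reg (result (push rs) s) = (reg s)(rTop := Suc (reg s rTop))" (is ?B)
    and "loop_free (push rs)" (is ?C)
    and "reg s rLen < W \<Longrightarrow> Suc (reg s rTop) < W \<Longrightarrow> 3 < W \<Longrightarrow> \<forall>r \<in> set rs. reg s r < W \<Longrightarrow>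
      fits W (push rs) s" (is "_ \<Longrightarrow> _ \<Longrightarrow> _ \<Longrightarrow> _ \<Longrightarrow> ?D")
proof -
  have u: "[0..<2] = [0, 1]" "[0..<3] = [0, 1, 2]" by (simp_all add: upt_rec)
  have "0 < length rs" using assms by simp
  then have "length rs = 1 \<or> length rs = 2 \<or> length rs = 3" using assms by linarith
  then consider x where "rs = [x]" | x y where "rs = [x, y]" | x y z where "rs = [x, y, z]"
    by (auto simp: length_Suc_conv numeral_eq_Suc)
  then have "?A \<and> ?B \<and> ?C \<and> (reg s rLen < W \<and> Suc (reg s rTop) < W \<and> 3 < W \<and> (\<forall>r \<in> set rs. reg s r < W) \<longrightarrow> ?D)"
    using u by cases (simp_all add: push_def stack_def)
  then show ?A ?B ?C "reg s rLen < W \<Longrightarrow> Suc (reg s rTop) < W \<Longrightarrow> 3 < W \<Longrightarrow> \<forall>r \<in> set rs. reg s r < W \<Longrightarrow> ?D"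
    by blast+
qed

lemma loop_free_pushes: "\<forall>rs \<in> set xs. rs \<noteq> [] \<and> length rs \<le> 3 \<Longrightarrow> loop_free (pushes xs)"
  by (induction xs) (simp_all add: result_push(3))

lemma result_pushes:
  assumes "\<forall>rs \<in> set xs. rs \<noteq> [] \<and> length rs \<le> 3 \<and> rTop \<notin> set rs \<and> (\<forall>r \<in> set rs. reg s r < W)"
    and "reg s rLen < W" "reg s rTop + length xs < W" "3 < W"
  shows "fits W (pushes xs) s" (is ?A)
    and "stack (arr (result (pushes xs) s)) (reg (result (pushes xs) s) rTop) =
      stack (arr s) (reg s rTop) @ map (\<lambda>rs. (reg s rLen, map (reg s) rs)) xs" (is ?B)
proof -
  from assms have "?A \<and> ?B"
  proof (induction xs arbitrary: s)
    case Nil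
    then show ?case by simp
  next
    case (Cons rs xs)
    let ?s = "result (push rs) s"
    have rs: "rs \<noteq> []" "length rs \<le> 3" "rTop \<notin> set rs" using Cons.prems(1) by auto
    note p = result_push[OF rs(1,2)]
    have f: "fits W (push rs) s"
      using Cons.prems rs by (intro result_push(4)) auto
    have m: "map (reg ?s) rs' = map (reg s) rs'" if "rs' \<in> set xs" for rs'
      using Cons.prems(1) that by (auto simp: p)
    have "fits W (pushes xs) ?s \<and> stack (arr (result (pushes xs) ?s)) (reg (result (pushes xs) ?s) rTop) =
      stack (arr ?s) (reg ?s rTop) @ map (\<lambda>rs. (reg ?s rLen, map (reg ?s) rs)) xs"
    proof (rule Cons.IH)
      show "\<forall>rs \<in> set xs. rs \<noteq> [] \<and> length rs \<le> 3 \<and> rTop \<notin> set rs \<and> (\<forall>r \<in> set rs. reg ?s r < W)"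
        using Cons.prems(1) by (auto simp: p)
    qed (use Cons.prems p in auto)
    then show ?case
      using f m by (simp add: p cong: map_cong)
  qed
  then show ?A ?B by simp_all
qed

lemma obstruction_reverse: "obstruction F a b c d \<Longrightarrow> obstruction F d c b a"
  by (auto simp: obstruction_def insert_commute)

lemma of_bool_eq_Suc_0 [simp]: "of_bool P = Suc 0 \<longleftrightarrow> P"
  by simp

section \<open>Validity of the emitted branches\<close>

context tp_instance
begin

definition eid :: "nat set \<Rightarrow> nat" where
  "eid e = Suc (THE i. i < m \<and> edge i = e)"

lemma eid:
  assumes "e \<in> E" shows "eid e \<in> {1..m}" "edge (eid e - 1) = e"
proof -
  from assms obtain i where "i < m" "edge i = e" by (auto simp: edges)
  then have "\<exists>!i. i < m \<and> edge i = e" using edge_eq_iff by blast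
  from theI'[OF this] show "eid e \<in> {1..m}" "edge (eid e - 1) = e" by (auto simp: eid_def)
qed

lemma eid_inj: "inj_on eid E"
  using eid(2) by (metis inj_onI)

lemma aval_id_eid:
  assumes "static (reg s) (arr s)" "aval e s < n" "aval f s < n" "{aval e s, aval f s} \<in> E"
  shows "aval (id_exp e f) s = eid {aval e s, aval f s}"
  using aval_id[OF assms(1-3), of "eid {aval e s, aval f s} - 1"] eid[OF assms(4)] by auto

text \<open>The contract between the case analysis and the search. The constant is a round number
  just above \<open>6 / 2.450^2\<close>, the value of the tightest rule, that for \<open>C4\<close>.
  At most six nonempty branches keep the stack low, and new edges outside \<open>D\<close> keep the
  trail free of repetitions, so that its length is the number of deleted edges.\<close>

definition branching :: "nat set set \<Rightarrow> nat list list \<Rightarrow> bool" where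
  "branching D idss \<longleftrightarrow> length idss \<le> 6 \<and>
     (\<forall>ids \<in> set idss. ids \<noteq> [] \<and> length ids \<le> 3 \<and> distinct ids \<and> set ids \<subseteq> {1..m} \<and>
        ids_edges ids \<inter> D = {}) \<and>
     (\<Sum>ids\<leftarrow>idss. (1 / 2.450) ^ length ids) \<le> (9997 / 10000 :: real) \<and>
     (extendable ({..<n}, E) k D \<longrightarrow>
        (\<exists>ids \<in> set idss. extendable ({..<n}, E) k (D \<union> ids_edges ids)))"

lemma branchingI:
  assumes "length ess \<le> 6"
    and e: "\<forall>es' \<in> set ess. es' \<noteq> [] \<and> length es' \<le> 3 \<and> distinct es' \<and> set es' \<subseteq> E - D"
    and "(\<Sum>es'\<leftarrow>ess. (1 / 2.450) ^ length es') \<le> (9997 / 10000 :: real)"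
    and x: "extendable ({..<n}, E) k D \<Longrightarrow> \<exists>X \<in> set (map set ess). extendable ({..<n}, E) k (D \<union> X)"
  shows "branching D (map (map eid) ess)"
proof -
  have ie: "ids_edges (map eid es') = set es'" if "es' \<in> set ess" for es'
  proof -
    have "(\<lambda>e. edge (eid e - 1)) ` set es' = (\<lambda>e. e) ` set es'"
      using e that eid(2) by (intro image_cong) auto
    then show ?thesis by (simp add: ids_edges_def image_image)
  qed
  have "distinct (map eid es')" "eid ` set es' \<subseteq> {1..m}" if "es' \<in> set ess" for es'
  proof -
    from e that have "set es' \<subseteq> E" "distinct es'" by auto
    then show "distinct (map eid es')" "eid ` set es' \<subseteq> {1..m}"
      using inj_on_subset[OF eid_inj] eid(1) by (auto simp: distinct_map)
  qed
  then show ?thesis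
    unfolding branching_def using assms ie by (auto simp: o_def)
qed

text \<open>The situation in which a node is expanded: its own entry has been popped,
  \<open>st\<close> lies below it and \<open>L\<close> is the length of its trail. The last two
  bounds ensure that pushing stays within the word bound.\<close>

definition ready :: "nat set set \<Rightarrow> (nat \<times> nat list) list \<Rightarrow> nat \<Rightarrow> memory \<Rightarrow> bool" where
  "ready D st L s \<longleftrightarrow> static (reg s) (arr s) \<and> live (arr s) (E - D) \<and>
     stack (arr s) (reg s rTop) = st \<and> reg s rLen = L \<and> length st \<le> 6 * (k + 4) \<and> L \<le> k"

lemma ready_top: "ready D st L s \<Longrightarrow> reg s rTop = length st"
  using length_stack by (metis ready_def)

lemma ready_reg [simp]:
  "r \<notin> {rN, rM, rK, rHalf, rTop, rLen} \<Longrightarrow> ready D st L (s\<lparr>reg := (reg s)(r := x)\<rparr>) \<longleftrightarrow> ready D st L s"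
  by (simp add: ready_def)

lemma ready_frame:
  assumes "ready D st L s" "frame c s s'" "written_regs c \<inter> {rN, rM, rK, rHalf, rTop, rLen} = {}"
    "written_arrs c \<inter> {aU, aV, aMul, aId, aHU, aHV, aLive} = {}" "\<forall>a \<in> written_arrs c. a < aLev"
  shows "ready D st L s'"
proof -
  have "static (reg s') (arr s')" "live (arr s') (E - D)"
    using assms static_frame[OF _ assms(2)] live_frame[OF _ assms(2)] by (auto simp: ready_def)
  moreover have "reg s' r = reg s r" if "r \<in> {rTop, rLen}" for r
    using frame_reg[OF assms(2), of r] assms(3) that by blast
  moreover have "arr s' a = arr s a" if "aLev \<le> a" for a
    using frame_arr[OF assms(2), of a] assms(5) that leD by blast
  ultimately show ?thesis using assms(1) by (simp add: ready_def stack_def)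
qed

definition branched :: "nat set set \<Rightarrow> (nat \<times> nat list) list \<Rightarrow> nat \<Rightarrow> memory \<Rightarrow> bool" where
  "branched D st L s \<longleftrightarrow> (\<exists>idss. branching D idss \<and> stack (arr s) (reg s rTop) = st @ map (Pair L) idss)"

lemma eid_fits: "e \<in> E \<Longrightarrow> eid e < W"
  using eid(1)[of e] fits_linear[of "eid e"] by simp

text \<open>\<open>xs\<close> names registers and \<open>ess\<close> the edges whose identifiers
  they hold. The combinatorial conditions can thus be stated about edges and discharged by the
  branching rules.\<close>

lemma run_pushes:
  assumes r: "ready D st L s" and v: "map (map (reg s)) xs = map (map eid) ess"
    and t: "rTop \<notin> \<Union> (set (map set xs))"
    and b: "length ess \<le> 6"
      "\<forall>es' \<in> set ess. es' \<noteq> [] \<and> length es' \<le> 3 \<and> distinct es' \<and> set es' \<subseteq> E - D"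
      "(\<Sum>es'\<leftarrow>ess. (1 / 2.450) ^ length es') \<le> (9997 / 10000 :: real)"
      "extendable ({..<n}, E) k D \<Longrightarrow> \<exists>X \<in> set (map set ess). extendable ({..<n}, E) k (D \<union> X)"
    and X: "1 \<le> X"
  shows "run W X (pushes xs) s (branched D st L)"
proof -
  have len: "length xs = length ess" using arg_cong[OF v, of length] by simp
  have xs: "rs \<noteq> [] \<and> length rs \<le> 3 \<and> rTop \<notin> set rs \<and> (\<forall>r \<in> set rs. reg s r < W)" if "rs \<in> set xs" for rs
  proof -
    from that v have "map (reg s) rs \<in> set (map (map eid) ess)" by (metis image_eqI image_set)
    then obtain es' where e: "es' \<in> set ess" "map (reg s) rs = map eid es'" by auto
    with b(2) have es': "es' \<noteq> []" "length es' \<le> 3" "set es' \<subseteq> E" by auto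
    have "\<forall>x \<in> set (map (reg s) rs). x < W" unfolding e(2) using eid_fits es'(3) by auto
    moreover have "length rs = length es'" using arg_cong[OF e(2), of length] by simp
    ultimately show ?thesis using es' t that by auto
  qed
  have "reg s rTop + length xs < W"
    using r b(1) len ready_top[OF r] by (intro fits_linear) (simp add: ready_def)
  moreover have "reg s rLen < W" using r by (intro fits_linear) (simp add: ready_def)
  ultimately have p: "fits W (pushes xs) s"
    "stack (arr (result (pushes xs) s)) (reg (result (pushes xs) s) rTop) =
      stack (arr s) (reg s rTop) @ map (\<lambda>rs. (reg s rLen, map (reg s) rs)) xs"
    using result_pushes[of xs s W] xs by auto
  have "map (\<lambda>rs. (reg s rLen, map (reg s) rs)) xs = map (Pair L) (map (map eid) ess)"
    unfolding v[symmetric] using r by (simp add: ready_def)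
  then have "branched D st L (result (pushes xs) s)"
    unfolding branched_def p using branchingI[OF b] r by (auto simp: ready_def)
  then show ?thesis using p X by (intro run_loop_free loop_free_pushes) (use xs in auto)
qed

lemma obstruction_ends:
  assumes "obstruction (E - D) a b c d" shows "a < n" "b < n" "c < n" "d < n"
  using assms simple_graph_edgeD[OF G] by (auto simp: obstruction_def)

lemma run_path_ids:
  assumes r: "ready D st L s" and o: "obstruction (E - D) (reg s rA) (reg s rB) (reg s rC) (reg s rD)"
    and X: "1 \<le> X"
  shows "run W X path_ids s (\<lambda>s'. ready D st L s' \<and>
    reg s' rAB = eid {reg s rA, reg s rB} \<and> reg s' rBC = eid {reg s rB, reg s rC} \<and>
    reg s' rCD = eid {reg s rC, reg s rD} \<and>
    ({reg s rA, reg s rD} \<in> E \<longrightarrow> reg s' rAD = eid {reg s rA, reg s rD}))"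
proof (rule run_loop_free)
  note v = obstruction_ends[OF o]
  have st: "static (reg s) (arr s)" using r by (simp add: ready_def)
  show "fits W path_ids s" using v st by (simp add: path_ids_def afits_id)
  have e: "{reg s rA, reg s rB} \<in> E" "{reg s rB, reg s rC} \<in> E" "{reg s rC, reg s rD} \<in> E"
    using o by (auto simp: obstruction_def)
  show "ready D st L (result path_ids s) \<and>
    reg (result path_ids s) rAB = eid {reg s rA, reg s rB} \<and>
    reg (result path_ids s) rBC = eid {reg s rB, reg s rC} \<and>
    reg (result path_ids s) rCD = eid {reg s rC, reg s rD} \<and>
    ({reg s rA, reg s rD} \<in> E \<longrightarrow> reg (result path_ids s) rAD = eid {reg s rA, reg s rD})"
    using v st r e by (simp add: path_ids_def aval_id_eid ready_def)
qed (use X in \<open>simp_all add: path_ids_def\<close>)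

lemma run_third_ids:
  assumes r: "ready D st L s" and v: "reg s rA < n" "reg s rB < n" "reg s rC < n" "reg s rZ < n"
    and X: "1 \<le> X"
  shows "run W X third_ids s (\<lambda>s'. ready D st L s' \<and>
    ({reg s rZ, reg s rA} \<in> E \<longrightarrow> reg s' rZA = eid {reg s rZ, reg s rA}) \<and>
    ({reg s rZ, reg s rB} \<in> E \<longrightarrow> reg s' rZB = eid {reg s rZ, reg s rB}) \<and>
    ({reg s rZ, reg s rC} \<in> E \<longrightarrow> reg s' rZC = eid {reg s rZ, reg s rC}))"
proof (rule run_loop_free)
  have st: "static (reg s) (arr s)" using r by (simp add: ready_def)
  show "fits W third_ids s" using v st by (simp add: third_ids_def afits_id)
  show "ready D st L (result third_ids s) \<and>
    ({reg s rZ, reg s rA} \<in> E \<longrightarrow> reg (result third_ids s) rZA = eid {reg s rZ, reg s rA}) \<and>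
    ({reg s rZ, reg s rB} \<in> E \<longrightarrow> reg (result third_ids s) rZB = eid {reg s rZ, reg s rB}) \<and>
    ({reg s rZ, reg s rC} \<in> E \<longrightarrow> reg (result third_ids s) rZC = eid {reg s rZ, reg s rC})"
    using v st r by (simp add: third_ids_def aval_id_eid ready_def)
qed (use X in \<open>simp_all add: third_ids_def\<close>)

lemma run_emit_C4:
  assumes r: "ready D st L s" and o: "obstruction (E - D) (reg s rA) (reg s rB) (reg s rC) (reg s rD)"
    and ad: "{reg s rA, reg s rD} \<in> E - D" and X: "1 \<le> X"
  shows "run W X emit_C4 s (branched D st L)"
  unfolding emit_C4_def
proof (rule run_Seq[OF run_path_ids[OF r o X] _ X], elim conjE)
  let ?a = "reg s rA" and ?b = "reg s rB" and ?c = "reg s rC" and ?d = "reg s rD"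
  fix s' assume s': "ready D st L s'" "reg s' rAB = eid {?a, ?b}" "reg s' rBC = eid {?b, ?c}"
    "reg s' rCD = eid {?c, ?d}" "{?a, ?d} \<in> E \<longrightarrow> reg s' rAD = eid {?a, ?d}"
  let ?ess = "[[{?a, ?b}, {?b, ?c}], [{?a, ?b}, {?c, ?d}], [{?a, ?b}, {?a, ?d}],
      [{?b, ?c}, {?c, ?d}], [{?b, ?c}, {?a, ?d}], [{?c, ?d}, {?a, ?d}]]"
  show "run W X (pushes [[rAB, rBC], [rAB, rCD], [rAB, rAD], [rBC, rCD], [rBC, rAD], [rCD, rAD]]) s'
    (branched D st L)"
  proof (rule run_pushes[OF s'(1), where ess = ?ess])
    show "\<forall>es' \<in> set ?ess. es' \<noteq> [] \<and> length es' \<le> 3 \<and> distinct es' \<and> set es' \<subseteq> E - D"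
      using o ad by (auto simp: obstruction_def doubleton_eq_iff)
    assume "extendable ({..<n}, E) k D"
    from branch_C4[OF G this o ad]
    show "\<exists>X \<in> set (map set ?ess). extendable ({..<n}, E) k (D \<union> X)" by simp
  qed (use s' ad X in \<open>simp_all add: power2_eq_square\<close>)
qed

lemma run_emit_symmetric:
  assumes r: "ready D st L s" and o: "obstruction (E - D) (reg s rA) (reg s rB) (reg s rC) (reg s rD)"
    and z: "\<forall>z. \<not> asymmetric (E - D) (reg s rA) (reg s rB) (reg s rC) (reg s rD) z"
    and D: "D \<subseteq> E" and X: "1 \<le> X"
  shows "run W X emit_symmetric s (branched D st L)"
  unfolding emit_symmetric_def
proof (rule run_Seq[OF run_path_ids[OF r o X] _ X], elim conjE)
  let ?a = "reg s rA" and ?b = "reg s rB" and ?c = "reg s rC" and ?d = "reg s rD"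
  fix s' assume s': "ready D st L s'" "reg s' rAB = eid {?a, ?b}" "reg s' rBC = eid {?b, ?c}"
  let ?ess = "[[{?a, ?b}], [{?b, ?c}]]"
  show "run W X (pushes [[rAB], [rBC]]) s' (branched D st L)"
  proof (rule run_pushes[OF s'(1), where ess = ?ess])
    show "\<forall>es' \<in> set ?ess. es' \<noteq> [] \<and> length es' \<le> 3 \<and> distinct es' \<and> set es' \<subseteq> E - D"
      using o by (auto simp: obstruction_def)
    assume "extendable ({..<n}, E) k D"
    from branch_symmetric[OF G this D o] z
    have "\<exists>X \<in> set [{{?a, ?b}}, {{?b, ?c}}]. extendable ({..<n}, E) k (D \<union> X)"
      unfolding asymmetric_def by (metis lessThan_iff)
    then show "\<exists>X \<in> set (map set ?ess). extendable ({..<n}, E) k (D \<union> X)" by simp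
  qed (use s' X in simp_all)
qed

text \<open>Shared by the three rules that use the fifth vertex, hence the pushing stays a
  hypothesis. The pairs at \<open>z\<close> have a known identifier only if they are edges, which
  each rule supplies for the pairs it deletes.\<close>

lemma run_emit_third:
  assumes r: "ready D st L s" and o: "obstruction (E - D) (reg s rA) (reg s rB) (reg s rC) (reg s rD)"
    and z: "reg s rZ < n" and X: "1 \<le> X"
    and p: "\<And>s'. ready D st L s' \<Longrightarrow>
      reg s' rAB = eid {reg s rA, reg s rB} \<Longrightarrow> reg s' rBC = eid {reg s rB, reg s rC} \<Longrightarrow>
      reg s' rCD = eid {reg s rC, reg s rD} \<Longrightarrow>
      ({reg s rZ, reg s rA} \<in> E \<Longrightarrow> reg s' rZA = eid {reg s rZ, reg s rA}) \<Longrightarrow>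
      ({reg s rZ, reg s rB} \<in> E \<Longrightarrow> reg s' rZB = eid {reg s rZ, reg s rB}) \<Longrightarrow>
      ({reg s rZ, reg s rC} \<in> E \<Longrightarrow> reg s' rZC = eid {reg s rZ, reg s rC}) \<Longrightarrow>
      run W X (pushes xs) s' (branched D st L)"
  shows "run W X (emit_third xs) s (branched D st L)"
  unfolding emit_third_def
proof (rule run_Seq[OF run_path_ids[OF r o X] _ X], elim conjE)
  fix s1 assume s1: "ready D st L s1" "reg s1 rAB = eid {reg s rA, reg s rB}"
    "reg s1 rBC = eid {reg s rB, reg s rC}" "reg s1 rCD = eid {reg s rC, reg s rD}"
    and f: "frame path_ids s s1"
  have v: "reg s1 rA = reg s rA" "reg s1 rB = reg s rB" "reg s1 rC = reg s rC" "reg s1 rZ = reg s rZ"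
    using frame_reg[OF f] by (simp_all add: path_ids_def)
  have "run W X third_ids s1 (\<lambda>s'. ready D st L s' \<and>
    ({reg s1 rZ, reg s1 rA} \<in> E \<longrightarrow> reg s' rZA = eid {reg s1 rZ, reg s1 rA}) \<and>
    ({reg s1 rZ, reg s1 rB} \<in> E \<longrightarrow> reg s' rZB = eid {reg s1 rZ, reg s1 rB}) \<and>
    ({reg s1 rZ, reg s1 rC} \<in> E \<longrightarrow> reg s' rZC = eid {reg s1 rZ, reg s1 rC}))"
    using v z obstruction_ends[OF o] by (intro run_third_ids[OF s1(1) _ _ _ _ X]) simp_all
  then show "run W X (Seq third_ids (pushes xs)) s1 (branched D st L)"
  proof (rule run_Seq[OF _ _ X], elim conjE)
    fix s2 assume s2: "ready D st L s2"
      "{reg s1 rZ, reg s1 rA} \<in> E \<longrightarrow> reg s2 rZA = eid {reg s1 rZ, reg s1 rA}"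
      "{reg s1 rZ, reg s1 rB} \<in> E \<longrightarrow> reg s2 rZB = eid {reg s1 rZ, reg s1 rB}"
      "{reg s1 rZ, reg s1 rC} \<in> E \<longrightarrow> reg s2 rZC = eid {reg s1 rZ, reg s1 rC}"
      and f2: "frame third_ids s1 s2"
    have "reg s2 rAB = reg s1 rAB" "reg s2 rBC = reg s1 rBC" "reg s2 rCD = reg s1 rCD"
      using frame_reg[OF f2] by (simp_all add: third_ids_def)
    then show "run W X (pushes xs) s2 (branched D st L)"
      using s2 s1 v by (intro p) simp_all
  qed
qed

text \<open>The asymmetry witnesses left after reversing the path if necessary.\<close>

definition skew :: "nat set set \<Rightarrow> memory \<Rightarrow> bool" where
  "skew F s \<longleftrightarrow> obstruction F (reg s rA) (reg s rB) (reg s rC) (reg s rD) \<and>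
     reg s rZ < n \<and> reg s rZ \<notin> {reg s rA, reg s rB, reg s rC, reg s rD} \<and>
     ({reg s rZ, reg s rA} \<in> F \<and> {reg s rZ, reg s rD} \<notin> F \<or>
      ({reg s rZ, reg s rA} \<in> F \<longleftrightarrow> {reg s rZ, reg s rD} \<in> F) \<and>
      {reg s rZ, reg s rB} \<in> F \<and> {reg s rZ, reg s rC} \<notin> F)"

text \<open>The path is oriented lexicographically, by the adjacency of \<open>z\<close> to the two
  ends and, on a tie, to the two middle vertices. Asymmetry of \<open>z\<close> says that one of the
  two comparisons is strict.\<close>

lemma run_mirror:
  assumes r: "ready D st L s" and o: "obstruction (E - D) (reg s rA) (reg s rB) (reg s rC) (reg s rD)"
    and z: "asymmetric (E - D) (reg s rA) (reg s rB) (reg s rC) (reg s rD) (reg s rZ)" and X: "1 \<le> X"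
  shows "run W X mirror s (\<lambda>s'. ready D st L s' \<and> skew (E - D) s')"
proof (rule run_loop_free)
  note v = obstruction_ends[OF o]
  have st: "static (reg s) (arr s)" "live (arr s) (E - D)" using r by (simp_all add: ready_def)
  have zn: "reg s rZ < n" using z by (simp add: asymmetric_def)
  let ?b = "Not (And (Not (Less (adj_exp (Reg rZ) (Reg rA)) (adj_exp (Reg rZ) (Reg rD))))
      (Not (And (Eq (adj_exp (Reg rZ) (Reg rA)) (adj_exp (Reg rZ) (Reg rD)))
        (Less (adj_exp (Reg rZ) (Reg rB)) (adj_exp (Reg rZ) (Reg rC))))))"
  show "fits W mirror s"
    using v zn st by (simp add: mirror_def afits_adj[where F = "E - D"])
  have b: "bval ?b s \<longleftrightarrow> {reg s rZ, reg s rA} \<notin> E - D \<and> {reg s rZ, reg s rD} \<in> E - D \<or>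
      ({reg s rZ, reg s rA} \<in> E - D \<longleftrightarrow> {reg s rZ, reg s rD} \<in> E - D) \<and>
      {reg s rZ, reg s rB} \<notin> E - D \<and> {reg s rZ, reg s rC} \<in> E - D"
    using v zn st by (simp add: aval_adj[where F = "E - D"] del: Diff_iff split: split_of_bool)
  show "ready D st L (result mirror s) \<and> skew (E - D) (result mirror s)"
  proof (cases "bval ?b s")
    case True
    then have "result mirror s = s\<lparr>reg := (reg s)(rT := reg s rB, rA := reg s rD, rD := reg s rA,
        rB := reg s rC, rC := reg s rB)\<rparr>"
      unfolding mirror_def by (simp add: fun_upd_twist)
    then show ?thesis using True[unfolded b] r z obstruction_reverse[OF o]
      by (simp add: skew_def asymmetric_def ready_def) blast
  next
    case False
    then have "result mirror s = s" unfolding mirror_def by simp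
    then show ?thesis using False[unfolded b] r z o
      by (simp add: skew_def asymmetric_def) blast
  qed
qed (use X in \<open>simp_all add: mirror_def\<close>)

end

section \<open>The search tree\<close>

definition node :: com where
  "node = Seq reset (Seq (for_loop rI rN clear_vertex) (Seq (for_loop rI rHalf count_half)
     (Seq (for_loop rI rHalf parent_half) (Seq (Set_Reg rFlag (Const 0))
       (Seq (for_loop rI rHalf search_half)
         (If (Eq (Reg rFlag) (Const 0)) (Set_Reg rFound (Const 1)) branch))))))"

definition pop :: com where
  "pop = block
    [Set_Reg rTop (Sub (Reg rTop) (Const 1)), Set_Reg rU (Arr aLev (Reg rTop)),
     Set_Reg rV (Arr aCnt (Reg rTop)), Set_Reg rLen (Add (Reg rU) (Reg rV)),
     If (Less (Const 0) (Reg rV)) (Set_Arr aTrail (Reg rU) (Arr aStack (Reg rTop))) Skip,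
     If (Less (Const 1) (Reg rV))
       (Set_Arr aTrail (Add (Reg rU) (Const 1)) (Arr (aStack + 1) (Reg rTop))) Skip,
     If (Less (Const 2) (Reg rV))
       (Set_Arr aTrail (Add (Reg rU) (Const 2)) (Arr (aStack + 2) (Reg rTop))) Skip]"

text \<open>The budget is tested when an entry is popped, so the branches of a node can be pushed
  without looking at \<open>k\<close>.\<close>

definition step :: com where
  "step = Seq pop (If (Less (Reg rK) (Reg rLen)) Skip node)"

definition unfinished :: bexp where
  "unfinished = And (Less (Const 0) (Reg rTop)) (Eq (Reg rFound) (Const 0))"

definition tp_program :: com where
  "tp_program = Seq init (While unfinished step)"

context tp_instance
begin

text \<open>If \<open>z\<close> misses \<open>b\<close> and sees \<open>c\<close>, skewness forces
  \<open>za\<close>, and \<open>a, b, c, z\<close> is a \<open>C4\<close>. If \<open>z\<close> sees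
  \<open>d\<close>, skewness forces \<open>za\<close>, \<open>zb\<close> and the non-edge
  \<open>zc\<close>, and \<open>z, b, c, d\<close> is a \<open>C4\<close>. Otherwise
  \<open>zd\<close> is a non-edge and the adjacency to \<open>b\<close> and \<open>c\<close> selects
  the pendant, fork or kite rule; missing both or seeing both forces \<open>za\<close> once
  more.\<close>

lemma run_emit_asymmetric:
  assumes r: "ready D st L s" and z: "skew (E - D) s" and X: "1 \<le> X"
  shows "run W X emit_asymmetric s (branched D st L)"
proof -
  let ?a = "reg s rA" and ?b = "reg s rB" and ?c = "reg s rC" and ?d = "reg s rD" and ?z = "reg s rZ"
  have o: "obstruction (E - D) ?a ?b ?c ?d" and zn: "?z < n" and zd: "?z \<notin> {?a, ?b, ?c, ?d}"
    and zz: "{?z, ?a} \<in> E - D \<and> {?z, ?d} \<notin> E - D \<or>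
      ({?z, ?a} \<in> E - D \<longleftrightarrow> {?z, ?d} \<in> E - D) \<and> {?z, ?b} \<in> E - D \<and> {?z, ?c} \<notin> E - D"
    using z by (auto simp: skew_def)
  note v = obstruction_ends[OF o]
  have st: "static (reg s) (arr s)" "live (arr s) (E - D)" using r by (simp_all add: ready_def)
  note adj = aval_adj[OF st(2) Diff_subset st(1)] afits_adj[OF st(2) Diff_subset st(1)]
  have e: "{?a, ?b} \<in> E - D" "{?b, ?c} \<in> E - D" "{?c, ?d} \<in> E - D"
    and d: "?a \<noteq> ?b" "?a \<noteq> ?c" "?a \<noteq> ?d" "?b \<noteq> ?c" "?b \<noteq> ?d" "?c \<noteq> ?d"
    using o by (simp_all add: obstruction_def)
  have zd': "?z \<noteq> ?a" "?z \<noteq> ?b" "?z \<noteq> ?c" "?z \<noteq> ?d" using zd by simp_all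
  show ?thesis
    unfolding emit_asymmetric_def
  proof (intro run_If X)
    assume "bval (And (Eq (adj_exp (Reg rZ) (Reg rB)) (Const 0)) (Eq (adj_exp (Reg rZ) (Reg rC)) (Const 1))) s"
    then have c: "{?z, ?b} \<notin> E - D" "{?z, ?c} \<in> E - D"
      using adj v zn by (simp_all del: Diff_iff)
    have "obstruction (E - D) ?a ?b ?c ?z" "{?a, ?z} \<in> E - D"
      using o zd' zd'[symmetric] zz c by (simp_all add: obstruction_def insert_commute del: Diff_iff)
    then have "run W X emit_C4 (s\<lparr>reg := (reg s)(rD := ?z)\<rparr>) (branched D st L)"
      using r X by (intro run_emit_C4) simp_all
    then show "run W X (Seq (Set_Reg rD (Reg rZ)) emit_C4) s (branched D st L)"
      using X zn by (intro run_Seq_loop_free) simp_all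
  next
    assume "\<not> bval (And (Eq (adj_exp (Reg rZ) (Reg rB)) (Const 0)) (Eq (adj_exp (Reg rZ) (Reg rC)) (Const 1))) s"
      and "bval (Eq (adj_exp (Reg rZ) (Reg rD)) (Const 1)) s"
    then have c: "{?z, ?d} \<in> E - D" using adj v zn by (simp_all del: Diff_iff)
    have "obstruction (E - D) ?z ?b ?c ?d" "{?z, ?d} \<in> E - D"
      using o zd' zd'[symmetric] zz c by (simp_all add: obstruction_def insert_commute del: Diff_iff)
    then have "run W X emit_C4 (s\<lparr>reg := (reg s)(rA := ?z)\<rparr>) (branched D st L)"
      using r X by (intro run_emit_C4) simp_all
    then show "run W X (Seq (Set_Reg rA (Reg rZ)) emit_C4) s (branched D st L)"
      using X zn by (intro run_Seq_loop_free) simp_all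
  next
    assume "\<not> bval (And (Eq (adj_exp (Reg rZ) (Reg rB)) (Const 0)) (Eq (adj_exp (Reg rZ) (Reg rC)) (Const 1))) s"
      and "\<not> bval (Eq (adj_exp (Reg rZ) (Reg rD)) (Const 1)) s"
      and "bval (Eq (adj_exp (Reg rZ) (Reg rB)) (Const 0)) s"
    then have c: "{?z, ?a} \<in> E - D" "{?z, ?b} \<notin> E - D"
      using adj v zn zz by (simp_all del: Diff_iff)
    let ?ess = "[[{?a, ?b}], [{?b, ?c}], [{?c, ?d}, {?z, ?a}]]"
    show "run W X (emit_third [[rAB], [rBC], [rCD, rZA]]) s (branched D st L)"
    proof (rule run_emit_third[OF r o zn X])
      fix s' assume s': "ready D st L s'"
        "reg s' rAB = eid {?a, ?b}" "reg s' rBC = eid {?b, ?c}" "reg s' rCD = eid {?c, ?d}"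
        "{?z, ?a} \<in> E \<Longrightarrow> reg s' rZA = eid {?z, ?a}"
      show "run W X (pushes [[rAB], [rBC], [rCD, rZA]]) s' (branched D st L)"
      proof (rule run_pushes[OF s'(1), where ess = ?ess])
        show "\<forall>es' \<in> set ?ess. es' \<noteq> [] \<and> length es' \<le> 3 \<and> distinct es' \<and> set es' \<subseteq> E - D"
          using e c zd by (auto simp: doubleton_eq_iff)
        assume "extendable ({..<n}, E) k D"
        from branch_pendant[OF G this o zd c]
        show "\<exists>X \<in> set (map set ?ess). extendable ({..<n}, E) k (D \<union> X)" by simp
      qed (use s' c X in \<open>simp_all add: power2_eq_square\<close>)
    qed
  next
    assume "\<not> bval (And (Eq (adj_exp (Reg rZ) (Reg rB)) (Const 0)) (Eq (adj_exp (Reg rZ) (Reg rC)) (Const 1))) s"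
      and "\<not> bval (Eq (adj_exp (Reg rZ) (Reg rD)) (Const 1)) s"
      and "\<not> bval (Eq (adj_exp (Reg rZ) (Reg rB)) (Const 0)) s"
      and "bval (Eq (adj_exp (Reg rZ) (Reg rC)) (Const 0)) s"
    then have c: "{?z, ?b} \<in> E - D" "{?z, ?c} \<notin> E - D"
      using adj v zn by (simp_all del: Diff_iff)
    let ?ess = "[[{?b, ?c}], [{?c, ?d}], [{?a, ?b}, {?z, ?b}]]"
    show "run W X (emit_third [[rBC], [rCD], [rAB, rZB]]) s (branched D st L)"
    proof (rule run_emit_third[OF r o zn X])
      fix s' assume s': "ready D st L s'"
        "reg s' rAB = eid {?a, ?b}" "reg s' rBC = eid {?b, ?c}" "reg s' rCD = eid {?c, ?d}"
        "{?z, ?b} \<in> E \<Longrightarrow> reg s' rZB = eid {?z, ?b}"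
      show "run W X (pushes [[rBC], [rCD], [rAB, rZB]]) s' (branched D st L)"
      proof (rule run_pushes[OF s'(1), where ess = ?ess])
        show "\<forall>es' \<in> set ?ess. es' \<noteq> [] \<and> length es' \<le> 3 \<and> distinct es' \<and> set es' \<subseteq> E - D"
          using e c zd by (auto simp: doubleton_eq_iff)
        assume "extendable ({..<n}, E) k D"
        from branch_fork[OF G this o zd c]
        show "\<exists>X \<in> set (map set ?ess). extendable ({..<n}, E) k (D \<union> X)" by simp
      qed (use s' c X in \<open>simp_all add: power2_eq_square\<close>)
    qed
  next
    assume "\<not> bval (And (Eq (adj_exp (Reg rZ) (Reg rB)) (Const 0)) (Eq (adj_exp (Reg rZ) (Reg rC)) (Const 1))) s"
      and "\<not> bval (Eq (adj_exp (Reg rZ) (Reg rD)) (Const 1)) s"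
      and "\<not> bval (Eq (adj_exp (Reg rZ) (Reg rB)) (Const 0)) s"
      and "\<not> bval (Eq (adj_exp (Reg rZ) (Reg rC)) (Const 0)) s"
    then have c: "{?z, ?a} \<in> E - D" "{?z, ?b} \<in> E - D" "{?z, ?c} \<in> E - D" "{?z, ?d} \<notin> E - D"
      using adj v zn zz by (simp_all del: Diff_iff)
    let ?ess = "[[{?c, ?d}], [{?a, ?b}, {?z, ?a}], [{?b, ?c}, {?z, ?c}],
      [{?a, ?b}, {?z, ?c}, {?z, ?b}], [{?b, ?c}, {?z, ?a}, {?z, ?b}]]"
    show "run W X (emit_third [[rCD], [rAB, rZA], [rBC, rZC], [rAB, rZC, rZB], [rBC, rZA, rZB]]) s (branched D st L)"
    proof (rule run_emit_third[OF r o zn X])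
      fix s' assume s': "ready D st L s'"
        "reg s' rAB = eid {?a, ?b}" "reg s' rBC = eid {?b, ?c}" "reg s' rCD = eid {?c, ?d}"
        "{?z, ?a} \<in> E \<Longrightarrow> reg s' rZA = eid {?z, ?a}" "{?z, ?b} \<in> E \<Longrightarrow> reg s' rZB = eid {?z, ?b}"
        "{?z, ?c} \<in> E \<Longrightarrow> reg s' rZC = eid {?z, ?c}"
      show "run W X (pushes [[rCD], [rAB, rZA], [rBC, rZC], [rAB, rZC, rZB], [rBC, rZA, rZB]]) s' (branched D st L)"
      proof (rule run_pushes[OF s'(1), where ess = ?ess])
        show "\<forall>es' \<in> set ?ess. es' \<noteq> [] \<and> length es' \<le> 3 \<and> distinct es' \<and> set es' \<subseteq> E - D"
          using e c zd d by (auto simp: doubleton_eq_iff)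
        assume "extendable ({..<n}, E) k D"
        from branch_kite[OF G this o zd c]
        show "\<exists>X \<in> set (map set ?ess). extendable ({..<n}, E) k (D \<union> X)" by simp
      qed (use s' c X in \<open>simp_all add: power2_eq_square power3_eq_cube\<close>)
    qed
  qed (use adj v zn zz in \<open>simp_all del: Diff_iff\<close>)
qed

lemma run_branch:
  assumes r: "ready D st L s" and D: "D \<subseteq> E"
    and v: "{reg s rC, reg s rB} \<in> E - D" "before (E - D) (reg s rB) (reg s rC)"
      "{reg s rC, reg s rD} \<in> E - D" "reg s rD \<noteq> reg s rB" "{reg s rD, reg s rB} \<notin> E - D"
    and X: "n + 2 * m + 2 \<le> X"
  shows "run W X branch s (branched D st L)"
  unfolding branch_def
proof (rule run_Seq[OF search_end[where F = "E - D"]])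
  show "static (reg s) (arr s)" "live (arr s) (E - D)" using r by (simp_all add: ready_def)
  fix s1 assume o: "obstruction (E - D) (reg s1 rA) (reg s1 rB) (reg s1 rC) (reg s1 rD)"
    and f: "frame (for_loop rI rN search_end) s s1"
  have r1: "ready D st L s1" using ready_frame[OF r f] by (simp add: search_end_def)
  then have st: "static (reg s1) (arr s1)" "live (arr s1) (E - D)" by (simp_all add: ready_def)
  note ends = obstruction_ends[OF o]
  have X1: "1 \<le> X" using X by simp
  show "run W X (If (Eq (adj_exp (Reg rA) (Reg rD)) (Const 1)) emit_C4
      (Seq (Set_Reg rFlag (Const 0)) (Seq (for_loop rI rN search_asymmetric)
        (If (Eq (Reg rFlag) (Const 0)) emit_symmetric (Seq mirror emit_asymmetric))))) s1 (branched D st L)"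
  proof (rule run_If)
    show "bfits W (Eq (adj_exp (Reg rA) (Reg rD)) (Const 1)) s1"
      using ends st by (simp add: afits_adj[where F = "E - D"])
    assume "bval (Eq (adj_exp (Reg rA) (Reg rD)) (Const 1)) s1"
    then have "{reg s1 rA, reg s1 rD} \<in> E - D" using ends st by (simp add: aval_adj[where F = "E - D"])
    then show "run W X emit_C4 s1 (branched D st L)" by (rule run_emit_C4[OF r1 o _ X1])
  next
    let ?s2 = "s1\<lparr>reg := (reg s1)(rFlag := 0)\<rparr>"
    have r2: "ready D st L ?s2" using r1 by simp
    have rest: "run W X (Seq (for_loop rI rN search_asymmetric)
        (If (Eq (Reg rFlag) (Const 0)) emit_symmetric (Seq mirror emit_asymmetric))) ?s2 (branched D st L)"
    proof (rule run_Seq[OF search_asymmetric[where F = "E - D"]])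
      show "static (reg ?s2) (arr ?s2)" "live (arr ?s2) (E - D)" using r2 by (simp_all add: ready_def)
      fix s3 assume a: "reg s3 rFlag = 0 \<and>
          (\<forall>z. \<not> asymmetric (E - D) (reg ?s2 rA) (reg ?s2 rB) (reg ?s2 rC) (reg ?s2 rD) z) \<or>
        reg s3 rFlag = 1 \<and> asymmetric (E - D) (reg ?s2 rA) (reg ?s2 rB) (reg ?s2 rC) (reg ?s2 rD) (reg s3 rZ)"
        and f3: "frame (for_loop rI rN search_asymmetric) ?s2 s3"
      have r3: "ready D st L s3" using ready_frame[OF r2 f3] by (simp add: search_asymmetric_def)
      have same: "reg s3 rA = reg s1 rA" "reg s3 rB = reg s1 rB" "reg s3 rC = reg s1 rC" "reg s3 rD = reg s1 rD"
        using frame_reg[OF f3] by (simp_all add: search_asymmetric_def)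
      have o3: "obstruction (E - D) (reg s3 rA) (reg s3 rB) (reg s3 rC) (reg s3 rD)" using o same by simp
      show "run W X (If (Eq (Reg rFlag) (Const 0)) emit_symmetric (Seq mirror emit_asymmetric)) s3 (branched D st L)"
      proof (rule run_If)
        assume "bval (Eq (Reg rFlag) (Const 0)) s3"
        then show "run W X emit_symmetric s3 (branched D st L)"
          using a same by (intro run_emit_symmetric[OF r3 o3 _ D X1]) simp
      next
        assume "\<not> bval (Eq (Reg rFlag) (Const 0)) s3"
        then have "asymmetric (E - D) (reg s3 rA) (reg s3 rB) (reg s3 rC) (reg s3 rD) (reg s3 rZ)"
          using a same by simp
        from run_mirror[OF r3 o3 this X1]
        show "run W X (Seq mirror emit_asymmetric) s3 (branched D st L)"
          by (rule run_Seq) (use run_emit_asymmetric X1 in blast)+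
      qed (use a X1 in auto)
    qed (use ends X in simp_all)
    show "run W X (Seq (Set_Reg rFlag (Const 0)) (Seq (for_loop rI rN search_asymmetric)
        (If (Eq (Reg rFlag) (Const 0)) emit_symmetric (Seq mirror emit_asymmetric)))) s1 (branched D st L)"
      by (rule run_Seq_loop_free) (use X1 rest in simp_all)
  qed (rule X1)
qed (use v X in simp_all)

lemma ids_edges_subset: "set ids \<subseteq> {1..m} \<Longrightarrow> ids_edges ids \<subseteq> E"
  using edge_mem by (fastforce simp: ids_edges_def)

lemma run_node:
  assumes st: "static (reg s) (arr s)" and stk: "stack (arr s) (reg s rTop) = st" "length st \<le> 6 * (k + 4)"
    and L: "reg s rLen = L" "L \<le> k" "L \<le> m" and T: "\<forall>i < L. arr s aTrail i \<in> {1..m}"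
    and D: "D = ids_edges (map (arr s aTrail) [0..<L])"
    and found: "reg s rFound = 0" and X: "n + 2 * m + 2 \<le> X"
  shows "run W X node s (\<lambda>s'.
    reg s' rFound = 1 \<and> (\<forall>a b c d. \<not> obstruction (E - D) a b c d) \<and>
      (\<forall>i < L. {arr s' aOutU i, arr s' aOutV i} = edge (arr s aTrail i - 1)) \<and>
      stack (arr s') (reg s' rTop) = st \<and> reg s' rLen = L \<or>
    reg s' rFound = 0 \<and> branched D st L s')"
  (is "run W X node s ?Q")
  unfolding node_def
proof (rule run_Seq[OF reset[OF st L(1,3) T X]], elim conjE)
  have X1: "1 \<le> X" using X by simp
  \<comment> \<open>\<open>reset\<close> writes the output before it is known whether the node is
    solved, so this fact is carried through the scans up to the verdict.\<close>
  let ?out = "\<lambda>s'. (\<forall>i < L. {arr s' aOutU i, arr s' aOutV i} = edge (arr s aTrail i - 1)) \<and> reg s' rFound = 0"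
  have DE: "D \<subseteq> E" unfolding D using T by (intro ids_edges_subset) auto
  fix s1 assume l1: "live (arr s1) (E - ids_edges (map (arr s aTrail) [0..<L]))"
    and o1: "\<forall>i < L. {arr s1 aOutU i, arr s1 aOutV i} = edge (arr s aTrail i - 1)"
    and f1: "frame reset s s1"
  have st1: "static (reg s1) (arr s1)" using static_frame[OF st f1] by (simp add: reset_def kill_edge_def)
  have "stack (arr s1) (reg s1 rTop) = st"
    unfolding stk(1)[symmetric] stack_def using frame_reg[OF f1, of rTop] frame_arr[OF f1]
    by (simp add: reset_def kill_edge_def)
  moreover have "reg s1 rLen = L" using frame_reg[OF f1, of rLen] L by (simp add: reset_def kill_edge_def)
  ultimately have r1: "ready D st L s1" using l1 st1 stk L by (simp add: ready_def D)
  have out1: "?out s1" using o1 frame_reg[OF f1, of rFound] found by (simp add: reset_def kill_edge_def)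
  show "run W X (Seq (for_loop rI rN clear_vertex) (Seq (for_loop rI rHalf count_half)
     (Seq (for_loop rI rHalf parent_half) (Seq (Set_Reg rFlag (Const 0))
       (Seq (for_loop rI rHalf search_half)
         (If (Eq (Reg rFlag) (Const 0)) (Set_Reg rFound (Const 1)) branch)))))) s1 ?Q"
  proof (rule run_Seq[OF clear_vertices[OF st1 X] _ X1])
    fix s2 assume c2: "\<forall>v < n. arr s2 aDeg v = 0 \<and> arr s2 aPar v = 0"
      and f2: "frame (for_loop rI rN clear_vertex) s1 s2"
    have r2: "ready D st L s2" using ready_frame[OF r1 f2] by (simp add: clear_vertex_def)
    have out2: "?out s2" using out1 frame_arr[OF f2] frame_reg[OF f2] by (simp add: clear_vertex_def)
    have st2: "static (reg s2) (arr s2)" "live (arr s2) (E - D)" using r2 by (simp_all add: ready_def)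
    have z2: "\<forall>v < n. arr s2 aDeg v = 0" using c2 by simp
    show "run W X (Seq (for_loop rI rHalf count_half)
     (Seq (for_loop rI rHalf parent_half) (Seq (Set_Reg rFlag (Const 0))
       (Seq (for_loop rI rHalf search_half)
         (If (Eq (Reg rFlag) (Const 0)) (Set_Reg rFound (Const 1)) branch))))) s2 ?Q"
    proof (rule run_Seq[OF count_degrees[OF st2 Diff_subset z2 X] _ X1])
      fix s3 assume d3: "degs (arr s3) (E - D)" and f3: "frame (for_loop rI rHalf count_half) s2 s3"
      have r3: "ready D st L s3" using ready_frame[OF r2 f3] by (simp add: count_half_def)
      have out3: "?out s3" using out2 frame_arr[OF f3] frame_reg[OF f3] by (simp add: count_half_def)
      have st3: "static (reg s3) (arr s3)" "live (arr s3) (E - D)" using r3 by (simp_all add: ready_def)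
      have z3: "\<forall>v < n. arr s3 aPar v = 0" using c2 frame_arr[OF f3, of aPar] by (simp add: count_half_def)
      show "run W X (Seq (for_loop rI rHalf parent_half) (Seq (Set_Reg rFlag (Const 0))
       (Seq (for_loop rI rHalf search_half)
         (If (Eq (Reg rFlag) (Const 0)) (Set_Reg rFound (Const 1)) branch)))) s3 ?Q"
      proof (rule run_Seq[OF find_parents[OF st3 Diff_subset d3 z3 X] _ X1])
        fix s4 assume p4: "\<forall>v < n. latest (E - D) {w. {v, w} \<in> E - D \<and> before (E - D) w v} (arr s4 aPar v)"
          and f4: "frame (for_loop rI rHalf parent_half) s3 s4"
        have r4: "ready D st L s4" using ready_frame[OF r3 f4] by (simp add: parent_half_def)
        have out4: "?out s4" using out3 frame_arr[OF f4] frame_reg[OF f4] by (simp add: parent_half_def)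
        let ?s5 = "s4\<lparr>reg := (reg s4)(rFlag := 0)\<rparr>"
        have r5: "ready D st L ?s5" using r4 by simp
        then have st5: "static (reg ?s5) (arr ?s5)" "live (arr ?s5) (E - D)" by (simp_all add: ready_def)
        have p5: "\<forall>v < n. latest (E - D) {w. {v, w} \<in> E - D \<and> before (E - D) w v} (arr ?s5 aPar v)"
          using p4 by simp
        have rest: "run W X (Seq (for_loop rI rHalf search_half)
         (If (Eq (Reg rFlag) (Const 0)) (Set_Reg rFound (Const 1)) branch)) ?s5 ?Q"
        proof (rule run_Seq[OF search_violation[OF st5 Diff_subset p5 _ X] _ X1])
          fix s6 assume v6: "reg s6 rFlag = 0 \<and> (\<forall>a b c d. \<not> obstruction (E - D) a b c d) \<or>
              reg s6 rFlag = 1 \<and> {reg s6 rC, reg s6 rB} \<in> E - D \<and> before (E - D) (reg s6 rB) (reg s6 rC) \<and>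
              {reg s6 rC, reg s6 rD} \<in> E - D \<and> reg s6 rD \<noteq> reg s6 rB \<and> {reg s6 rD, reg s6 rB} \<notin> E - D"
            and f6: "frame (for_loop rI rHalf search_half) ?s5 s6"
          have r6: "ready D st L s6" using ready_frame[OF r5 f6] by (simp add: search_half_def)
          have out6: "?out s6" using out4 frame_arr[OF f6] frame_reg[OF f6] by (simp add: search_half_def)
          show "run W X (If (Eq (Reg rFlag) (Const 0)) (Set_Reg rFound (Const 1)) branch) s6 ?Q"
          proof (rule run_If)
            assume "bval (Eq (Reg rFlag) (Const 0)) s6"
            then show "run W X (Set_Reg rFound (Const 1)) s6 ?Q"
              using v6 out6 r6 X1 by (intro run_loop_free) (auto simp: ready_def)
          next
            assume "\<not> bval (Eq (Reg rFlag) (Const 0)) s6"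
            then have "run W X branch s6 (branched D st L)"
              using v6 by (intro run_branch[OF r6 DE _ _ _ _ _ X]) auto
            then show "run W X branch s6 ?Q"
            proof (rule run_frame)
              fix s' assume b: "branched D st L s'" and f': "frame branch s6 s'"
              have "rFound \<notin> written_regs branch"
                by (simp add: branch_def search_end_def search_asymmetric_def emit_C4_def emit_symmetric_def
                    emit_third_def emit_asymmetric_def mirror_def path_ids_def third_ids_def push_def)
              then have "reg s' rFound = 0" using frame_reg[OF f', of rFound] out6 by simp
              with b show "?Q s'" by blast
            qed
          qed (use v6 X1 in auto)
        qed simp
        show "run W X (Seq (Set_Reg rFlag (Const 0)) (Seq (for_loop rI rHalf search_half)
         (If (Eq (Reg rFlag) (Const 0)) (Set_Reg rFound (Const 1)) branch))) s4 ?Q"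
          by (rule run_Seq_loop_free) (use X1 rest in simp_all)
      qed
    qed
  qed
qed (use X in simp)

lemma node_frame: "frame node s s' \<Longrightarrow> static (reg s) (arr s) \<Longrightarrow> static (reg s') (arr s')"
  "frame node s s' \<Longrightarrow> arr s' aTrail = arr s aTrail"
proof -
  have "written_regs node \<inter> {rN, rM, rK, rHalf} = {} \<and> written_arrs node \<inter> {aU, aV, aMul, aId, aHU, aHV, aTrail} = {}"
    by (simp add: node_def reset_def kill_edge_def clear_vertex_def count_half_def parent_half_def search_half_def
        branch_def search_end_def search_asymmetric_def emit_C4_def emit_symmetric_def
        emit_third_def emit_asymmetric_def mirror_def path_ids_def third_ids_def push_def)
  then show "frame node s s' \<Longrightarrow> static (reg s) (arr s) \<Longrightarrow> static (reg s') (arr s')"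
    "frame node s s' \<Longrightarrow> arr s' aTrail = arr s aTrail"
    using static_frame[of s node s'] frame_arr[of node s s' aTrail] by blast+
qed

end

section \<open>Stack invariant, potential and running time\<close>

definition path :: "(nat \<Rightarrow> nat) \<Rightarrow> nat \<times> nat list \<Rightarrow> nat list" where
  "path T x = map T [0..<fst x] @ snd x"

lemma length_path [simp]: "length (path T x) = fst x + length (snd x)"
  by (simp add: path_def)

lemma path_cong: "(\<And>i. i < fst x \<Longrightarrow> T' i = T i) \<Longrightarrow> path T' x = path T x"
  by (simp add: path_def)

definition tp_cost :: real where
  "tp_cost = real (1 + linear_cost init + linear_cost (While unfinished step))"

context tp_instance
begin

text \<open>The bound on the position \<open>j\<close> limits the stack height: a popped entry is
  replaced by at most six others, and their paths are longer by at least one edge. As paths have at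
  most \<open>k + 3\<close> edges, the stack pointer stays linear in \<open>k\<close>.\<close>

definition entry :: "(nat \<Rightarrow> nat) \<Rightarrow> nat \<Rightarrow> nat \<times> nat list \<Rightarrow> bool" where
  "entry T j x \<longleftrightarrow> fst x \<le> k \<and> length (snd x) \<le> 3 \<and> j \<le> 6 * length (path T x) \<and>
     distinct (path T x) \<and> set (path T x) \<subseteq> {1..m}"

text \<open>Levels increase along the stack, so working on the top entry only overwrites the part of the
  trail that the entries below do not use.\<close>

definition entries :: "(nat \<Rightarrow> nat) \<Rightarrow> (nat \<times> nat list) list \<Rightarrow> bool" where
  "entries T st \<longleftrightarrow> sorted (map fst st) \<and> (\<forall>j < length st. entry T j (st ! j))"

definition solvable :: "nat set set \<Rightarrow> bool" where
  "solvable D \<longleftrightarrow> extendable ({..<n}, E) k D"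

text \<open>As long as nothing is found, a solvable instance keeps an entry that extends to a
  solution, so an empty stack justifies the answer "No". Once \<open>rFound\<close> is set, the
  output arrays hold a solution and the loop ends.\<close>

definition invariant :: "memory \<Rightarrow> bool" where
  "invariant s \<longleftrightarrow> static (reg s) (arr s) \<and> entries (arr s aTrail) (stack (arr s) (reg s rTop)) \<and>
     (reg s rFound = 0 \<and> (solvable {} \<longrightarrow>
        (\<exists>x \<in> set (stack (arr s) (reg s rTop)). solvable (ids_edges (path (arr s aTrail) x)))) \<or>
      reg s rFound = 1 \<and>
        tp_deletion_set ({..<n}, E) k {{arr s aOutU i, arr s aOutV i} | i. i < reg s rLen})"

text \<open>The factor is \<open>1 / (1 - 0.9997)\<close>, so that expanding an entry decreases the total weight by at
  least 1.\<close>

definition weight :: "nat \<times> nat list \<Rightarrow> real" where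
  "weight x = 10000 / 3 * 2.450 ^ (k + 3 - (fst x + length (snd x)))"

definition potential :: "memory \<Rightarrow> real" where
  "potential s = (\<Sum>x\<leftarrow>stack (arr s) (reg s rTop). weight x)"

lemma weight_ge: "1 \<le> weight x"
proof -
  have "1 \<le> (2.450 :: real) ^ (k + 3 - (fst x + length (snd x)))" by (rule one_le_power) simp
  then show ?thesis unfolding weight_def by linarith
qed

lemma potential_nonneg: "0 \<le> potential s"
  unfolding potential_def using weight_ge by (intro sum_list_nonneg) (auto intro: order_trans[OF zero_le_one])

lemma weight_branching:
  assumes "branching D idss" "L \<le> k" "fst x + length (snd x) = L"
  shows "(\<Sum>y\<leftarrow>map (Pair L) idss. weight y) + 1 \<le> weight x"
proof -
  let ?w = "(2.450 :: real) ^ (k + 3 - L)"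
  have w: "weight (L, ids) = 10000 / 3 * ?w * (1 / 2.450) ^ length ids" if "ids \<in> set idss" for ids
  proof -
    have "length ids \<le> 3" using assms(1) that by (auto simp: branching_def)
    \<comment> \<open>The surplus 3 in the exponent keeps the truncated subtraction exact: an
      expanded node has \<open>L \<le> k\<close>, and a branch adds at most three edges.\<close>
    then have "k + 3 - L = (k + 3 - (L + length ids)) + length ids" using assms(2) by simp
    then have "?w = 2.450 ^ (k + 3 - (L + length ids)) * 2.450 ^ length ids"
      by (metis power_add)
    moreover have "(2.450 :: real) ^ length ids * (1 / 2.450) ^ length ids = 1"
      by (simp flip: power_mult_distrib)
    ultimately show ?thesis by (simp add: weight_def)
  qed
  have "(\<Sum>y\<leftarrow>map (Pair L) idss. weight y) = (\<Sum>ids\<leftarrow>idss. 10000 / 3 * ?w * (1 / 2.450) ^ length ids)"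
    unfolding map_map o_def using w by (intro arg_cong[where f = sum_list] map_cong) auto
  also have "\<dots> = 10000 / 3 * ?w * (\<Sum>ids\<leftarrow>idss. (1 / 2.450) ^ length ids)"
    by (rule sum_list_const_mult)
  also have "\<dots> \<le> 10000 / 3 * ?w * (9997 / 10000)"
    using assms(1) by (intro mult_left_mono) (auto simp: branching_def)
  also have "\<dots> = 10000 / 3 * ?w - ?w" by simp
  finally have "(\<Sum>y\<leftarrow>map (Pair L) idss. weight y) \<le> 10000 / 3 * ?w - ?w" .
  moreover have "1 \<le> ?w" by (rule one_le_power) simp
  moreover have "weight x = 10000 / 3 * ?w" using assms(3) by (simp add: weight_def)
  ultimately show ?thesis by linarith
qed

lemma card_ids_edges:
  assumes "distinct ids" "set ids \<subseteq> {1..m}" shows "card (ids_edges ids) = length ids"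
proof -
  have "inj_on (\<lambda>i. edge (i - 1)) {1..m}"
  proof (rule inj_onI)
    fix i j assume ij: "i \<in> {1..m}" "j \<in> {1..m}" "edge (i - 1) = edge (j - 1)"
    then have "i - 1 < m" "j - 1 < m" by auto
    then have "i - 1 = j - 1" using edge_eq_iff ij(3) by blast
    then show "i = j" using ij by auto
  qed
  then have "card (ids_edges ids) = card (set ids)"
    unfolding ids_edges_def using assms(2) by (intro card_image) (rule inj_on_subset)
  then show ?thesis using assms(1) by (simp add: distinct_card)
qed

text \<open>Justifies discarding entries over the budget: distinct identifiers are distinct edges,
  and a solution containing them has at most \<open>k\<close>.\<close>

lemma solvable_length:
  assumes "distinct ids" "set ids \<subseteq> {1..m}" "solvable (ids_edges ids)"
  shows "length ids \<le> k"
proof -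
  from assms(3) obtain S where S: "S \<subseteq> E" "card S \<le> k" "ids_edges ids \<subseteq> S"
    by (auto simp: solvable_def extendable_def tp_deletion_set_def)
  then have "card (ids_edges ids) \<le> card S" using finite_E finite_subset card_mono by metis
  then show ?thesis using S card_ids_edges[OF assms(1,2)] by simp
qed

lemma length_le_m:
  assumes "distinct ids" "set ids \<subseteq> {1..m}" shows "length ids \<le> m"
  using distinct_card[OF assms(1)] card_mono[OF _ assms(2)] by simp

lemma entries_butlast:
  assumes "entries T (st @ [x])" "\<And>i. i < fst x \<Longrightarrow> T' i = T i"
  shows "entries T' st" "y \<in> set st \<Longrightarrow> path T' y = path T y" "y \<in> set st \<Longrightarrow> fst y \<le> fst x"
proof -
  have le: "fst y \<le> fst x" if "y \<in> set st" for y
    using assms(1) that by (auto simp: entries_def sorted_append)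
  then show "y \<in> set st \<Longrightarrow> fst y \<le> fst x" .
  have p: "path T' y = path T y" if "y \<in> set st" for y
    using le[OF that] assms(2) by (intro path_cong) simp
  then show "y \<in> set st \<Longrightarrow> path T' y = path T y" .
  have "entry T' j (st ! j)" if "j < length st" for j
  proof -
    have "entry T j ((st @ [x]) ! j)" using assms(1) that by (simp add: entries_def)
    then show ?thesis using p[of "st ! j"] that by (simp add: entry_def nth_append)
  qed
  then show "entries T' st" using assms(1) by (simp add: entries_def sorted_append)
qed

lemma entries_append:
  assumes st: "entries T st" "\<And>y. y \<in> set st \<Longrightarrow> fst y \<le> L" "length st \<le> 6 * L" and L: "L \<le> k"
    and T: "distinct (map T [0..<L])" "set (map T [0..<L]) \<subseteq> {1..m}"
    and b: "branching (ids_edges (map T [0..<L])) idss"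
  shows "entries T (st @ map (Pair L) idss)"
proof -
  have "entry T j ((st @ map (Pair L) idss) ! j)" if j: "j < length (st @ map (Pair L) idss)" for j
  proof (cases "j < length st")
    case True
    then show ?thesis using st(1) by (simp add: entries_def nth_append)
  next
    case False
    define ids where "ids = idss ! (j - length st)"
    have "ids \<in> set idss" using False j unfolding ids_def by (intro nth_mem) simp
    then have ids: "ids \<noteq> []" "length ids \<le> 3" "distinct ids" "set ids \<subseteq> {1..m}"
        "ids_edges ids \<inter> ids_edges (map T [0..<L]) = {}" and "length idss \<le> 6"
      using b by (auto simp: branching_def)
    obtain q where q: "length ids = Suc q" using ids(1) by (cases ids) auto
    have "j < length st + 6" using j \<open>length idss \<le> 6\<close> by simp
    then have "j \<le> 6 * (L + length ids)" unfolding q using st(3) by simp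
    moreover have "set (map T [0..<L]) \<inter> set ids = {}"
      using ids(5) unfolding ids_edges_def by blast
    moreover have "(st @ map (Pair L) idss) ! j = (L, ids)" using False j by (simp add: nth_append ids_def)
    ultimately show ?thesis
      using L T ids by (simp add: entry_def path_def)
  qed
  moreover have "sorted (map fst (map (Pair L) idss))" by (simp add: o_def sorted_iff_nth_mono)
  ultimately show ?thesis
    using st by (auto simp: entries_def sorted_append)
qed

lemma run_pop:
  assumes st: "static (reg s) (arr s)" and stk: "stack (arr s) (reg s rTop) = st @ [x]"
    and x: "entry (arr s aTrail) (length st) x" and X: "1 \<le> X"
  shows "run W X pop s (\<lambda>s'. stack (arr s') (reg s' rTop) = st \<and> reg s' rLen = length (path (arr s aTrail) x) \<and>
    map (arr s' aTrail) [0..<reg s' rLen] = path (arr s aTrail) x \<and>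
    (\<forall>i < fst x. arr s' aTrail i = arr s aTrail i))"
proof -
  define t l c where d: "t = length st" "l = arr s aLev t" "c = arr s aCnt t"
  have top: "reg s rTop = Suc t" using arg_cong[OF stk, of length] d by simp
  then have stk': "stack (arr s) (Suc t) = st @ [x]" using stk by simp
  then have sx: "stack (arr s) t = st" "x = (l, map (\<lambda>i. arr s (aStack + i) t) [0..<c])"
    by (auto simp: stack_def d)
  have c: "l \<le> k" "c \<le> 3" "t \<le> 6 * (l + c)" using x sx(2) by (simp_all add: entry_def d(1))
  have sv: "arr s (aStack + i) t \<le> m" if "i < c" for i
  proof -
    have "arr s (aStack + i) t \<in> set (snd x)" using that sx(2) by simp
    then show ?thesis using x by (auto simp: entry_def path_def)
  qed
  have fit: "t < W" "Suc t < W" "l < W" "c < W" "l + c < W" "Suc l < W" "Suc (Suc l) < W"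
    using c by (auto intro!: fits_linear)
  have "c = 0 \<or> c = 1 \<or> c = 2 \<or> c = 3" using c by linarith
  then have "fits W pop s \<and> reg (result pop s) rTop = t \<and> reg (result pop s) rLen = l + c \<and>
      (\<forall>i < l + c. arr (result pop s) aTrail i = (if i < l then arr s aTrail i else arr s (aStack + (i - l)) t))"
    using fit top d(2,3) sv[of 0] sv[of 1] sv[of 2] fits_linear[of "arr s 14 t"] fits_linear[of "arr s 15 t"]
      fits_linear[of "arr s 16 t"]
    by (elim disjE) (auto simp: pop_def less_Suc_eq numeral_eq_Suc)
  moreover have "stack (arr (result pop s)) t = st"
    unfolding sx(1)[symmetric] by (simp add: pop_def stack_def)
  moreover have "map (arr (result pop s) aTrail) [0..<l + c] = path (arr s aTrail) x"
    if "\<forall>i < l + c. arr (result pop s) aTrail i = (if i < l then arr s aTrail i else arr s (aStack + (i - l)) t)"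
    using that by (intro nth_equalityI) (auto simp: path_def sx(2) nth_append)
  moreover have "loop_free pop" by (simp add: pop_def)
  ultimately show ?thesis
    using X sx(2) by (intro run_loop_free) auto
qed

text \<open>An entry over the budget takes a weight of at least 1 with it and loses no solution; a
  node without obstruction becomes the answer; any other node is replaced by branches whose total
  weight is smaller by at least 1, one of which inherits solvability.\<close>

lemma run_step:
  assumes inv: "invariant s" and go: "bval unfinished s" and X: "n + 2 * m + 2 \<le> X"
  shows "run W X step s (\<lambda>s'. invariant s' \<and> potential s' + 1 \<le> potential s)"
proof -
  let ?T = "arr s aTrail"
  have X1: "1 \<le> X" using X by simp
  have st: "static (reg s) (arr s)" and found: "reg s rFound = 0" and "0 < reg s rTop"
    using inv go by (auto simp: invariant_def unfinished_def)
  then obtain st x where stk: "stack (arr s) (reg s rTop) = st @ [x]"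
    by (metis length_greater_0_conv length_stack rev_exhaust)
  have ent: "entries ?T (st @ [x])"
    and sol: "solvable {} \<Longrightarrow> \<exists>y \<in> set (st @ [x]). solvable (ids_edges (path ?T y))"
    using inv found stk by (auto simp: invariant_def)
  have "entry ?T (length st) ((st @ [x]) ! length st)"
    using ent unfolding entries_def by (metis length_append_singleton lessI)
  then have x: "entry ?T (length st) x" by simp
  define L where "L = length (path ?T x)"
  have px: "distinct (path ?T x)" "set (path ?T x) \<subseteq> {1..m}" using x by (simp_all add: entry_def)
  have pot: "potential s = (\<Sum>y\<leftarrow>st. weight y) + weight x"
    by (simp add: potential_def stk)
  show ?thesis
    unfolding step_def
  proof (rule run_Seq[OF run_pop[OF st stk x X1] _ X1], elim conjE)
    fix s1 assume s1: "stack (arr s1) (reg s1 rTop) = st" "reg s1 rLen = length (path ?T x)"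
      "map (arr s1 aTrail) [0..<reg s1 rLen] = path ?T x" "\<forall>i < fst x. arr s1 aTrail i = ?T i"
      and f1: "frame pop s s1"
    have st1: "static (reg s1) (arr s1)" using static_frame[OF st f1] by (simp add: pop_def)
    have found1: "reg s1 rFound = 0" using frame_reg[OF f1, of rFound] found by (simp add: pop_def)
    note L = s1(2)[folded L_def]
    note tr = s1(3)[unfolded L]
    have ent1: "entries (arr s1 aTrail) st"
      and p1: "\<And>y. y \<in> set st \<Longrightarrow> path (arr s1 aTrail) y = path ?T y"
      and fx: "\<And>y. y \<in> set st \<Longrightarrow> fst y \<le> fst x"
      using entries_butlast[OF ent, of "arr s1 aTrail"] s1(4) by blast+
    show "run W X (If (Less (Reg rK) (Reg rLen)) Skip node) s1
      (\<lambda>s'. invariant s' \<and> potential s' + 1 \<le> potential s)"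
    proof (rule run_If)
      have "L < W" using length_le_m[OF px] L_def by (intro fits_linear) simp
      then show "bfits W (Less (Reg rK) (Reg rLen)) s1"
        using st1 L by (simp add: static_def)
      assume "bval (Less (Reg rK) (Reg rLen)) s1"
      then have "\<not> solvable (ids_edges (path ?T x))"
        using st1 L solvable_length[OF px] by (auto simp: static_def L_def)
      then have "solvable {} \<Longrightarrow> \<exists>y \<in> set st. solvable (ids_edges (path (arr s1 aTrail) y))"
        using sol p1 by auto
      then have "invariant s1" using st1 ent1 s1(1) found1 by (simp add: invariant_def)
      moreover have "potential s1 + 1 \<le> potential s"
        using weight_ge[of x] by (simp add: pot) (simp add: potential_def s1(1))
      ultimately show "run W X Skip s1 (\<lambda>s'. invariant s' \<and> potential s' + 1 \<le> potential s)"
        using X1 by (intro run_loop_free) auto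
    next
      assume "\<not> bval (Less (Reg rK) (Reg rLen)) s1"
      then have Lk: "L \<le> k" using st1 L by (simp add: static_def)
      define D where "D = ids_edges (map (arr s1 aTrail) [0..<L])"
      have D: "D = ids_edges (path ?T x)" by (simp add: D_def tr)
      have lst: "length st \<le> 6 * L" using x by (simp add: entry_def L_def)
      have T1: "\<forall>i < L. arr s1 aTrail i \<in> {1..m}"
      proof (intro allI impI)
        fix i assume "i < L"
        then have "arr s1 aTrail i \<in> set (map (arr s1 aTrail) [0..<L])" by simp
        then show "arr s1 aTrail i \<in> {1..m}" unfolding tr using px by blast
      qed
      have DE: "D \<subseteq> E" unfolding D by (rule ids_edges_subset[OF px(2)])
      have cD: "card D = L" unfolding D L_def by (rule card_ids_edges[OF px])
      have "run W X node s1 (\<lambda>s'.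
        reg s' rFound = 1 \<and> (\<forall>a b c d. \<not> obstruction (E - D) a b c d) \<and>
          (\<forall>i < L. {arr s' aOutU i, arr s' aOutV i} = edge (arr s1 aTrail i - 1)) \<and>
          stack (arr s') (reg s' rTop) = st \<and> reg s' rLen = L \<or>
        reg s' rFound = 0 \<and> branched D st L s')"
        using lst Lk length_le_m[OF px]
        by (intro run_node[OF st1 s1(1) _ L Lk _ T1 D_def found1 X]) (simp_all add: L_def)
      then show "run W X node s1 (\<lambda>s'. invariant s' \<and> potential s' + 1 \<le> potential s)"
      proof (rule run_frame)
        fix s' assume f': "frame node s1 s'" and cases:
          "reg s' rFound = 1 \<and> (\<forall>a b c d. \<not> obstruction (E - D) a b c d) \<and>
            (\<forall>i < L. {arr s' aOutU i, arr s' aOutV i} = edge (arr s1 aTrail i - 1)) \<and>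
            stack (arr s') (reg s' rTop) = st \<and> reg s' rLen = L \<or>
          reg s' rFound = 0 \<and> branched D st L s'"
        have st': "static (reg s') (arr s')" and tr': "arr s' aTrail = arr s1 aTrail"
          using node_frame[OF f'] st1 by blast+
        from cases show "invariant s' \<and> potential s' + 1 \<le> potential s"
        proof (elim disjE conjE)
          assume c: "reg s' rFound = 1" "\<forall>a b c d. \<not> obstruction (E - D) a b c d"
            "\<forall>i < L. {arr s' aOutU i, arr s' aOutV i} = edge (arr s1 aTrail i - 1)"
            "stack (arr s') (reg s' rTop) = st" "reg s' rLen = L"
          have "{{arr s' aOutU i, arr s' aOutV i} | i. i < L} = (\<lambda>i. {arr s' aOutU i, arr s' aOutV i}) ` {0..<L}"
            by auto
          also have "\<dots> = (\<lambda>i. edge (arr s1 aTrail i - 1)) ` {0..<L}"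
            using c(3) by (intro image_cong) auto
          also have "\<dots> = D" by (simp add: D_def ids_edges_def image_image)
          finally have "{{arr s' aOutU i, arr s' aOutV i} | i. i < L} = D" .
          moreover have "tp_deletion_set ({..<n}, E) k D"
            using DE cD Lk trivially_perfect_iff[OF simple_graph_Diff[OF G]] c(2)
            by (simp add: tp_deletion_set_def)
          ultimately have "invariant s'" using st' c ent1 tr' by (simp add: invariant_def)
          moreover have "potential s' + 1 \<le> potential s"
            using weight_ge[of x] by (simp add: pot) (simp add: potential_def c(4))
          ultimately show ?thesis by blast
        next
          assume found': "reg s' rFound = 0" and "branched D st L s'"
          then obtain idss where b: "branching D idss"
            and stk': "stack (arr s') (reg s' rTop) = st @ map (Pair L) idss" by (auto simp: branched_def)
          have fL: "fst y \<le> L" if "y \<in> set st" for y using fx[OF that] by (simp add: L_def)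
          have "entries (arr s1 aTrail) (st @ map (Pair L) idss)"
            using b px unfolding D_def by (intro entries_append[OF ent1 fL lst Lk]) (simp_all add: tr)
          moreover have "\<exists>y \<in> set (st @ map (Pair L) idss). solvable (ids_edges (path (arr s1 aTrail) y))"
            if "solvable {}"
          proof -
            from sol[OF that] consider y where "y \<in> set st" "solvable (ids_edges (path ?T y))" | "solvable D"
              by (auto simp: D)
            then show ?thesis
            proof cases
              case 1
              then show ?thesis using p1[OF 1(1)] by (intro bexI[where x = y]) simp_all
            next
              case 2
              then obtain ids where ids: "ids \<in> set idss" "solvable (D \<union> ids_edges ids)"
                using b by (auto simp: branching_def solvable_def)
              have "ids_edges (path (arr s1 aTrail) (L, ids)) = D \<union> ids_edges ids"
                by (simp add: path_def D_def ids_edges_def image_Un)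
              then show ?thesis using ids by (intro bexI[where x = "(L, ids)"]) auto
            qed
          qed
          ultimately have "invariant s'" using st' stk' tr' found' by (simp add: invariant_def)
          moreover have "potential s' = (\<Sum>y\<leftarrow>st. weight y) + (\<Sum>y\<leftarrow>map (Pair L) idss. weight y)"
            by (simp add: potential_def stk')
          then have "potential s' + 1 \<le> potential s"
            unfolding pot using weight_branching[OF b Lk, of x] by (simp add: L_def)
          ultimately show ?thesis by blast
        qed
      qed
    qed (rule X1)
  qed
qed

lemma exec_tp_program:
  assumes X: "X = n + 2 * m + 2"
  shows "\<exists>t s. exec W tp_program (input n es k) t s \<and> correct_answer ({..<n}, E) k (answer s) \<and>
    real t \<le> tp_cost * real X * (10000 / 3 * 2.450 ^ (k + 3) + 1)"
proof -
  from init[of X] X obtain t s where init: "exec W init (input n es k) t s" "t \<le> linear_cost init * X"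
    and s: "static (reg s) (arr s)" "reg s rTop = 1" "reg s rFound = 0" "arr s aLev 0 = 0" "arr s aCnt 0 = 0"
    unfolding run_def by auto
  have stk: "stack (arr s) (reg s rTop) = [(0, [])]" using s by (simp add: stack_def)
  then have inv: "invariant s"
    using s by (simp add: invariant_def entries_def entry_def path_def ids_edges_def)
  have fits: "bfits W unfinished r" if "invariant r" for r
  proof -
    have ent: "entries (arr r aTrail) (stack (arr r) (reg r rTop))" using that by (simp add: invariant_def)
    \<comment> \<open>The position bound of \<open>entry\<close> is applied to the top entry, at
      position \<open>rTop - 1\<close>.\<close>
    have "reg r rTop \<le> 6 * (k + 3) + 1"
    proof (cases "reg r rTop")
      case (Suc t)
      then have "entry (arr r aTrail) t (stack (arr r) (reg r rTop) ! t)" using ent by (simp add: entries_def)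
      then show ?thesis using Suc by (simp add: entry_def)
    qed simp
    then have "reg r rTop < W" by (intro fits_linear) simp
    moreover have "reg r rFound < W" using that by (auto simp: invariant_def)
    ultimately show ?thesis by (simp add: unfinished_def)
  qed
  have "run W X step r (\<lambda>s'. invariant s' \<and> potential s' + 1 \<le> potential r)"
    if "invariant r" "bval unfinished r" for r
    using run_step[OF that] X by simp
  from While_potential[where J = invariant and \<Phi> = potential, OF inv potential_nonneg fits this]
  obtain u s' where loop: "exec W (While unfinished step) s u s'"
      "real u \<le> real (linear_cost (While unfinished step) * X) * (potential s + 1)"
    and s': "invariant s'" "\<not> bval unfinished s'"
    using X by auto
  have "correct_answer ({..<n}, E) k (answer s')"
  proof (cases "reg s' rFound = 0")
    case True
    then have "reg s' rTop = 0" using s'(2) by (simp add: unfinished_def)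
    then have "\<not> solvable {}" using s'(1) True by (auto simp: invariant_def stack_def)
    then show ?thesis using True by (simp add: correct_answer_def answer_def solvable_def extendable_def)
  next
    case False
    then show ?thesis using s'(1) by (simp add: invariant_def correct_answer_def answer_def)
  qed
  moreover have "exec W tp_program (input n es k) (1 + t + u) s'"
    unfolding tp_program_def by (rule exec.Seq[OF init(1) loop(1)])
  moreover have "real (1 + t + u) \<le> tp_cost * real X * (10000 / 3 * 2.450 ^ (k + 3) + 1)"
  proof -
    let ?P = "10000 / 3 * 2.450 ^ (k + 3) + 1 :: real"
    have P: "potential s + 1 = ?P" by (simp add: potential_def stk weight_def)
    have "1 + t \<le> (1 + linear_cost init) * X" using init(2) X by simp
    then have "real (1 + t) \<le> real ((1 + linear_cost init) * X)" by (rule of_nat_mono)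
    also have "\<dots> * 1 \<le> real ((1 + linear_cost init) * X) * ?P" by (intro mult_left_mono) auto
    finally have "real (1 + t) \<le> real ((1 + linear_cost init) * X) * ?P" by simp
    then have "real (1 + t + u) \<le> real ((1 + linear_cost init) * X) * ?P + real (linear_cost (While unfinished step) * X) * ?P"
      using loop(2) unfolding P of_nat_add by linarith
    then show ?thesis by (simp only: tp_cost_def of_nat_add of_nat_mult of_nat_1 distrib_right)
  qed
  ultimately show ?thesis by blast
qed

end

text \<open>A polynomial word bound means words of logarithmic length, so unit cost cannot be
  exploited through huge numbers. Without vertices the right-hand side of the time bound is 0, while
  every execution takes some time; hence the guard \<open>0 < n\<close>.\<close>

theorem theorem3:
  "\<exists>(p :: com) (d :: nat) (C :: real).
     \<forall>(n :: nat) (E :: nat set set) (es :: (nat \<times> nat) list) (k :: nat).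
       simple_graph ({..<n}, E) \<and> edge_list E es \<and> 0 < k \<longrightarrow>
       (\<exists>t s. exec ((n + card E + k + 2) ^ d) p (input n es k) t s \<and>
              correct_answer ({..<n}, E) k (answer s) \<and>
              (0 < n \<longrightarrow> real t \<le> C * (2.450 ^ k * real (n + card E))))"
proof (rule exI[where x = tp_program], rule exI[where x = 9],
    rule exI[where x = "tp_cost * 4 * (10000 / 3 * 2.450 ^ 3 + 1)"],
    intro allI impI)
  fix n :: nat and E es and k :: nat
  assume a: "simple_graph ({..<n}, E) \<and> edge_list E es \<and> 0 < k"
  let ?N = "n + card E + k + 2" and ?X = "n + 2 * length es + 2"
  have m: "card E = length es"
  proof -
    from a have "distinct (map (\<lambda>(u, v). {u, v}) es)" "E = set (map (\<lambda>(u, v). {u, v}) es)"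
      by (auto simp: edge_list_def)
    then show ?thesis using distinct_card by fastforce
  qed
  have nine: "x ^ 7 * (x * x) = x ^ 9" for x :: nat
    using power_add[of x 7 2] by (simp add: power2_eq_square)
  \<comment> \<open>The exponent 9: as \<open>?N\<close> is at least 2, seven factors absorb the
    constant 100, and two supply the square that the instance asks for.\<close>
  have "100 * (?N * ?N) \<le> 2 ^ 7 * (?N * ?N)" by (intro mult_le_mono1) simp
  also have "\<dots> \<le> ?N ^ 7 * (?N * ?N)" by (intro mult_le_mono1 power_mono) auto
  also have "\<dots> = ?N ^ 9" by (rule nine)
  finally interpret tp_instance n E es k "?N ^ 9"
    using a by unfold_locales (simp_all add: m)
  from exec_tp_program[OF refl] obtain t s where
    e: "exec (?N ^ 9) tp_program (input n es k) t s" "correct_answer ({..<n}, E) k (answer s)"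
    and t: "real t \<le> tp_cost * real ?X * (10000 / 3 * 2.450 ^ (k + 3) + 1)"
    by blast
  have "real t \<le> tp_cost * 4 * (10000 / 3 * 2.450 ^ 3 + 1) * (2.450 ^ k * real (n + card E))" if "0 < n"
  proof -
    \<comment> \<open>With at least one vertex, the additive 2 is absorbed by
      \<open>2 * n\<close>.\<close>
    have "?X \<le> 4 * (n + card E)" using that m by simp
    then have X: "real ?X \<le> 4 * real (n + card E)" using of_nat_mono[of ?X "4 * (n + card E)"] by simp
    \<comment> \<open>Moves the additive 1 under the factor \<open>2.450 ^ k\<close>.\<close>
    have "a * (x * y) + 1 \<le> (a * y + 1) * x" if "1 \<le> x" for a x y :: real
      using that by (simp add: algebra_simps)
    moreover have "1 \<le> (2.450 :: real) ^ k" by (rule one_le_power) simp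
    ultimately have P: "10000 / 3 * 2.450 ^ (k + 3) + 1 \<le> (10000 / 3 * 2.450 ^ 3 + 1) * (2.450 :: real) ^ k"
      unfolding power_add by blast
    have "tp_cost * real ?X * (10000 / 3 * 2.450 ^ (k + 3) + 1) \<le>
        tp_cost * (4 * real (n + card E)) * ((10000 / 3 * 2.450 ^ 3 + 1) * 2.450 ^ k)"
      using X P by (intro mult_mono) (auto simp: tp_cost_def)
    also have "\<dots> = tp_cost * 4 * (10000 / 3 * 2.450 ^ 3 + 1) * (2.450 ^ k * real (n + card E))"
      by (simp only: mult_ac)
    finally show ?thesis using t by simp
  qed
  with e show "\<exists>t s. exec (?N ^ 9) tp_program (input n es k) t s \<and> correct_answer ({..<n}, E) k (answer s) \<and>
    (0 < n \<longrightarrow> real t \<le> tp_cost * 4 * (10000 / 3 * 2.450 ^ 3 + 1) * (2.450 ^ k * real (n + card E)))"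
    by blast
qed

end
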